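(* Let $d\ge 1$ and consider the switching diffusion $(X_t,Z_t)$ described in the context. Assume that there exist constants $M,r_-,r_+>0$ and $R_-,R_+$ such that for all $x\in\mathbb R^d$ with $|x|\ge M$, $$ x\cdot b_-(x)\le -r_-,\qquad x\cdot b_+(x)\le r_+,\qquad x\cdot b_-(x)\ge -R_-,\qquad x\cdot b_+(x)\ge R_+, $$ and that $$ \frac{6r_- -(3d+12)}{\lambda_-} > \frac{6r_+ +(3d+12)}{\lambda_+}. $$ Then the process $(X,Z)$ is 2-recurrent in the following sense: there exists $C>0$ such that for every $M_1$ large enough, all $x\in\mathbb R^d$ and $z\in\{0,1\}$, $$ \mathsf E_{x,z}\,\tau_{M_1}^2\le C(|x|^6+1),\qquad \text{where } \tau_{M_1}:=\inf\{t\ge 0: |X_t|\le M_1\}. $$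
   Context: $W$ is a standard $d$-dimensional Wiener process; $Z$ is a càdlàg continuous-time Markov process on $\{0,1\}$, independent of $W$, with constant transition intensities $\lambda_->0$ (from $0$ to $1$) and $\lambda_+>0$ (from $1$ to $0$). The drift $b:\mathbb R^d\times\{0,1\}\to\mathbb R^d$ is bounded and Borel measurable, $b_-(x):=b(x,0)$, $b_+(x):=b(x,1)$, and $X$ is the (strong) solution of $dX_t=b(X_t,Z_t)\,dt+dW_t$, $X_0=x$, $Z_0=z$. $\mathsf P_{x,z},\mathsf E_{x,z}$ denote probability and expectation for initial data $(x,z)$; $x\cdot y$ is the Euclidean inner product. *)

theory Defs
  imports "HOL-Probability.Probability"
begin

definition gauss_density :: "real \<Rightarrow> 'v::euclidean_space \<Rightarrow> real" where
  "gauss_density s y = (2 * pi * s) powr (- real DIM('v) / 2) * exp (- ((norm y) ^ 2) / (2 * s))"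

definition std_wiener :: "'a measure \<Rightarrow> (real \<Rightarrow> 'a \<Rightarrow> 'v::euclidean_space) \<Rightarrow> bool" where
  "std_wiener M W \<longleftrightarrow>
     prob_space M \<and>
     (\<forall>t\<ge>0. W t \<in> borel_measurable M) \<and>
     (AE \<omega> in M. W 0 \<omega> = 0) \<and>
     (AE \<omega> in M. continuous_on {0..} (\<lambda>t. W t \<omega>)) \<and>
     (\<forall>s t. 0 \<le> s \<and> s < t \<longrightarrow>
        distributed M lborel (\<lambda>\<omega>. W t \<omega> - W s \<omega>) (\<lambda>y. ennreal (gauss_density (t - s) y))) \<and>
     (\<forall>n (t::nat \<Rightarrow> real). 0 \<le> t 0 \<and> (\<forall>i<n. t i \<le> t (Suc i)) \<longrightarrow>
        prob_space.indep_vars M (\<lambda>_. borel) (\<lambda>i \<omega>. W (t (Suc i)) \<omega> - W (t i) \<omega>) {..<n})"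

text \<open>Transition probabilities p_t(i,j) of the Markov chain on {0,1} with intensity lm from 0 to 1
  and lp from 1 to 0 (i.e. the entries of exp(tQ), Q = [[-lm, lm], [lp, -lp]]).\<close>
definition two_state_trans :: "real \<Rightarrow> real \<Rightarrow> real \<Rightarrow> nat \<Rightarrow> nat \<Rightarrow> real" where
  "two_state_trans lm lp t i j =
     (let q = lm + lp; e = 1 - exp (- q * t) in
      if i = 0 \<and> j = 1 then lm / q * e
      else if i = 0 \<and> j = 0 then 1 - lm / q * e
      else if i = 1 \<and> j = 0 then lp / q * e
      else if i = 1 \<and> j = 1 then 1 - lp / q * e
      else 0)"

definition two_state_chain :: "'a measure \<Rightarrow> real \<Rightarrow> real \<Rightarrow> nat \<Rightarrow> (real \<Rightarrow> 'a \<Rightarrow> nat) \<Rightarrow> bool" where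
  "two_state_chain M lm lp z Z \<longleftrightarrow>
     prob_space M \<and>
     (\<forall>t\<ge>0. Z t \<in> measurable M (count_space UNIV)) \<and>
     (\<forall>t\<ge>0. \<forall>\<omega>\<in>space M. Z t \<omega> \<in> {0, 1}) \<and>
     (AE \<omega> in M. Z 0 \<omega> = z) \<and>
     (AE \<omega> in M. \<forall>t\<ge>0. continuous (at_right t) (\<lambda>s. Z s \<omega>) \<and>
                         (0 < t \<longrightarrow> (\<exists>l. ((\<lambda>s. Z s \<omega>) \<longlongrightarrow> l) (at_left t)))) \<and>
     (\<forall>n (t::nat \<Rightarrow> real) (i::nat \<Rightarrow> nat). t 0 = 0 \<and> i 0 = z \<and> (\<forall>k<n. t k \<le> t (Suc k)) \<longrightarrow>
        measure M {\<omega> \<in> space M. \<forall>k\<in>{1..n}. Z (t k) \<omega> = i k} =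
        (\<Prod>k\<in>{1..n}. two_state_trans lm lp (t k - t (k - 1)) (i (k - 1)) (i k)))"

definition switch_filtr :: "'a measure \<Rightarrow> (real \<Rightarrow> 'a \<Rightarrow> 'v::euclidean_space) \<Rightarrow> (real \<Rightarrow> 'a \<Rightarrow> nat) \<Rightarrow> real \<Rightarrow> 'a measure" where
  "switch_filtr M W Z t = sigma (space M)
     ((\<Union>s\<in>{0..t}. {W s -` A \<inter> space M | A. A \<in> sets borel} \<union> {Z s -` {k} \<inter> space M | k. True})
      \<union> null_sets M)"

text \<open>(W, Z, X) on M: W standard Wiener, Z the switching chain started at z, independent of W,
  and X the strong solution of dX = b(X,Z) dt + dW, X_0 = x (additive noise, so pathwise integral form).\<close>
definition switching_solution ::
  "'a measure \<Rightarrow> real \<Rightarrow> real \<Rightarrow> ('v::euclidean_space \<Rightarrow> nat \<Rightarrow> 'v) \<Rightarrow> 'v \<Rightarrow> nat \<Rightarrow>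
   (real \<Rightarrow> 'a \<Rightarrow> 'v) \<Rightarrow> (real \<Rightarrow> 'a \<Rightarrow> nat) \<Rightarrow> (real \<Rightarrow> 'a \<Rightarrow> 'v) \<Rightarrow> bool" where
  "switching_solution M lm lp b x z W Z X \<longleftrightarrow>
     std_wiener M W \<and> two_state_chain M lm lp z Z \<and>
     prob_space.indep_set M
        (sets (vimage_algebra (space M) (\<lambda>\<omega>. \<lambda>t\<in>{0..}. W t \<omega>) (Pi\<^sub>M {0..} (\<lambda>_. borel))))
        (sets (vimage_algebra (space M) (\<lambda>\<omega>. \<lambda>t\<in>{0..}. Z t \<omega>) (Pi\<^sub>M {0..} (\<lambda>_. count_space UNIV)))) \<and>
     (\<forall>t\<ge>0. X t \<in> borel_measurable (switch_filtr M W Z t)) \<and>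
     (AE \<omega> in M. \<forall>t\<ge>0. set_integrable lborel {0..t} (\<lambda>s. b (X s \<omega>) (Z s \<omega>)) \<and>
                         X t \<omega> = x + (LINT s:{0..t}|lborel. b (X s \<omega>) (Z s \<omega>)) + W t \<omega>)"

text \<open>tau_{M1} = inf {t >= 0. |X_t| <= M1}, with inf {} = infinity.\<close>
definition hit_time :: "(real \<Rightarrow> 'a \<Rightarrow> 'v::real_normed_vector) \<Rightarrow> real \<Rightarrow> 'a \<Rightarrow> ennreal" where
  "hit_time X M1 \<omega> = (INF t\<in>{t. 0 \<le> t \<and> norm (X t \<omega>) \<le> M1}. ennreal t)"

end

theory Submission
  imports Defs
begin

text \<open>
  Sample the process at the multiples of a fixed small step \<open>h\<close>: the first grid time at which
  \<open>|X| \<le> M1\<close> bounds the hitting time from above, so no stochastic calculus is needed. With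
  \<open>V = |X|^4 + \<delta> |X|^2 Z\<close> the jump term contributes \<open>\<delta> \<lambda>\<^sub>-\<close> in state 0 and \<open>- \<delta> \<lambda>\<^sub>+\<close> in state 1 at
  order \<open>|X|^2\<close>, and the hypothesis on the rates is what allows a \<open>\<delta>\<close> for which both states drift
  downwards. The increments of \<open>W\<close> and \<open>Z\<close> over one step are controlled given the past, \<open>h\<close> is taken
  small enough to absorb the errors of order \<open>h^(3/2)\<close>, and then \<open>M1\<close> large enough to absorb the terms
  of lower order in \<open>|X|\<close>; hence \<open>E(Y V') \<le> E(Y V) - \<epsilon> h E(Y |X|^2)\<close> for all weights \<open>Y\<close> in \<open>[0, 1]\<close> that
  depend on the past and vanish on \<open>|X| < M1\<close>. Taking \<open>Y\<close> proportional to \<open>1/\<surd>V\<close> and using concavity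
  of the square root, \<open>U = \<surd>V\<close> loses a constant amount per step. If \<open>A\<^sub>k\<close> is the event that the grid
  has not been hit up to index \<open>k\<close>, the expectation of \<open>k U\<^sub>k + \<rho> V\<^sub>k\<close> on \<open>A\<^sub>k\<close> then telescopes and
  bounds the sum of \<open>(k + 1) P(A\<^sub>k)\<close>, that is, the second moment, by a multiple of \<open>V\<close> at time 0.
\<close>

text \<open>Origin of the constants: to first order in \<open>h\<close>, the fourth power of the
  norm gains \<open>h * (norm (X t))\<^sup>2\<close> times 4 X.b + 2d + 4. Bounding X.b and adding
  the jump term gives the rates 2d + 4 - 4 \<open>rm\<close> + \<open>\<delta> * lm\<close> in state
  0 and 2d + 4 + 4 \<open>rp\<close> - \<open>\<delta> * lp\<close> in state 1. Both are at most -4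
  iff (4 \<open>rp\<close> + 2d + 8) / \<open>lp\<close> <= \<open>\<delta>\<close> <= (4
  \<open>rm\<close> - 2d - 8) / \<open>lm\<close>; multiplied by 3/2, the hypothesis says exactly
  that this interval has nonempty interior. \<open>\<delta>\<close> is its left end, and -4 leaves
  room for the errors of a small step. The obstacle is the expected drift over one step:
  \<open>b\<close> is merely bounded and measurable in the argument, and no joint measurability of
  \<open>X\<close> or \<open>Z\<close> in time and outcome is assumed, so Fubini is not at hand. The
  integrand is therefore dominated pathwise by a right-continuous function of time built from
  \<open>Z\<close> and \<open>W\<close> alone, the time integral by a liminf of Riemann sums, and
  Fatou is applied to the outcome. Conditional expectations never appear: integrals against
  arbitrary nonnegative past-measurable weights take their place.\<close>

section \<open>Moments of Gaussian increments\<close>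

lemma gauss_density_nonneg [simp]: "0 \<le> gauss_density s y"
  by (simp add: gauss_density_def)

lemma borel_measurable_gauss_density [measurable]: "gauss_density s \<in> borel_measurable borel"
  unfolding gauss_density_def by measurable

lemma power2_norm_eq_sum_Basis: "(norm (y::'v::euclidean_space))\<^sup>2 = (\<Sum>i\<in>Basis. (y \<bullet> i)\<^sup>2)"
  by (simp add: power2_norm_eq_inner euclidean_inner[of y y] power2_eq_square[of "y \<bullet> _"])

lemma gauss_density_eq_prod:
  fixes y :: "'v::euclidean_space"
  assumes "0 < s"
  shows "gauss_density s y = (\<Prod>i\<in>Basis. normal_density 0 (sqrt s) (y \<bullet> i))"
proof -
  have "(\<Prod>i\<in>(Basis :: 'v set). normal_density 0 (sqrt s) (y \<bullet> i))
      = (\<Prod>i\<in>(Basis :: 'v set). 1 / sqrt (2 * pi * s)) * (\<Prod>i\<in>Basis. exp (- (y \<bullet> i)\<^sup>2 / (2 * s)))"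
    using assms by (subst prod.distrib[symmetric]) (simp add: normal_density_def)
  also have "(\<Prod>i\<in>(Basis :: 'v set). exp (- (y \<bullet> i)\<^sup>2 / (2 * s))) = exp (- (norm y)\<^sup>2 / (2 * s))"
  proof -
    show ?thesis
      by (simp add: power2_norm_eq_sum_Basis exp_sum[symmetric] sum_divide_distrib sum_negf)
  qed
  also have "(\<Prod>i\<in>(Basis :: 'v set). 1 / sqrt (2 * pi * s)) = (2 * pi * s) powr (- real DIM('v) / 2)"
  proof -
    have "1 / sqrt (2 * pi * s) = (2 * pi * s) powr (-1/2)"
      using assms by (simp add: powr_minus powr_half_sqrt divide_simps)
    then show ?thesis
      using assms by (simp add: powr_power)
  qed
  finally show ?thesis by (simp add: gauss_density_def)
qed

text \<open>The density is a product over coordinates, and every factor except the one along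
  \<open>i\<close> integrates to 1.\<close>

lemma distributed_gauss_component:
  fixes \<xi> :: "'a \<Rightarrow> 'v::euclidean_space"
  assumes \<xi>: "distributed P lborel \<xi> (\<lambda>y. ennreal (gauss_density s y))" and "0 < s" and i: "i \<in> Basis"
  shows "distributed P lborel (\<lambda>\<omega>. \<xi> \<omega> \<bullet> i) (\<lambda>r. ennreal (normal_density 0 (sqrt s) r))"
  unfolding distributed_def
proof (intro conjI measure_eqI)
  have [measurable]: "\<xi> \<in> borel_measurable P"
    using distributed_measurable[OF \<xi>] by simp
  show "(\<lambda>\<omega>. \<xi> \<omega> \<bullet> i) \<in> measurable P lborel" by simp
  fix A assume "A \<in> sets (distr P lborel (\<lambda>\<omega>. \<xi> \<omega> \<bullet> i))"
  then have [measurable]: "A \<in> sets borel" by simp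
  \<comment> \<open>The indicator is attached to the factor of coordinate \<open>i\<close>, so that
    the whole integrand stays a product over \<open>Basis\<close> and the integral
    factorises.\<close>
  have *: "ennreal (gauss_density s y) * indicator A (y \<bullet> i) =
      (\<Prod>j\<in>Basis. ennreal (normal_density 0 (sqrt s) (y \<bullet> j)) * (if j = i then indicator A (y \<bullet> j) else 1))" for y :: 'v
    using \<open>0 < s\<close> i by (simp add: gauss_density_eq_prod prod.distrib prod_ennreal prod.delta)
  have "emeasure (distr P lborel (\<lambda>\<omega>. \<xi> \<omega> \<bullet> i)) A = (\<integral>\<^sup>+ \<omega>. indicator A (\<xi> \<omega> \<bullet> i) \<partial>P)"
    by (subst emeasure_distr) (auto simp: nn_integral_indicator[symmetric] intro!: nn_integral_cong split: split_indicator simp del: nn_integral_indicator)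
  also have "\<dots> = (\<integral>\<^sup>+ y. ennreal (gauss_density s y) * indicator A (y \<bullet> i) \<partial>lborel)"
    by (rule distributed_nn_integral[OF \<xi>, symmetric]) simp
  also have "\<dots> = (\<Prod>j\<in>(Basis::'v set). \<integral>\<^sup>+ r. ennreal (normal_density 0 (sqrt s) r) * (if j = i then indicator A r else 1) \<partial>lborel)"
    unfolding * by (rule nn_integral_lborel_prod) auto
  also have "\<dots> = (\<Prod>j\<in>(Basis::'v set). if j = i then (\<integral>\<^sup>+ r. ennreal (normal_density 0 (sqrt s) r) * indicator A r \<partial>lborel) else 1)"
    using \<open>0 < s\<close> by (intro prod.cong) (auto simp: nn_integral_eq_integral)
  also have "\<dots> = (\<integral>\<^sup>+ r. ennreal (normal_density 0 (sqrt s) r) * indicator A r \<partial>lborel)"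
    using i by (simp add: prod.delta)
  also have "\<dots> = emeasure (density lborel (\<lambda>r. ennreal (normal_density 0 (sqrt s) r))) A"
    by (simp add: emeasure_density)
  finally show "emeasure (distr P lborel (\<lambda>\<omega>. \<xi> \<omega> \<bullet> i)) A =
      emeasure (density lborel (\<lambda>r. ennreal (normal_density 0 (sqrt s) r))) A" .
qed auto

lemma gauss_component_moments:
  fixes \<xi> :: "'a \<Rightarrow> 'v::euclidean_space"
  assumes \<xi>: "distributed P lborel \<xi> (\<lambda>y. ennreal (gauss_density s y))" and s: "0 < s" and i: "i \<in> Basis"
  shows "integrable P (\<lambda>\<omega>. \<xi> \<omega> \<bullet> i)" "(\<integral>\<omega>. \<xi> \<omega> \<bullet> i \<partial>P) = 0"
    "integrable P (\<lambda>\<omega>. (\<xi> \<omega> \<bullet> i)\<^sup>2)" "(\<integral>\<omega>. (\<xi> \<omega> \<bullet> i)\<^sup>2 \<partial>P) = s"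
    "integrable P (\<lambda>\<omega>. (\<xi> \<omega> \<bullet> i) ^ 4)" "(\<integral>\<omega>. (\<xi> \<omega> \<bullet> i) ^ 4 \<partial>P) = 3 * s\<^sup>2"
proof -
  note D = distributed_gauss_component[OF assms]
  have [simp]: "0 < sqrt s" using s by simp
  have int: "integrable P (\<lambda>\<omega>. (\<xi> \<omega> \<bullet> i) ^ k)" for k
    using distributed_integrable[OF D, of "\<lambda>r. r ^ k"] integrable_normal_moment[of "sqrt s" 0 k] s by simp
  have eq: "(\<integral>\<omega>. (\<xi> \<omega> \<bullet> i) ^ k \<partial>P) = (\<integral>r. normal_density 0 (sqrt s) r * (r - 0) ^ k \<partial>lborel)" for k
    using distributed_integral[OF D, of "\<lambda>r. r ^ k"] by simp
  show "integrable P (\<lambda>\<omega>. \<xi> \<omega> \<bullet> i)" "integrable P (\<lambda>\<omega>. (\<xi> \<omega> \<bullet> i)\<^sup>2)" "integrable P (\<lambda>\<omega>. (\<xi> \<omega> \<bullet> i) ^ 4)"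
    using int[of 1] int[of 2] int[of 4] by simp_all
  show "(\<integral>\<omega>. \<xi> \<omega> \<bullet> i \<partial>P) = 0"
    using eq[of 1] integral_normal_moment_odd[of "sqrt s" 0 0] s by simp
  show "(\<integral>\<omega>. (\<xi> \<omega> \<bullet> i)\<^sup>2 \<partial>P) = s"
    using eq[of 2] integral_normal_moment_even[of "sqrt s" 0 1] s by simp
  show "(\<integral>\<omega>. (\<xi> \<omega> \<bullet> i) ^ 4 \<partial>P) = 3 * s\<^sup>2"
    using eq[of 4] integral_normal_moment_even[of "sqrt s" 0 2] s
    by (simp add: fact_numeral power_divide power2_eq_square field_simps)
qed

text \<open>The density and Lebesgue measure are invariant under reflecting a single coordinate.\<close>

lemma gauss_component_uncorrelated:
  fixes \<xi> :: "'a \<Rightarrow> 'v::euclidean_space"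
  assumes \<xi>: "distributed P lborel \<xi> (\<lambda>y. ennreal (gauss_density s y))"
    and i: "i \<in> Basis" and j: "j \<in> Basis" and "i \<noteq> j"
  shows "(\<integral>\<omega>. (\<xi> \<omega> \<bullet> i) * (\<xi> \<omega> \<bullet> j) \<partial>P) = 0"
proof -
  define c :: "'v \<Rightarrow> real" where "c k = (if k = i then - 1 else 1)" for k
  define T :: "'v \<Rightarrow> 'v" where "T x = (\<Sum>k\<in>Basis. (c k * (x \<bullet> k)) *\<^sub>R k)" for x
  have [measurable]: "T \<in> borel_measurable borel" unfolding T_def by measurable
  have Tk: "T x \<bullet> k = c k * (x \<bullet> k)" if "k \<in> Basis" for x k
    using that by (simp add: T_def inner_sum_left inner_Basis if_distrib sum.delta cong: if_cong)
  have "(norm (T x))\<^sup>2 = (norm x)\<^sup>2" for x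
    unfolding power2_norm_eq_sum_Basis by (intro sum.cong) (simp_all add: Tk c_def)
  then have gT: "gauss_density s (T x) = gauss_density s x" for x
    by (simp add: gauss_density_def)
  have "lborel = density (distr lborel borel T) (\<lambda>_. (\<Prod>k\<in>Basis. \<bar>c k\<bar>))"
    using lborel_affine_euclidean[of c 0] by (simp add: T_def[abs_def] c_def)
  moreover have "(\<Prod>k\<in>Basis. \<bar>c k\<bar>) = 1" by (rule prod.neutral) (simp add: c_def)
  ultimately have lT: "lborel = distr lborel borel T"
    by (simp add: density_1)
  let ?f = "\<lambda>y::'v. gauss_density s y * ((y \<bullet> i) * (y \<bullet> j))"
  have "(\<integral>y. ?f y \<partial>lborel) = (\<integral>y. ?f (T y) \<partial>lborel)"
    by (subst lT, subst integral_distr) simp_all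
  also have "\<dots> = (\<integral>y. - ?f y \<partial>lborel)"
    using i j \<open>i \<noteq> j\<close> by (simp add: gT Tk c_def)
  finally have "(\<integral>y. ?f y \<partial>lborel) = 0" by simp
  then show ?thesis
    using distributed_integral[OF \<xi>, of "\<lambda>y. (y \<bullet> i) * (y \<bullet> j)"] by simp
qed

text \<open>The second moment has to be exact, since it enters the drift at leading order; the other
  two only feed error terms. The first moment is bounded through the nonnegativity of the variance
  of the norm, the fourth by Cauchy-Schwarz over the coordinates, which gives the crude factor 3
  d^2.\<close>

lemma gauss_norm_moments:
  fixes \<xi> :: "'a \<Rightarrow> 'v::euclidean_space" and s :: real
  assumes \<xi>: "distributed P lborel \<xi> (\<lambda>y. ennreal (gauss_density s y))" and s: "0 < s"
    and "prob_space P"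
  shows "integrable P (\<lambda>\<omega>. (norm (\<xi> \<omega>))\<^sup>2)" "(\<integral>\<omega>. (norm (\<xi> \<omega>))\<^sup>2 \<partial>P) = DIM('v) * s"
    "integrable P (\<lambda>\<omega>. norm (\<xi> \<omega>))" "(\<integral>\<omega>. norm (\<xi> \<omega>) \<partial>P) \<le> sqrt (DIM('v) * s)"
    "integrable P (\<lambda>\<omega>. (norm (\<xi> \<omega>)) ^ 4)" "(\<integral>\<omega>. (norm (\<xi> \<omega>)) ^ 4 \<partial>P) \<le> 3 * (DIM('v))\<^sup>2 * s\<^sup>2"
proof -
  interpret prob_space P by fact
  have [measurable]: "\<xi> \<in> borel_measurable P"
    using distributed_measurable[OF \<xi>] by simp
  note m = gauss_component_moments[OF \<xi> s]
  show i2: "integrable P (\<lambda>\<omega>. (norm (\<xi> \<omega>))\<^sup>2)" and e2: "(\<integral>\<omega>. (norm (\<xi> \<omega>))\<^sup>2 \<partial>P) = DIM('v) * s"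
    using m by (simp_all add: power2_norm_eq_sum_Basis)
  show i1: "integrable P (\<lambda>\<omega>. norm (\<xi> \<omega>))"
  proof (rule Bochner_Integration.integrable_bound)
    show "integrable P (\<lambda>\<omega>. 1 + (norm (\<xi> \<omega>))\<^sup>2)" using i2 by simp
    have "r \<le> 1 + r\<^sup>2" for r :: real
      using sum_squares_ge_zero[of "r - 1" r] by (simp add: power2_eq_square algebra_simps)
    then show "AE \<omega> in P. norm (norm (\<xi> \<omega>)) \<le> norm (1 + (norm (\<xi> \<omega>))\<^sup>2)"
      by (simp add: abs_of_nonneg add_nonneg_nonneg)
  qed simp
  have "(expectation (\<lambda>\<omega>. norm (\<xi> \<omega>)))\<^sup>2 \<le> expectation (\<lambda>\<omega>. (norm (\<xi> \<omega>))\<^sup>2)"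
    using variance_positive[of "\<lambda>\<omega>. norm (\<xi> \<omega>)"] variance_eq[OF i1 i2] by simp
  then show "(\<integral>\<omega>. norm (\<xi> \<omega>) \<partial>P) \<le> sqrt (DIM('v) * s)"
    unfolding e2 by (rule real_le_rsqrt)
  have le: "(norm (\<xi> \<omega>)) ^ 4 \<le> DIM('v) * (\<Sum>i\<in>Basis. (\<xi> \<omega> \<bullet> i) ^ 4)" for \<omega>
  proof -
    have "(norm (\<xi> \<omega>)) ^ 4 = (\<Sum>i\<in>Basis. (\<xi> \<omega> \<bullet> i)\<^sup>2)\<^sup>2"
      unfolding power2_norm_eq_sum_Basis[symmetric] by simp
    also have "\<dots> \<le> (\<Sum>i\<in>(Basis::'v set). 1\<^sup>2) * (\<Sum>i\<in>Basis. ((\<xi> \<omega> \<bullet> i)\<^sup>2)\<^sup>2)"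
      using Cauchy_Schwarz_ineq_sum[of "\<lambda>_. 1" "\<lambda>i. (\<xi> \<omega> \<bullet> i)\<^sup>2" "Basis :: 'v set"] by simp
    finally show ?thesis by simp
  qed
  have isum: "integrable P (\<lambda>\<omega>. DIM('v) * (\<Sum>i\<in>Basis. (\<xi> \<omega> \<bullet> i) ^ 4))"
    using m by simp
  show i4: "integrable P (\<lambda>\<omega>. (norm (\<xi> \<omega>)) ^ 4)"
    by (rule Bochner_Integration.integrable_bound[OF isum]) (use le in \<open>auto intro!: AE_I2 order_trans[OF _ abs_ge_self]\<close>)
  have "(\<integral>\<omega>. (norm (\<xi> \<omega>)) ^ 4 \<partial>P) \<le> (\<integral>\<omega>. DIM('v) * (\<Sum>i\<in>Basis. (\<xi> \<omega> \<bullet> i) ^ 4) \<partial>P)"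
    by (rule integral_mono[OF i4 isum le])
  also have "\<dots> = 3 * (DIM('v))\<^sup>2 * s\<^sup>2"
    using m by (simp add: power2_eq_square)
  finally show "(\<integral>\<omega>. (norm (\<xi> \<omega>)) ^ 4 \<partial>P) \<le> 3 * (DIM('v))\<^sup>2 * s\<^sup>2" .
qed

section \<open>Independence of increments and Markov property on cylinders\<close>

text \<open>Wiener process and chain are specified along nondecreasing sequences of times, while
  events of the past involve finite sets of times; this lists such a set, with the future time
  \<open>u\<close> appended. The last clause says that only index 0 carries time 0, which matters
  for the chain because its law prescribes the state at index 0.\<close>

lemma sorted_list_times:
  fixes I :: "real set"
  assumes "finite I" "I \<subseteq> {0..t}" "t \<in> I" "0 \<in> I" "t \<le> u"
  obtains n and \<tau> :: "nat \<Rightarrow> real" where "\<tau> 0 = 0" "\<tau> n = t" "\<tau> (Suc n) = u" "I = \<tau> ` {..n}"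
    "\<And>i. i \<le> n \<Longrightarrow> \<tau> i \<le> \<tau> (Suc i)"
    "\<And>i. 0 < i \<Longrightarrow> i \<le> n \<Longrightarrow> \<tau> i \<noteq> 0"
proof -
  define l where "l = sorted_list_of_set I"
  have l: "sorted l" "distinct l" "set l = I"
    using assms(1) by (simp_all add: l_def)
  define n where "n = length l - 1"
  have len: "length l = Suc n"
    using l(3) assms(3) by (cases l) (auto simp: n_def)
  have I: "I = (!) l ` {..n}"
    using l(3) len by (auto simp: set_conv_nth less_Suc_eq_le)
  have le: "l ! i \<le> l ! k" if "i \<le> k" "k \<le> n" for i k
    using l(1) len that by (auto intro: sorted_nth_mono)
  have "l ! 0 = 0"
  proof -
    obtain k where "k \<le> n" "l ! k = 0" using I assms(4) by auto
    moreover have "l ! 0 \<in> I" using I by auto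
    ultimately show ?thesis using le[of 0 k] assms(2) by fastforce
  qed
  have "l ! n = t"
  proof -
    obtain k where "k \<le> n" "l ! k = t" using I assms(3) by auto
    moreover have "l ! n \<in> I" using I by auto
    ultimately show ?thesis using le[of k n] assms(2) by fastforce
  qed
  show ?thesis
  proof (rule that[of "\<lambda>k. if k \<le> n then l ! k else u" n])
    show "(if i \<le> n then l ! i else u) \<le> (if Suc i \<le> n then l ! Suc i else u)" if "i \<le> n" for i
      using that le[of i "Suc i"] \<open>l ! n = t\<close> assms(5) by (cases "i = n") auto
    show "(if i \<le> n then l ! i else u) \<noteq> 0" if "0 < i" "i \<le> n" for i
      using that l(2) len \<open>l ! 0 = 0\<close> nth_eq_iff_index_eq[OF l(2), of i 0] by auto
    show "I = (\<lambda>k. if k \<le> n then l ! k else u) ` {..n}"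
      unfolding I by (rule image_cong) auto
  qed (use \<open>l ! 0 = 0\<close> \<open>l ! n = t\<close> in auto)
qed

text \<open>Since \<open>W\<close> starts at 0 almost surely, its values at past times are partial
  sums of the increments before \<open>t\<close>, and these are independent of the increment from
  \<open>t\<close> to \<open>u\<close>.\<close>

lemma wiener_increment_indep_cylinder:
  fixes W :: "real \<Rightarrow> 'a \<Rightarrow> 'v::euclidean_space"
  assumes W: "std_wiener P W" and I: "finite I" "I \<subseteq> {0..t}" and tu: "0 \<le> t" "t \<le> u"
    and A: "\<And>s. A s \<in> sets borel" and S: "S \<in> sets borel"
  shows "measure P {\<omega>\<in>space P. (\<forall>s\<in>I. W s \<omega> \<in> A s) \<and> W u \<omega> - W t \<omega> \<in> S} =
    measure P {\<omega>\<in>space P. \<forall>s\<in>I. W s \<omega> \<in> A s} * measure P {\<omega>\<in>space P. W u \<omega> - W t \<omega> \<in> S}"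
proof -
  \<comment> \<open>Time 0 makes the partial sums start from the known value of \<open>W\<close>,
    and time \<open>t\<close> makes the last increment exactly the one from \<open>t\<close> to
    \<open>u\<close>.\<close>
  have I': "finite (insert 0 (insert t I))" "insert 0 (insert t I) \<subseteq> {0..t}"
    "t \<in> insert 0 (insert t I)" "0 \<in> insert 0 (insert t I)"
    using I tu by auto
  obtain n and \<tau> :: "nat \<Rightarrow> real" where \<tau>: "\<tau> 0 = 0" "\<tau> n = t" "\<tau> (Suc n) = u" "insert 0 (insert t I) = \<tau> ` {..n}"
    "\<And>i. i \<le> n \<Longrightarrow> \<tau> i \<le> \<tau> (Suc i)"
    using sorted_list_times[OF I' tu(2)] by metis
  interpret prob_space P using W by (simp add: std_wiener_def)
  have Wm[measurable]: "0 \<le> s \<Longrightarrow> W s \<in> borel_measurable P" for s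
    using W by (simp add: std_wiener_def)
  define D where "D i \<omega> = W (\<tau> (Suc i)) \<omega> - W (\<tau> i) \<omega>" for i \<omega>
  have "indep_vars (\<lambda>_. borel) D {..<Suc n}"
    using W \<tau>(1,5) unfolding std_wiener_def D_def[abs_def] by (auto simp: less_Suc_eq_le)
  from indep_var_restrict[OF this, of "{..<n}" "{n}"]
  have ind: "indep_var (PiM {..<n} (\<lambda>_. borel)) (\<lambda>\<omega>. \<lambda>i\<in>{..<n}. D i \<omega>) (PiM {n} (\<lambda>_. borel)) (\<lambda>\<omega>. \<lambda>i\<in>{n}. D i \<omega>)"
    by auto
  \<comment> \<open>The constraints on \<open>W\<close> rewritten as constraints on increments; the
    guard \<open>\<tau> k \<in> I\<close> leaves the auxiliary times 0 and \<open>t\<close> free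
    unless they belong to \<open>I\<close>.\<close>
  define Y where "Y f \<longleftrightarrow> (\<forall>k\<in>{..n}. \<tau> k \<in> I \<longrightarrow> (\<Sum>i<k. f i) \<in> A (\<tau> k))" for f :: "nat \<Rightarrow> 'v"
  have [measurable]: "Y \<in> measurable (PiM {..<n} (\<lambda>_. borel)) (count_space UNIV)"
  proof -
    have [measurable]: "(\<lambda>f. (\<Sum>i<k. f i) \<in> A (\<tau> k)) \<in> measurable (PiM {..<n} (\<lambda>_. borel)) (count_space UNIV)" if "k \<le> n" for k
    proof -
      have [measurable]: "(\<lambda>f. \<Sum>i<k. f i) \<in> borel_measurable (PiM {..<n} (\<lambda>_. borel :: 'v measure))"
        using that by (intro borel_measurable_sum measurable_component_singleton) auto
      show ?thesis using A[of "\<tau> k"] by measurable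
    qed
    show ?thesis unfolding Y_def by measurable
  qed
  have "indep_var (count_space UNIV) (Y \<circ> (\<lambda>\<omega>. \<lambda>i\<in>{..<n}. D i \<omega>)) (count_space UNIV) ((\<lambda>f. f n \<in> S) \<circ> (\<lambda>\<omega>. \<lambda>i\<in>{n}. D i \<omega>))"
  proof (rule indep_var_compose[OF ind])
    have [measurable]: "(\<lambda>f. f n) \<in> measurable (PiM {n} (\<lambda>_. borel :: 'v measure)) borel"
      by (rule measurable_component_singleton) simp
    show "(\<lambda>f. f n \<in> S) \<in> measurable (PiM {n} (\<lambda>_. borel :: 'v measure)) (count_space UNIV)"
      using S by measurable
  qed measurable
  from indep_varD[OF this, of "{True}" "{True}"]
  have *: "prob {\<omega>\<in>space P. Y (\<lambda>i\<in>{..<n}. D i \<omega>) \<and> D n \<omega> \<in> S} =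
      prob {\<omega>\<in>space P. Y (\<lambda>i\<in>{..<n}. D i \<omega>)} * prob {\<omega>\<in>space P. D n \<omega> \<in> S}"
    by (simp add: vimage_def Int_def conj_commute)
  have Dm: "D i \<in> borel_measurable P" if "i \<le> n" for i
  proof -
    have "\<tau> i \<in> insert 0 (insert t I)" using \<tau>(4) that by auto
    then have "0 \<le> \<tau> i" using I'(2) by auto
    moreover have "0 \<le> \<tau> (Suc i)" using \<tau>(5)[OF that] \<open>0 \<le> \<tau> i\<close> by simp
    ultimately show ?thesis unfolding D_def[abs_def] by measurable
  qed
  have Ym: "(\<lambda>\<omega>. Y (\<lambda>i\<in>{..<n}. D i \<omega>)) \<in> measurable P (count_space UNIV)"
  proof -
    have "(\<lambda>\<omega>. \<lambda>i\<in>{..<n}. D i \<omega>) \<in> measurable P (PiM {..<n} (\<lambda>_. borel))"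
      using Dm by (intro measurable_restrict) auto
    then show ?thesis by measurable
  qed
  note [measurable] = Ym Dm[of n, simplified] S A
  have [measurable]: "(\<lambda>\<omega>. W s \<omega> \<in> A s) \<in> measurable P (count_space UNIV)" if "s \<in> I" for s
  proof -
    have [measurable]: "W s \<in> borel_measurable P" using that I(2) by (intro Wm) auto
    show ?thesis by measurable
  qed
  have AEeq: "AE \<omega> in P. (\<forall>s\<in>I. W s \<omega> \<in> A s) \<longleftrightarrow> Y (\<lambda>i\<in>{..<n}. D i \<omega>)"
  proof -
    have "AE \<omega> in P. W 0 \<omega> = 0" using W by (simp add: std_wiener_def)
    then show ?thesis
    proof eventually_elim
      case (elim \<omega>)
      have "(\<Sum>i<k. (\<lambda>i\<in>{..<n}. D i \<omega>) i) = W (\<tau> k) \<omega>" if "k \<le> n" for k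
      proof -
        have "(\<Sum>i<k. (\<lambda>i\<in>{..<n}. D i \<omega>) i) = (\<Sum>i<k. W (\<tau> (Suc i)) \<omega> - W (\<tau> i) \<omega>)"
          using that by (intro sum.cong) (auto simp: D_def)
        then show ?thesis
          using elim \<tau>(1) sum_lessThan_telescope[of "\<lambda>i. W (\<tau> i) \<omega>" k] by simp
      qed
      then have "Y (\<lambda>i\<in>{..<n}. D i \<omega>) \<longleftrightarrow> (\<forall>k\<in>{..n}. \<tau> k \<in> I \<longrightarrow> W (\<tau> k) \<omega> \<in> A (\<tau> k))"
        by (simp add: Y_def)
      also have "\<dots> \<longleftrightarrow> (\<forall>s\<in>\<tau> ` {..n}. s \<in> I \<longrightarrow> W s \<omega> \<in> A s)" by auto
      finally show ?case unfolding \<tau>(4)[symmetric] by auto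
    qed
  qed
  have e1: "prob {\<omega>\<in>space P. Y (\<lambda>i\<in>{..<n}. D i \<omega>)} = prob {\<omega>\<in>space P. \<forall>s\<in>I. W s \<omega> \<in> A s}"
    using AEeq I(1) by (intro measure_eq_AE) (auto elim!: eventually_mono)
  have e2: "prob {\<omega>\<in>space P. Y (\<lambda>i\<in>{..<n}. D i \<omega>) \<and> D n \<omega> \<in> S} =
      prob {\<omega>\<in>space P. (\<forall>s\<in>I. W s \<omega> \<in> A s) \<and> D n \<omega> \<in> S}"
    using AEeq I(1) by (intro measure_eq_AE) (auto elim!: eventually_mono)
  have "D n \<omega> = W u \<omega> - W t \<omega>" for \<omega> by (simp add: D_def \<tau>)
  then show ?thesis using * unfolding e1 e2 by simp
qed

text \<open>The finite-dimensional probabilities are products of transition probabilities, and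
  adding the time \<open>u\<close> adds one last factor. That factor starts from the state at
  \<open>t\<close>, hence the requirement \<open>t \<in> J\<close>.\<close>

lemma two_state_chain_markov_cylinder:
  assumes Z: "two_state_chain P lm lp z Z" and J: "finite J" "J \<subseteq> {0..t}" "t \<in> J" and tu: "t \<le> u"
  shows "measure P {\<omega>\<in>space P. (\<forall>s\<in>J. Z s \<omega> = j s) \<and> Z u \<omega> = m} =
    measure P {\<omega>\<in>space P. \<forall>s\<in>J. Z s \<omega> = j s} * two_state_trans lm lp (u - t) (j t) m"
proof -
  have t: "0 \<le> t" using J by auto
  interpret prob_space P using Z by (simp add: two_state_chain_def)
  have Zm: "0 \<le> s \<Longrightarrow> Z s \<in> measurable P (count_space UNIV)" for s
    using Z by (simp add: two_state_chain_def)
  have Z0: "AE \<omega> in P. Z 0 \<omega> = z" using Z by (simp add: two_state_chain_def)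
  have [measurable]: "(\<lambda>\<omega>. Z s \<omega> = k) \<in> measurable P (count_space UNIV)" if "0 \<le> s" for s k
    using Zm[OF that] by measurable
  have [measurable]: "(\<lambda>\<omega>. Z s \<omega> = j s) \<in> measurable P (count_space UNIV)" if "s \<in> J" for s
    using that J by auto
  have [measurable]: "(\<lambda>\<omega>. Z u \<omega> = m) \<in> measurable P (count_space UNIV)" "(\<lambda>\<omega>. Z 0 \<omega> = z) \<in> measurable P (count_space UNIV)"
    using t tu by auto
  note J(1)[simp]
  show ?thesis
  proof (cases "0 \<in> J \<and> j 0 \<noteq> z")
    \<comment> \<open>The product formula presupposes the initial state \<open>z\<close>. A cylinder
      prescribing another state at time 0 is a null event, and both sides vanish.\<close>
    case True
    then have "AE \<omega> in P. \<not> (\<forall>s\<in>J. Z s \<omega> = j s)"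
      using Z0 by (auto elim!: eventually_mono intro!: bexI[of _ 0])
    then have "prob {\<omega>\<in>space P. \<forall>s\<in>J. Z s \<omega> = j s} = 0" "prob {\<omega>\<in>space P. (\<forall>s\<in>J. Z s \<omega> = j s) \<and> Z u \<omega> = m} = 0"
      by (auto intro!: measure_eq_AE[where B="{}", simplified] elim!: eventually_mono)
    then show ?thesis by simp
  next
    case False
    have J': "finite (insert 0 J)" "insert 0 J \<subseteq> {0..t}" "t \<in> insert 0 J" "0 \<in> insert 0 J"
      using J t by auto
    obtain n and \<tau> :: "nat \<Rightarrow> real" where \<tau>: "\<tau> 0 = 0" "\<tau> n = t" "\<tau> (Suc n) = u" "insert 0 J = \<tau> ` {..n}"
      "\<And>i. i \<le> n \<Longrightarrow> \<tau> i \<le> \<tau> (Suc i)" "\<And>i. 0 < i \<Longrightarrow> i \<le> n \<Longrightarrow> \<tau> i \<noteq> 0"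
      using sorted_list_times[OF J' tu] by metis
    \<comment> \<open>Index 0 carries \<open>z\<close> even if time 0 is not in \<open>J\<close>;
      the only index used beyond \<open>n\<close> is \<open>Suc n\<close>, which carries the target
      state \<open>m\<close>.\<close>
    define i where "i k = (if k = 0 then z else if k \<le> n then j (\<tau> k) else m)" for k
    note fd0 = Z[unfolded two_state_chain_def, THEN conjunct2, THEN conjunct2, THEN conjunct2, THEN conjunct2, THEN conjunct2, rule_format]
    have fd: "prob {\<omega>\<in>space P. \<forall>k\<in>{1..N}. Z (\<tau> k) \<omega> = i k} =
        (\<Prod>k\<in>{1..N}. two_state_trans lm lp (\<tau> k - \<tau> (k - 1)) (i (k - 1)) (i k))" if "N \<le> Suc n" for N
      by (rule fd0) (use \<tau>(1,5) that in \<open>auto simp: i_def\<close>)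
    \<comment> \<open>For \<open>n = 0\<close> the time \<open>t\<close> is 0, and the excluded case
      guarantees that \<open>j 0\<close> is the initial state.\<close>
    have iN: "i n = j t"
      using False \<tau>(1,2) J(3) by (cases "n = 0") (auto simp: i_def)
    have AEeq: "AE \<omega> in P. (\<forall>s\<in>J. Z s \<omega> = j s) \<longleftrightarrow> (\<forall>k\<in>{1..n}. Z (\<tau> k) \<omega> = i k)"
      using Z0
    proof eventually_elim
      case (elim \<omega>)
      have "(\<forall>s\<in>J. Z s \<omega> = j s) \<longleftrightarrow> (\<forall>s\<in>insert 0 J - {0}. Z s \<omega> = j s)"
        using elim False by auto
      also have "insert 0 J - {0} = \<tau> ` {1..n}"
        unfolding \<tau>(4) using \<tau>(1,6) by (auto simp: image_iff) (metis One_nat_def atLeastAtMost_iff atMost_iff le_0_eq not_less_eq_eq)+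
      also have "(\<forall>s\<in>\<tau> ` {1..n}. Z s \<omega> = j s) \<longleftrightarrow> (\<forall>k\<in>{1..n}. Z (\<tau> k) \<omega> = i k)"
        by (auto simp: i_def)
      finally show ?case .
    qed
    have [measurable]: "(\<lambda>\<omega>. Z (\<tau> k) \<omega> = i k) \<in> measurable P (count_space UNIV)" if "k \<in> {1..n}" for k
    proof -
      have "\<tau> k \<in> insert 0 J" unfolding \<tau>(4) using that by auto
      then show ?thesis using J'(2) by auto
    qed
    have Suc: "(\<forall>k\<in>{1..Suc n}. Z (\<tau> k) \<omega> = i k) \<longleftrightarrow> (\<forall>k\<in>{1..n}. Z (\<tau> k) \<omega> = i k) \<and> Z u \<omega> = m" for \<omega>
    proof -
      have "{1..Suc n} = insert (Suc n) {1..n}" by auto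
      then show ?thesis using \<tau>(3) by (auto simp: i_def)
    qed
    have e1: "prob {\<omega>\<in>space P. \<forall>s\<in>J. Z s \<omega> = j s} = prob {\<omega>\<in>space P. \<forall>k\<in>{1..n}. Z (\<tau> k) \<omega> = i k}"
      using AEeq by (intro measure_eq_AE) (auto elim!: eventually_mono)
    have e2: "prob {\<omega>\<in>space P. (\<forall>s\<in>J. Z s \<omega> = j s) \<and> Z u \<omega> = m} = prob {\<omega>\<in>space P. \<forall>k\<in>{1..Suc n}. Z (\<tau> k) \<omega> = i k}"
      unfolding Suc using AEeq by (intro measure_eq_AE) (auto elim!: eventually_mono)
    have "i (Suc n) = m" by (simp add: i_def)
    then show ?thesis
      unfolding e1 e2 fd[OF order_refl] fd[OF le_SucI[OF order_refl]] by (simp add: \<tau> iN)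
  qed
qed

section \<open>Extension to the completed filtration\<close>

text \<open>The chain is constrained by single states rather than by sets of states, because its law
  is given for prescribed states. The price is that two cylinders with conflicting states meet in
  the empty set, which need not have the form of a cylinder.\<close>

definition past_cylinders ::
  "'a measure \<Rightarrow> (real \<Rightarrow> 'a \<Rightarrow> 'v::euclidean_space) \<Rightarrow> (real \<Rightarrow> 'a \<Rightarrow> nat) \<Rightarrow> real \<Rightarrow> 'a set set" where
  "past_cylinders P W Z t =
     {{\<omega>\<in>space P. (\<forall>s\<in>I. W s \<omega> \<in> A s) \<and> (\<forall>s\<in>J. Z s \<omega> = j s)} | I A J j.
        finite I \<and> I \<subseteq> {0..t} \<and> (\<forall>s. A s \<in> sets borel) \<and> finite J \<and> J \<subseteq> {0..t}}"

lemma past_cylindersI: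
  "finite I \<Longrightarrow> I \<subseteq> {0..t} \<Longrightarrow> (\<And>s. A s \<in> sets borel) \<Longrightarrow> finite J \<Longrightarrow> J \<subseteq> {0..t} \<Longrightarrow>
   {\<omega>\<in>space P. (\<forall>s\<in>I. W s \<omega> \<in> A s) \<and> (\<forall>s\<in>J. Z s \<omega> = j s)} \<in> past_cylinders P W Z t"
  unfolding past_cylinders_def by blast

lemma past_cylindersE:
  assumes "E \<in> past_cylinders P W Z t"
  obtains I A J j where "finite I" "I \<subseteq> {0..t}" "\<And>s. A s \<in> sets borel" "finite J" "J \<subseteq> {0..t}"
    "E = {\<omega>\<in>space P. (\<forall>s\<in>I. W s \<omega> \<in> A s) \<and> (\<forall>s\<in>J. Z s \<omega> = j s)}"
  using assms unfolding past_cylinders_def by blast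

lemma space_in_past_cylinders: "space P \<in> past_cylinders P W Z t"
  using past_cylindersI[of "{}" t "\<lambda>_. UNIV" "{}"] by simp

lemma past_cylinders_Int:
  assumes "E \<in> past_cylinders P W Z t" "F \<in> past_cylinders P W Z t"
  shows "E \<inter> F \<in> insert {} (past_cylinders P W Z t)"
proof -
  obtain I A J j where E: "finite I" "I \<subseteq> {0..t}" "\<And>s. A s \<in> sets borel" "finite J" "J \<subseteq> {0..t}"
    "E = {\<omega>\<in>space P. (\<forall>s\<in>I. W s \<omega> \<in> A s) \<and> (\<forall>s\<in>J. Z s \<omega> = j s)}"
    by (rule past_cylindersE[OF assms(1)]) blast
  obtain I' A' J' j' where F: "finite I'" "I' \<subseteq> {0..t}" "\<And>s. A' s \<in> sets borel" "finite J'" "J' \<subseteq> {0..t}"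
    "F = {\<omega>\<in>space P. (\<forall>s\<in>I'. W s \<omega> \<in> A' s) \<and> (\<forall>s\<in>J'. Z s \<omega> = j' s)}"
    by (rule past_cylindersE[OF assms(2)]) blast
  show ?thesis
  proof (cases "\<exists>s\<in>J \<inter> J'. j s \<noteq> j' s")
    case True
    then obtain s where "s \<in> J" "s \<in> J'" "j s \<noteq> j' s" by auto
    then have "E \<inter> F = {}" unfolding E(6) F(6) by fastforce
    then show ?thesis by simp
  next
    case False
    let ?A = "\<lambda>s. (if s \<in> I then A s else UNIV) \<inter> (if s \<in> I' then A' s else UNIV)"
    let ?j = "\<lambda>s. if s \<in> J then j s else j' s"
    have "E \<inter> F = {\<omega>\<in>space P. (\<forall>s\<in>I \<union> I'. W s \<omega> \<in> ?A s) \<and> (\<forall>s\<in>J \<union> J'. Z s \<omega> = ?j s)}"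
      unfolding E(6) F(6) using False by auto
    also have "\<dots> \<in> past_cylinders P W Z t"
      using E F by (intro past_cylindersI) auto
    finally show ?thesis by simp
  qed
qed

text \<open>The null sets are added to generate the completed filtration, and they also absorb the
  empty intersections of conflicting cylinders.\<close>

lemma Int_stable_past_cylinders_null:
  assumes "past_cylinders P W Z t \<subseteq> sets P"
  shows "Int_stable (past_cylinders P W Z t \<union> null_sets P)"
proof (rule Int_stableI)
  fix E F assume *: "E \<in> past_cylinders P W Z t \<union> null_sets P" "F \<in> past_cylinders P W Z t \<union> null_sets P"
  show "E \<inter> F \<in> past_cylinders P W Z t \<union> null_sets P"
  proof (cases "E \<in> null_sets P \<or> F \<in> null_sets P")
    case True
    then show ?thesis using * assms by (auto intro: null_set_Int1 null_set_Int2)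
  next
    case False
    then show ?thesis using * past_cylinders_Int[of E P W Z t F] by auto
  qed
qed

lemma space_switch_filtr [simp]: "space (switch_filtr P W Z t) = space P"
  unfolding switch_filtr_def by (rule space_measure_of_conv)

lemma sets_switch_filtr:
  "sets (switch_filtr P W Z t) = sigma_sets (space P)
     ((\<Union>s\<in>{0..t}. {W s -` A \<inter> space P | A. A \<in> sets borel} \<union> {Z s -` {k} \<inter> space P | k. True}) \<union> null_sets P)"
  unfolding switch_filtr_def
  by (rule sets_measure_of) (auto dest: null_setsD2 sets.sets_into_space)

lemma switch_filtr_subset_past_cylinders:
  "sets (switch_filtr P W Z t) \<subseteq> sigma_sets (space P) (past_cylinders P W Z t \<union> null_sets P)"
  unfolding sets_switch_filtr
proof (rule sigma_sets_mono', safe)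
  fix s A assume s: "s \<in> {0..t}" and A: "A \<in> sets (borel :: 'b measure)"
  have "W s -` A \<inter> space P = {\<omega>\<in>space P. (\<forall>r\<in>{s}. W r \<omega> \<in> A) \<and> (\<forall>r\<in>{}. Z r \<omega> = 0)}" by auto
  also have "\<dots> \<in> past_cylinders P W Z t" using s A by (intro past_cylindersI) auto
  finally show "W s -` A \<inter> space P \<in> past_cylinders P W Z t" .
next
  fix s k assume s: "s \<in> {0..t}"
  have "Z s -` {k} \<inter> space P = {\<omega>\<in>space P. (\<forall>r\<in>{}. W r \<omega> \<in> UNIV) \<and> (\<forall>r\<in>{s}. Z r \<omega> = k)}" by auto
  also have "\<dots> \<in> past_cylinders P W Z t" using s by (intro past_cylindersI) auto
  finally show "Z s -` {k} \<inter> space P \<in> past_cylinders P W Z t" .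
qed

lemma sets_switch_filtr_mono: "s \<le> t \<Longrightarrow> sets (switch_filtr P W Z s) \<subseteq> sets (switch_filtr P W Z t)"
  unfolding sets_switch_filtr by (intro sigma_sets_mono' Un_mono UN_mono) auto

lemma measurable_switch_filtr_mono:
  "f \<in> measurable (switch_filtr P W Z s) N \<Longrightarrow> s \<le> t \<Longrightarrow> f \<in> measurable (switch_filtr P W Z t) N"
  using sets_switch_filtr_mono[of s t P W Z] by (auto simp: measurable_def)

text \<open>A Dynkin argument on cylinders and null sets. It is stated with two events and a factor
  so as to cover both uses: \<open>C\<close> the whole space for the independence of increments, and
  \<open>C\<close> the event that \<open>Z t\<close> is a given state for the Markov
  property.\<close>

lemma switch_filtr_measure_eqI:
  assumes "prob_space P" and cyl: "past_cylinders P W Z t \<subseteq> sets P"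
    and B[measurable]: "B \<in> sets P" and C[measurable]: "C \<in> sets P"
    and eq: "\<And>A. A \<in> past_cylinders P W Z t \<Longrightarrow> measure P (A \<inter> B) = c * measure P (A \<inter> C)"
    and A: "A \<in> sets (switch_filtr P W Z t)"
  shows "measure P (A \<inter> B) = c * measure P (A \<inter> C)"
proof -
  interpret prob_space P by fact
  let ?G = "past_cylinders P W Z t \<union> null_sets P"
  have G: "?G \<subseteq> sets P" using cyl by auto
  have sG: "sigma_sets (space P) ?G \<subseteq> sets P" by (rule sets.sigma_sets_subset[OF G])
  have G': "?G \<subseteq> Pow (space P)" using G sets.sets_into_space by blast
  \<comment> \<open>The identity for the whole space, which is itself a cylinder; it is what the
    complement step subtracts from.\<close>
  have BC: "prob B = c * prob C"
    using eq[OF space_in_past_cylinders] sets.sets_into_space[OF B] sets.sets_into_space[OF C]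
    by (simp add: Int_absorb1)
  have "A \<in> sigma_sets (space P) ?G" using A switch_filtr_subset_past_cylinders by blast
  from Int_stable_past_cylinders_null[OF cyl] G' this show ?thesis
  proof (induction rule: sigma_sets_induct_disjoint)
    case (basic A)
    show ?case
    proof (cases "A \<in> null_sets P")
      case True
      then have "A \<inter> B \<in> null_sets P" "A \<inter> C \<in> null_sets P" by (auto intro: null_set_Int2)
      then show ?thesis by (simp add: measure_eq_0_null_sets)
    qed (use basic eq in auto)
  next
    case empty then show ?case by simp
  next
    case (compl A)
    have [measurable]: "A \<in> sets P" using compl sG by auto
    have "(space P - A) \<inter> B = B - A \<inter> B" "(space P - A) \<inter> C = C - A \<inter> C"
      using sets.sets_into_space[OF B] sets.sets_into_space[OF C] by auto
    then show ?case
      using compl BC by (simp add: finite_measure_Diff algebra_simps)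
  next
    case (union A)
    have [measurable]: "\<And>i. A i \<in> sets P" using union sG by auto
    have *: "(\<lambda>i. prob (A i \<inter> D)) sums prob ((\<Union>i. A i) \<inter> D)" if [measurable]: "D \<in> sets P" for D
    proof -
      have "(\<Union>i. A i) \<inter> D = (\<Union>i. A i \<inter> D)" by auto
      moreover have "disjoint_family (\<lambda>i. A i \<inter> D)"
        using union(1) by (auto simp: disjoint_family_on_def)
      ultimately show ?thesis using finite_measure_UNION[of "\<lambda>i. A i \<inter> D"] by (auto simp: image_subset_iff)
    qed
    from *[OF B] sums_mult[OF *[OF C], of c] union(3) show ?case
      by (auto dest: sums_unique2)
  qed
qed

text \<open>On the smaller sigma-algebra \<open>F\<close> the measure restricted to \<open>B\<close>
  is a multiple of the one restricted to \<open>C\<close>. Pushing both forward along the identity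
  to \<open>F\<close> turns this into an equality of measures, so the integrals of
  \<open>F\<close>-measurable functions agree as well.\<close>

lemma nn_integral_indicator_proportional:
  assumes F: "sets F \<subseteq> sets P" "space F = space P" and "finite_measure P"
    and B[measurable]: "B \<in> sets P" and C[measurable]: "C \<in> sets P" and c: "0 \<le> c"
    and eq: "\<And>A. A \<in> sets F \<Longrightarrow> measure P (A \<inter> B) = c * measure P (A \<inter> C)"
    and f: "f \<in> borel_measurable F"
  shows "(\<integral>\<^sup>+ \<omega>. f \<omega> * indicator B \<omega> \<partial>P) = ennreal c * (\<integral>\<^sup>+ \<omega>. f \<omega> * indicator C \<omega> \<partial>P)"
proof -
  interpret finite_measure P by fact
  have FP: "measurable F borel \<subseteq> (measurable P borel :: ('a \<Rightarrow> ennreal) set)"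
    using F by (auto simp: measurable_def)
  let ?N = "\<lambda>D. distr (density P (indicator D)) F id"
  have id: "id \<in> measurable (density P (indicator D)) F" for D
    using F by (auto simp: measurable_def id_def intro: sets.Int)
  have int: "(\<integral>\<^sup>+ \<omega>. f \<omega> * indicator D \<omega> \<partial>P) = (\<integral>\<^sup>+ \<omega>. f \<omega> \<partial>?N D)" if [measurable]: "D \<in> sets P" for D
    using f FP id by (subst nn_integral_distr) (auto simp: nn_integral_density mult.commute)
  have "?N B = scale_measure (ennreal c) (?N C)"
  proof (rule measure_eqI)
    fix A assume "A \<in> sets (?N B)"
    then have A: "A \<in> sets F" and [measurable]: "A \<in> sets P" using F by auto
    have *: "emeasure (?N D) A = ennreal (measure P (A \<inter> D))" if [measurable]: "D \<in> sets P" for D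
      using A id F(2) sets.sets_into_space[OF \<open>A \<in> sets P\<close>]
      by (subst emeasure_distr)
        (auto simp: emeasure_density emeasure_eq_measure[symmetric] indicator_inter_arith[symmetric] Int_commute Int_absorb1)
    show "emeasure (?N B) A = emeasure (scale_measure (ennreal c) (?N C)) A"
      using eq[OF A] c by (simp add: * ennreal_mult del: emeasure_distr)
  qed simp
  then show ?thesis
    using f by (simp add: int nn_integral_scale_measure)
qed

section \<open>Conditioning on the past\<close>

locale switching =
  fixes P :: "'a measure" and lm lp :: real and b :: "'v::euclidean_space \<Rightarrow> nat \<Rightarrow> 'v" and x :: 'v and z :: nat
    and W :: "real \<Rightarrow> 'a \<Rightarrow> 'v" and Z :: "real \<Rightarrow> 'a \<Rightarrow> nat" and X :: "real \<Rightarrow> 'a \<Rightarrow> 'v"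
  assumes sol: "switching_solution P lm lp b x z W Z X" and lm: "0 < lm" and lp: "0 < lp"
begin

lemma wiener: "std_wiener P W" and chain: "two_state_chain P lm lp z Z"
  using sol by (simp_all add: switching_solution_def)

sublocale prob_space P
  using wiener by (simp add: std_wiener_def)

abbreviation F :: "real \<Rightarrow> 'a measure" where "F \<equiv> switch_filtr P W Z"

lemma W_measurable [measurable]: "0 \<le> t \<Longrightarrow> W t \<in> borel_measurable P"
  using wiener by (simp add: std_wiener_def)

lemma Z_measurable [measurable]: "0 \<le> t \<Longrightarrow> Z t \<in> measurable P (count_space UNIV)"
  using chain by (simp add: two_state_chain_def)

lemma Z_range: "0 \<le> t \<Longrightarrow> \<omega> \<in> space P \<Longrightarrow> Z t \<omega> = 0 \<or> Z t \<omega> = 1"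
  using chain by (simp add: two_state_chain_def)

lemma sets_F_subset: "sets (F t) \<subseteq> sets P"
  unfolding sets_switch_filtr
proof (rule sets.sigma_sets_subset, safe)
  fix s A assume "s \<in> {0..t}" "A \<in> sets (borel :: 'v measure)"
  then show "W s -` A \<inter> space P \<in> sets P" by (intro measurable_sets[OF W_measurable]) auto
next
  fix s k assume "s \<in> {0..t}"
  then show "Z s -` {k} \<inter> space P \<in> sets P" by (intro measurable_sets[OF Z_measurable]) auto
qed auto

lemma measurable_F_P: "f \<in> measurable (F t) N \<Longrightarrow> f \<in> measurable P N"
  using sets_F_subset by (auto simp: measurable_def)

lemma X_measurable_F: "0 \<le> t \<Longrightarrow> X t \<in> borel_measurable (F t)"
  using sol by (simp add: switching_solution_def)

lemma X_measurable [measurable]: "0 \<le> t \<Longrightarrow> X t \<in> borel_measurable P"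
  using X_measurable_F measurable_F_P by blast

lemma Z_measurable_F: "0 \<le> t \<Longrightarrow> Z t \<in> measurable (F t) (count_space UNIV)"
proof (rule measurable_count_space_eq2_countable[THEN iffD2], safe)
  fix k assume "0 \<le> t"
  then show "Z t -` {k} \<inter> space (F t) \<in> sets (F t)"
    unfolding sets_switch_filtr space_switch_filtr
    by (intro sigma_sets.Basic UnI1 UN_I[of t] UnI2) auto
qed auto

section \<open>Independence and Markov property relative to the completed past\<close>

lemma past_cylinders_sets: "past_cylinders P W Z t \<subseteq> sets P"
proof
  fix E assume "E \<in> past_cylinders P W Z t"
  then obtain I A J j where E: "finite I" "I \<subseteq> {0..t}" "\<And>s. A s \<in> sets borel" "finite J" "J \<subseteq> {0..t}"
    "E = {\<omega>\<in>space P. (\<forall>s\<in>I. W s \<omega> \<in> A s) \<and> (\<forall>s\<in>J. Z s \<omega> = j s)}"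
    by (rule past_cylindersE) blast
  have [measurable]: "(\<lambda>\<omega>. W s \<omega> \<in> A s) \<in> measurable P (count_space UNIV)" if "s \<in> I" for s
  proof -
    have [measurable]: "W s \<in> borel_measurable P" using that E by (intro W_measurable) auto
    show ?thesis using E(3) by measurable
  qed
  have [measurable]: "(\<lambda>\<omega>. Z s \<omega> = j s) \<in> measurable P (count_space UNIV)" if "s \<in> J" for s
  proof -
    have [measurable]: "Z s \<in> measurable P (count_space UNIV)" using that E by (intro Z_measurable) auto
    show ?thesis by measurable
  qed
  show "E \<in> sets P" unfolding E(6) using E(1,4) by measurable
qed

text \<open>The independence of the two path sigma-algebras in terms of predicates: \<open>Q\<close>
  and \<open>R\<close> speak of paths restricted to nonnegative times, \<open>Q'\<close> and
  \<open>R'\<close> of the outcome itself, so the restriction disappears from all later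
  statements.\<close>

lemma path_events_indep:
  assumes "Measurable.pred (PiM {0..} (\<lambda>_. borel :: 'v measure)) Q" "Measurable.pred (PiM {0..} (\<lambda>_. count_space UNIV :: nat measure)) R"
    and QR: "\<And>\<omega>. \<omega> \<in> space P \<Longrightarrow> Q (\<lambda>t\<in>{0..}. W t \<omega>) \<longleftrightarrow> Q' \<omega>" "\<And>\<omega>. \<omega> \<in> space P \<Longrightarrow> R (\<lambda>t\<in>{0..}. Z t \<omega>) \<longleftrightarrow> R' \<omega>"
  shows "prob {\<omega>\<in>space P. Q' \<omega> \<and> R' \<omega>} = prob {\<omega>\<in>space P. Q' \<omega>} * prob {\<omega>\<in>space P. R' \<omega>}"
proof -
  let ?VW = "vimage_algebra (space P) (\<lambda>\<omega>. \<lambda>t\<in>{0..}. W t \<omega>) (PiM {0..} (\<lambda>_. borel))"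
  let ?VZ = "vimage_algebra (space P) (\<lambda>\<omega>. \<lambda>t\<in>{0..}. Z t \<omega>) (PiM {0..} (\<lambda>_. count_space UNIV))"
  have ind: "indep_set (sets ?VW) (sets ?VZ)"
    using sol by (simp add: switching_solution_def)
  have "(\<lambda>\<omega>. \<lambda>t\<in>{0..}. W t \<omega>) -` {f \<in> space (PiM {0..} (\<lambda>_. borel :: 'v measure)). Q f} \<inter> space P \<in> sets ?VW"
    using assms(1) by (intro in_vimage_algebra) measurable
  moreover have "(\<lambda>\<omega>. \<lambda>t\<in>{0..}. W t \<omega>) -` {f \<in> space (PiM {0..} (\<lambda>_. borel :: 'v measure)). Q f} \<inter> space P = {\<omega>\<in>space P. Q' \<omega>}"
    using QR(1) by (auto simp: space_PiM)
  moreover have "(\<lambda>\<omega>. \<lambda>t\<in>{0..}. Z t \<omega>) -` {f \<in> space (PiM {0..} (\<lambda>_. count_space UNIV :: nat measure)). R f} \<inter> space P \<in> sets ?VZ"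
    using assms(2) by (intro in_vimage_algebra) measurable
  moreover have "(\<lambda>\<omega>. \<lambda>t\<in>{0..}. Z t \<omega>) -` {f \<in> space (PiM {0..} (\<lambda>_. count_space UNIV :: nat measure)). R f} \<inter> space P = {\<omega>\<in>space P. R' \<omega>}"
    using QR(2) by (auto simp: space_PiM)
  ultimately have "prob ({\<omega>\<in>space P. Q' \<omega>} \<inter> {\<omega>\<in>space P. R' \<omega>}) = prob {\<omega>\<in>space P. Q' \<omega>} * prob {\<omega>\<in>space P. R' \<omega>}"
    using indep_setD[OF ind] by simp
  moreover have "{\<omega>\<in>space P. Q' \<omega>} \<inter> {\<omega>\<in>space P. R' \<omega>} = {\<omega>\<in>space P. Q' \<omega> \<and> R' \<omega>}" by auto
  ultimately show ?thesis by simp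
qed

lemma W_path_pred:
  assumes "finite I" "I \<subseteq> {0..}" "\<And>s. A s \<in> sets borel"
  shows "Measurable.pred (PiM {0..} (\<lambda>_. borel :: 'v measure)) (\<lambda>f. \<forall>s\<in>I. f s \<in> A s)"
proof -
  have "Measurable.pred (PiM {0..} (\<lambda>_. borel :: 'v measure)) (\<lambda>f. f s \<in> A s)" if "s \<in> I" for s
  proof -
    have [measurable]: "(\<lambda>f. f s) \<in> measurable (PiM {0..} (\<lambda>_. borel :: 'v measure)) borel"
      using that assms by (intro measurable_component_singleton) auto
    show ?thesis using assms(3) by measurable
  qed
  then show ?thesis using assms(1) by measurable
qed

lemma Z_path_pred:
  assumes "finite J" "J \<subseteq> {0..}"
  shows "Measurable.pred (PiM {0..} (\<lambda>_. count_space UNIV :: nat measure)) (\<lambda>f. \<forall>s\<in>J. f s = j s)"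
proof -
  have "Measurable.pred (PiM {0..} (\<lambda>_. count_space UNIV :: nat measure)) (\<lambda>f. f s = j s)" if "s \<in> J" for s
  proof -
    have [measurable]: "(\<lambda>f. f s) \<in> measurable (PiM {0..} (\<lambda>_. count_space UNIV :: nat measure)) (count_space UNIV)"
      using that assms by (intro measurable_component_singleton) auto
    show ?thesis by measurable
  qed
  then show ?thesis using assms(1) by measurable
qed

text \<open>On a cylinder the increment is first grouped with the constraints on \<open>W\<close>
  and separated from the chain by the independence of the two paths, then separated from the past of
  \<open>W\<close>.\<close>

lemma increment_indep_F:
  assumes A: "A \<in> sets (F t)" and tu: "0 \<le> t" "t \<le> u" and S[measurable]: "S \<in> sets borel"
  shows "prob (A \<inter> {\<omega>\<in>space P. W u \<omega> - W t \<omega> \<in> S}) = prob A * prob {\<omega>\<in>space P. W u \<omega> - W t \<omega> \<in> S}"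
proof -
  let ?B = "{\<omega>\<in>space P. W u \<omega> - W t \<omega> \<in> S}"
  have [measurable]: "W u \<in> borel_measurable P" "W t \<in> borel_measurable P" using tu by auto
  have "prob (A \<inter> ?B) = prob ?B * prob (A \<inter> space P)"
  proof (rule switch_filtr_measure_eqI[OF prob_space_axioms past_cylinders_sets _ _ _ A])
    fix E assume "E \<in> past_cylinders P W Z t"
    then obtain I A J j where E: "finite I" "I \<subseteq> {0..t}" "\<And>s. A s \<in> sets borel" "finite J" "J \<subseteq> {0..t}"
      "E = {\<omega>\<in>space P. (\<forall>s\<in>I. W s \<omega> \<in> A s) \<and> (\<forall>s\<in>J. Z s \<omega> = j s)}"
      by (rule past_cylindersE) blast
    have p1[measurable]: "Measurable.pred (PiM {0..} (\<lambda>_. borel :: 'v measure)) (\<lambda>f. \<forall>s\<in>I. f s \<in> A s)"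
      using E by (intro W_path_pred) auto
    have p2: "Measurable.pred (PiM {0..} (\<lambda>_. count_space UNIV :: nat measure)) (\<lambda>f. \<forall>s\<in>J. f s = j s)"
      using E by (intro Z_path_pred) auto
    have [measurable]: "(\<lambda>f. f u) \<in> measurable (PiM {0..} (\<lambda>_. borel :: 'v measure)) borel"
      "(\<lambda>f. f t) \<in> measurable (PiM {0..} (\<lambda>_. borel :: 'v measure)) borel"
      using tu by (auto intro: measurable_component_singleton)
    have p3: "Measurable.pred (PiM {0..} (\<lambda>_. borel :: 'v measure)) (\<lambda>f. (\<forall>s\<in>I. f s \<in> A s) \<and> f u - f t \<in> S)"
      by measurable
    have nn: "s \<in> I \<Longrightarrow> 0 \<le> s" "s \<in> J \<Longrightarrow> 0 \<le> s" for s using E by auto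
    have "E \<inter> ?B = {\<omega>\<in>space P. ((\<forall>s\<in>I. W s \<omega> \<in> A s) \<and> W u \<omega> - W t \<omega> \<in> S) \<and> (\<forall>s\<in>J. Z s \<omega> = j s)}"
      unfolding E(6) by auto
    then have "prob (E \<inter> ?B) = prob {\<omega>\<in>space P. (\<forall>s\<in>I. W s \<omega> \<in> A s) \<and> W u \<omega> - W t \<omega> \<in> S} * prob {\<omega>\<in>space P. \<forall>s\<in>J. Z s \<omega> = j s}"
      by (simp only:) (rule path_events_indep[OF p3 p2], use nn tu in auto)
    also have "prob {\<omega>\<in>space P. (\<forall>s\<in>I. W s \<omega> \<in> A s) \<and> W u \<omega> - W t \<omega> \<in> S} =
        prob {\<omega>\<in>space P. \<forall>s\<in>I. W s \<omega> \<in> A s} * prob ?B"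
      by (rule wiener_increment_indep_cylinder[OF wiener E(1,2) tu E(3) S])
    finally have "prob (E \<inter> ?B) = prob ?B * (prob {\<omega>\<in>space P. \<forall>s\<in>I. W s \<omega> \<in> A s} * prob {\<omega>\<in>space P. \<forall>s\<in>J. Z s \<omega> = j s})"
      by simp
    also have "prob {\<omega>\<in>space P. \<forall>s\<in>I. W s \<omega> \<in> A s} * prob {\<omega>\<in>space P. \<forall>s\<in>J. Z s \<omega> = j s} = prob (E \<inter> space P)"
    proof -
      have "E \<inter> space P = {\<omega>\<in>space P. (\<forall>s\<in>I. W s \<omega> \<in> A s) \<and> (\<forall>s\<in>J. Z s \<omega> = j s)}"
        unfolding E(6) by auto
      then show ?thesis using path_events_indep[OF p1 p2] nn by simp
    qed
    finally show "prob (E \<inter> ?B) = prob ?B * prob (E \<inter> space P)" .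
  qed simp_all
  moreover have "A \<inter> space P = A" using sets.sets_into_space[OF A] by auto
  ultimately show ?thesis by simp
qed

text \<open>As for increments, a cylinder is split into its \<open>W\<close> part and its chain
  part; here the future state goes with the chain part and contributes one transition
  factor.\<close>

lemma chain_markov_F:
  assumes A: "A \<in> sets (F t)" and tu: "0 \<le> t" "t \<le> u"
  shows "prob (A \<inter> {\<omega>\<in>space P. Z t \<omega> = i \<and> Z u \<omega> = m}) =
    two_state_trans lm lp (u - t) i m * prob (A \<inter> {\<omega>\<in>space P. Z t \<omega> = i})"
proof (rule switch_filtr_measure_eqI[OF prob_space_axioms past_cylinders_sets _ _ _ A])
  have [measurable]: "Z u \<in> measurable P (count_space UNIV)" "Z t \<in> measurable P (count_space UNIV)" using tu by auto
  show "{\<omega>\<in>space P. Z t \<omega> = i \<and> Z u \<omega> = m} \<in> sets P" "{\<omega>\<in>space P. Z t \<omega> = i} \<in> sets P" by measurable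
  fix E assume "E \<in> past_cylinders P W Z t"
  then obtain I A J j where E: "finite I" "I \<subseteq> {0..t}" "\<And>s. A s \<in> sets borel" "finite J" "J \<subseteq> {0..t}"
    "E = {\<omega>\<in>space P. (\<forall>s\<in>I. W s \<omega> \<in> A s) \<and> (\<forall>s\<in>J. Z s \<omega> = j s)}"
    by (rule past_cylindersE) blast
  show "prob (E \<inter> {\<omega>\<in>space P. Z t \<omega> = i \<and> Z u \<omega> = m}) =
      two_state_trans lm lp (u - t) i m * prob (E \<inter> {\<omega>\<in>space P. Z t \<omega> = i})"
  proof (cases "t \<in> J \<and> j t \<noteq> i")
    case True
    then have "E \<inter> {\<omega>\<in>space P. Z t \<omega> = i \<and> Z u \<omega> = m} = {}" "E \<inter> {\<omega>\<in>space P. Z t \<omega> = i} = {}"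
      unfolding E(6) by fastforce+
    then show ?thesis by simp
  next
    case False
    \<comment> \<open>The state at \<open>t\<close> is made part of the cylinder, since the Markov
      property on cylinders needs \<open>t\<close> among the constrained times; this is consistent
      because the conflicting case has been dealt with.\<close>
    define J' j' where "J' = insert t J" and "j' = j(t := i)"
    have J': "finite J'" "J' \<subseteq> {0..t}" "t \<in> J'" and j': "j' t = i"
      using E tu by (auto simp: J'_def j'_def)
    have iff: "(\<forall>s\<in>J'. Z s \<omega> = j' s) \<longleftrightarrow> (\<forall>s\<in>J. Z s \<omega> = j s) \<and> Z t \<omega> = i" for \<omega>
      using False by (auto simp: J'_def j'_def)
    have nn: "s \<in> I \<Longrightarrow> 0 \<le> s" "s \<in> J' \<Longrightarrow> 0 \<le> s" for s using E J' by auto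
    have p1: "Measurable.pred (PiM {0..} (\<lambda>_. borel :: 'v measure)) (\<lambda>f. \<forall>s\<in>I. f s \<in> A s)"
      using E by (intro W_path_pred) auto
    have p2[measurable]: "Measurable.pred (PiM {0..} (\<lambda>_. count_space UNIV :: nat measure)) (\<lambda>f. \<forall>s\<in>J'. f s = j' s)"
      using J' by (intro Z_path_pred) auto
    have [measurable]: "(\<lambda>f. f u) \<in> measurable (PiM {0..} (\<lambda>_. count_space UNIV :: nat measure)) (count_space UNIV)"
      using tu by (auto intro: measurable_component_singleton)
    have p3: "Measurable.pred (PiM {0..} (\<lambda>_. count_space UNIV :: nat measure)) (\<lambda>f. (\<forall>s\<in>J'. f s = j' s) \<and> f u = m)"
      by measurable
    have "E \<inter> {\<omega>\<in>space P. Z t \<omega> = i \<and> Z u \<omega> = m} =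
        {\<omega>\<in>space P. (\<forall>s\<in>I. W s \<omega> \<in> A s) \<and> ((\<forall>s\<in>J'. Z s \<omega> = j' s) \<and> Z u \<omega> = m)}"
      unfolding E(6) iff by auto
    then have "prob (E \<inter> {\<omega>\<in>space P. Z t \<omega> = i \<and> Z u \<omega> = m}) =
        prob {\<omega>\<in>space P. \<forall>s\<in>I. W s \<omega> \<in> A s} * prob {\<omega>\<in>space P. (\<forall>s\<in>J'. Z s \<omega> = j' s) \<and> Z u \<omega> = m}"
      using path_events_indep[OF p1 p3] nn tu by simp
    also have "prob {\<omega>\<in>space P. (\<forall>s\<in>J'. Z s \<omega> = j' s) \<and> Z u \<omega> = m} =
        prob {\<omega>\<in>space P. \<forall>s\<in>J'. Z s \<omega> = j' s} * two_state_trans lm lp (u - t) i m"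
      using two_state_chain_markov_cylinder[OF chain J' tu(2), of j' m] j' by simp
    finally have "prob (E \<inter> {\<omega>\<in>space P. Z t \<omega> = i \<and> Z u \<omega> = m}) = two_state_trans lm lp (u - t) i m *
        (prob {\<omega>\<in>space P. \<forall>s\<in>I. W s \<omega> \<in> A s} * prob {\<omega>\<in>space P. \<forall>s\<in>J'. Z s \<omega> = j' s})"
      by simp
    also have "prob {\<omega>\<in>space P. \<forall>s\<in>I. W s \<omega> \<in> A s} * prob {\<omega>\<in>space P. \<forall>s\<in>J'. Z s \<omega> = j' s} =
        prob {\<omega>\<in>space P. (\<forall>s\<in>I. W s \<omega> \<in> A s) \<and> (\<forall>s\<in>J'. Z s \<omega> = j' s)}"
      using path_events_indep[OF p1 p2] nn by simp
    also have "{\<omega>\<in>space P. (\<forall>s\<in>I. W s \<omega> \<in> A s) \<and> (\<forall>s\<in>J'. Z s \<omega> = j' s)} = E \<inter> {\<omega>\<in>space P. Z t \<omega> = i}"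
      unfolding E(6) iff by auto
    finally show ?thesis .
  qed
qed

section \<open>Expectations weighted by functions of the past\<close>

lemma indep_var_F_increment:
  fixes f :: "'a \<Rightarrow> real" and g :: "'v \<Rightarrow> real"
  assumes f: "f \<in> borel_measurable (F t)" and g[measurable]: "g \<in> borel_measurable borel" and tu: "0 \<le> t" "t \<le> u"
  shows "indep_var borel f borel (\<lambda>\<omega>. g (W u \<omega> - W t \<omega>))"
proof -
  have [measurable]: "W u \<in> borel_measurable P" "W t \<in> borel_measurable P" "f \<in> borel_measurable P"
    using tu f measurable_F_P by auto
  have "indep_set {f -` A \<inter> space P | A. A \<in> sets borel} {(\<lambda>\<omega>. g (W u \<omega> - W t \<omega>)) -` A \<inter> space P | A. A \<in> sets borel}"
  proof (rule indep_setI, safe)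
    fix A B :: "real set" assume [measurable]: "A \<in> sets borel" "B \<in> sets borel"
    show "f -` A \<inter> space P \<in> sets P" "(\<lambda>\<omega>. g (W u \<omega> - W t \<omega>)) -` B \<inter> space P \<in> sets P" by measurable
    have 1: "f -` A \<inter> space P \<in> sets (F t)" using measurable_sets[OF f, of A] by simp
    have 2: "(\<lambda>\<omega>. g (W u \<omega> - W t \<omega>)) -` B \<inter> space P = {\<omega>\<in>space P. W u \<omega> - W t \<omega> \<in> g -` B}" by auto
    have 3: "g -` B \<in> sets borel" using measurable_sets[OF g, of B] by simp
    show "prob ((f -` A \<inter> space P) \<inter> ((\<lambda>\<omega>. g (W u \<omega> - W t \<omega>)) -` B \<inter> space P)) =
        prob (f -` A \<inter> space P) * prob ((\<lambda>\<omega>. g (W u \<omega> - W t \<omega>)) -` B \<inter> space P)"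
      unfolding 2 by (rule increment_indep_F[OF 1 tu 3])
  qed
  moreover have "Int_stable {h -` A \<inter> space P | A. A \<in> sets borel}" for h :: "'a \<Rightarrow> real"
  proof (rule Int_stableI, safe)
    fix A B :: "real set" assume "A \<in> sets borel" "B \<in> sets borel"
    then show "\<exists>C. h -` A \<inter> space P \<inter> (h -` B \<inter> space P) = h -` C \<inter> space P \<and> C \<in> sets borel"
      by (intro exI[of _ "A \<inter> B"]) auto
  qed
  ultimately show ?thesis
    unfolding indep_var_eq by (auto intro: indep_set_sigma_sets)
qed

lemma integral_F_increment:
  fixes f :: "'a \<Rightarrow> real" and g :: "'v \<Rightarrow> real"
  assumes "f \<in> borel_measurable (F t)" "g \<in> borel_measurable borel" "0 \<le> t" "t \<le> u"
    and "integrable P f" "integrable P (\<lambda>\<omega>. g (W u \<omega> - W t \<omega>))"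
  shows "integrable P (\<lambda>\<omega>. f \<omega> * g (W u \<omega> - W t \<omega>))"
    "(\<integral>\<omega>. f \<omega> * g (W u \<omega> - W t \<omega>) \<partial>P) = (\<integral>\<omega>. f \<omega> \<partial>P) * (\<integral>\<omega>. g (W u \<omega> - W t \<omega>) \<partial>P)"
  using indep_var_integrable[OF indep_var_F_increment[OF assms(1-4)] assms(5,6)]
    indep_var_lebesgue_integral[OF indep_var_F_increment[OF assms(1-4)] assms(5,6)] by auto

text \<open>First-order bounds in \<open>s\<close>. Leaving state 1 is what lowers the Lyapunov
  function through its jump term, so that probability needs a lower bound with quadratic error; for
  entering state 1 an upper bound is enough.\<close>

lemma two_state_trans_bounds:
  assumes "0 \<le> s"
  shows "0 \<le> two_state_trans lm lp s 0 1" "two_state_trans lm lp s 0 1 \<le> lm * s"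
    "0 \<le> two_state_trans lm lp s 1 0" "two_state_trans lm lp s 1 0 \<le> lp * s"
    "lp * s - lp * (lm + lp) * s\<^sup>2 \<le> two_state_trans lm lp s 1 0" "two_state_trans lm lp s 1 0 \<le> 1"
proof -
  define q where "q = lm + lp"
  have q: "0 < q" using lm lp by (simp add: q_def)
  have e: "0 \<le> 1 - exp (- q * s)" "1 - exp (- q * s) \<le> q * s"
    using q assms exp_ge_add_one_self[of "- q * s"] by simp_all
  have "exp (- (q * s)) \<le> 1 - q * s + (q * s)\<^sup>2"
  proof -
    have "exp (q * s) \<ge> 1 + q * s" by (rule exp_ge_add_one_self)
    then have "exp (- (q * s)) \<le> 1 / (1 + q * s)"
      using q assms by (simp add: exp_minus divide_simps add_pos_nonneg)
    also have "\<dots> \<le> 1 - q * s + (q * s)\<^sup>2"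
    proof -
      have "0 < 1 + q * s" using q assms by (simp add: add_pos_nonneg)
      \<comment> \<open>With y = \<open>q * s\<close> the product equals 1 + y^3.\<close>
      moreover have "1 \<le> (1 - q * s + (q * s)\<^sup>2) * (1 + q * s)"
        using q assms by (simp add: power2_eq_square algebra_simps)
      ultimately show ?thesis by (simp add: pos_divide_le_eq)
    qed
    finally show ?thesis .
  qed
  then have e3: "q * s - (q * s)\<^sup>2 \<le> 1 - exp (- q * s)" by simp
  have "lp / q * (1 - exp (- q * s)) \<le> 1 * 1"
    using q lm lp e(1) by (intro mult_mono) (auto simp: q_def)
  then show "two_state_trans lm lp s 1 0 \<le> 1"
    by (simp add: two_state_trans_def Let_def q_def[symmetric])
  show "0 \<le> two_state_trans lm lp s 0 1" "0 \<le> two_state_trans lm lp s 1 0"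
    using e q lm lp by (simp_all add: two_state_trans_def Let_def q_def[symmetric])
  show "two_state_trans lm lp s 0 1 \<le> lm * s" "two_state_trans lm lp s 1 0 \<le> lp * s"
    using mult_left_mono[OF e(2), of "lm / q"] mult_left_mono[OF e(2), of "lp / q"] q lm lp
    by (simp_all add: two_state_trans_def Let_def q_def[symmetric])
  show "lp * s - lp * (lm + lp) * s\<^sup>2 \<le> two_state_trans lm lp s 1 0"
    using mult_left_mono[OF e3, of "lp / q"] q lm lp
    by (simp add: two_state_trans_def Let_def q_def[symmetric] algebra_simps power2_eq_square diff_divide_distrib)
qed

lemma two_state_trans_1_1: "two_state_trans lm lp s 1 1 = 1 - two_state_trans lm lp s 1 0"
  by (simp add: two_state_trans_def Let_def)

lemma integral_F_chain:
  assumes f: "f \<in> borel_measurable (F t)" "\<And>\<omega>. 0 \<le> f \<omega>" "integrable P f" and tu: "0 \<le> t" "t \<le> u"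
    and c: "0 \<le> two_state_trans lm lp (u - t) i m"
  shows "(\<integral>\<omega>. f \<omega> * indicator {\<omega>\<in>space P. Z t \<omega> = i \<and> Z u \<omega> = m} \<omega> \<partial>P) =
    two_state_trans lm lp (u - t) i m * (\<integral>\<omega>. f \<omega> * indicator {\<omega>\<in>space P. Z t \<omega> = i} \<omega> \<partial>P)"
proof -
  have [measurable]: "Z u \<in> measurable P (count_space UNIV)" "Z t \<in> measurable P (count_space UNIV)"
    "f \<in> borel_measurable P" using tu f measurable_F_P by auto
  have eq: "(\<integral>\<^sup>+ \<omega>. ennreal (f \<omega>) * indicator {\<omega>\<in>space P. Z t \<omega> = i \<and> Z u \<omega> = m} \<omega> \<partial>P) =
    ennreal (two_state_trans lm lp (u - t) i m) * (\<integral>\<^sup>+ \<omega>. ennreal (f \<omega>) * indicator {\<omega>\<in>space P. Z t \<omega> = i} \<omega> \<partial>P)"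
    by (rule nn_integral_indicator_proportional[OF sets_F_subset])
      (use f c chain_markov_F[OF _ tu] finite_measure_axioms in \<open>auto\<close>)
  have conv: "(\<integral>\<omega>. f \<omega> * indicator D \<omega> \<partial>P) = enn2real (\<integral>\<^sup>+ \<omega>. ennreal (f \<omega>) * indicator D \<omega> \<partial>P)"
    if "D \<in> sets P" for D
    using that f(2) by (subst integral_eq_nn_integral) (auto simp: ennreal_mult ennreal_indicator)
  show ?thesis
    using c by (subst (1 2) conv) (simp_all add: eq enn2real_mult)
qed

text \<open>The conditional expectation of \<open>Z u\<close> and the conditional probability of a
  change of state, in weak form: \<open>f\<close> is an arbitrary nonnegative integrable weight
  known at time \<open>t\<close>. As the chain is 0 or 1, both integrands are sums of two indicators
  of transitions.\<close>

lemma integral_F_chain_1: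
  assumes f: "f \<in> borel_measurable (F t)" "\<And>\<omega>. 0 \<le> f \<omega>" "integrable P f" and tu: "0 \<le> t" "t \<le> u"
  shows "integrable P (\<lambda>\<omega>. f \<omega> * real (Z u \<omega>))"
    "(\<integral>\<omega>. f \<omega> * real (Z u \<omega>) \<partial>P) =
      (\<integral>\<omega>. f \<omega> * (if Z t \<omega> = 0 then two_state_trans lm lp (u - t) 0 1 else 1 - two_state_trans lm lp (u - t) 1 0) \<partial>P)"
    "integrable P (\<lambda>\<omega>. f \<omega> * of_bool (Z u \<omega> \<noteq> Z t \<omega>))"
    "(\<integral>\<omega>. f \<omega> * of_bool (Z u \<omega> \<noteq> Z t \<omega>) \<partial>P) \<le> (lm + lp) * (u - t) * (\<integral>\<omega>. f \<omega> \<partial>P)"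
proof -
  have [measurable]: "Z u \<in> measurable P (count_space UNIV)" "Z t \<in> measurable P (count_space UNIV)"
    "f \<in> borel_measurable P" using tu f measurable_F_P by auto
  let ?p = "two_state_trans lm lp (u - t)"
  let ?B = "\<lambda>i m. {\<omega>\<in>space P. Z t \<omega> = i \<and> Z u \<omega> = m}" and ?C = "\<lambda>i. {\<omega>\<in>space P. Z t \<omega> = i}"
  have p: "0 \<le> ?p 0 1" "?p 0 1 \<le> lm * (u - t)" "0 \<le> ?p 1 0" "?p 1 0 \<le> lp * (u - t)" "?p 1 0 \<le> 1"
    using two_state_trans_bounds[of "u - t"] tu by auto
  have Z01: "Z t \<omega> = 0 \<or> Z t \<omega> = 1" "Z u \<omega> = 0 \<or> Z u \<omega> = 1" if "\<omega> \<in> space P" for \<omega>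
    using Z_range that tu by auto
  have i[simp]: "integrable P (\<lambda>\<omega>. f \<omega> * indicator D \<omega>)" if "D \<in> sets P" for D
    using f(3) that by (rule integrable_real_mult_indicator[rotated])
  have e1: "f \<omega> * real (Z u \<omega>) = f \<omega> * indicator (?B 0 1) \<omega> + f \<omega> * indicator (?B 1 1) \<omega>" if "\<omega> \<in> space P" for \<omega>
    using Z01[OF that] that by (auto simp: indicator_def)
  have e2: "f \<omega> * of_bool (Z u \<omega> \<noteq> Z t \<omega>) = f \<omega> * indicator (?B 0 1) \<omega> + f \<omega> * indicator (?B 1 0) \<omega>" if "\<omega> \<in> space P" for \<omega>
    using Z01[OF that] that by (auto simp: indicator_def)
  have e3: "f \<omega> * (if Z t \<omega> = 0 then ?p 0 1 else 1 - ?p 1 0) =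
      ?p 0 1 * (f \<omega> * indicator (?C 0) \<omega>) + (1 - ?p 1 0) * (f \<omega> * indicator (?C 1) \<omega>)" if "\<omega> \<in> space P" for \<omega>
    using Z01[OF that] that by (auto simp: indicator_def)
  show "integrable P (\<lambda>\<omega>. f \<omega> * real (Z u \<omega>))"
    by (subst Bochner_Integration.integrable_cong[OF refl e1]) auto
  have "(\<integral>\<omega>. f \<omega> * real (Z u \<omega>) \<partial>P) =
      (\<integral>\<omega>. f \<omega> * indicator (?B 0 1) \<omega> \<partial>P) + (\<integral>\<omega>. f \<omega> * indicator (?B 1 1) \<omega> \<partial>P)"
    by (subst Bochner_Integration.integral_cong[OF refl e1]) auto
  also have "\<dots> = ?p 0 1 * (\<integral>\<omega>. f \<omega> * indicator (?C 0) \<omega> \<partial>P) + (1 - ?p 1 0) * (\<integral>\<omega>. f \<omega> * indicator (?C 1) \<omega> \<partial>P)"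
    using p two_state_trans_1_1[of "u - t"] by (simp add: integral_F_chain[OF f tu])
  also have "\<dots> = (\<integral>\<omega>. f \<omega> * (if Z t \<omega> = 0 then ?p 0 1 else 1 - ?p 1 0) \<partial>P)"
    by (subst Bochner_Integration.integral_cong[OF refl e3]) auto
  finally show "(\<integral>\<omega>. f \<omega> * real (Z u \<omega>) \<partial>P) = (\<integral>\<omega>. f \<omega> * (if Z t \<omega> = 0 then ?p 0 1 else 1 - ?p 1 0) \<partial>P)" .
  show "integrable P (\<lambda>\<omega>. f \<omega> * of_bool (Z u \<omega> \<noteq> Z t \<omega>))"
    by (subst Bochner_Integration.integrable_cong[OF refl e2]) auto
  have le: "(\<integral>\<omega>. f \<omega> * indicator (?C k) \<omega> \<partial>P) \<le> (\<integral>\<omega>. f \<omega> \<partial>P)" for k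
    using f(2,3) by (intro integral_mono) (auto split: split_indicator)
  have nn: "0 \<le> (\<integral>\<omega>. f \<omega> \<partial>P)" "0 \<le> (\<integral>\<omega>. f \<omega> * indicator (?C k) \<omega> \<partial>P)" for k
    using f(2) by (auto intro!: integral_nonneg)
  have "(\<integral>\<omega>. f \<omega> * of_bool (Z u \<omega> \<noteq> Z t \<omega>) \<partial>P) =
      (\<integral>\<omega>. f \<omega> * indicator (?B 0 1) \<omega> \<partial>P) + (\<integral>\<omega>. f \<omega> * indicator (?B 1 0) \<omega> \<partial>P)"
    by (subst Bochner_Integration.integral_cong[OF refl e2]) auto
  also have "\<dots> = ?p 0 1 * (\<integral>\<omega>. f \<omega> * indicator (?C 0) \<omega> \<partial>P) + ?p 1 0 * (\<integral>\<omega>. f \<omega> * indicator (?C 1) \<omega> \<partial>P)"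
    using p by (simp add: integral_F_chain[OF f tu])
  also have "\<dots> \<le> (lm * (u - t)) * (\<integral>\<omega>. f \<omega> \<partial>P) + (lp * (u - t)) * (\<integral>\<omega>. f \<omega> \<partial>P)"
    using p le nn lm lp tu by (intro add_mono mult_mono) auto
  finally show "(\<integral>\<omega>. f \<omega> * of_bool (Z u \<omega> \<noteq> Z t \<omega>) \<partial>P) \<le> (lm + lp) * (u - t) * (\<integral>\<omega>. f \<omega> \<partial>P)"
    by (simp add: algebra_simps)
qed

end

section \<open>Pathwise bounds on the drift\<close>

text \<open>With right endpoints as nodes, the node of the cell containing \<open>s\<close> lies
  strictly to the right of \<open>s\<close> and tends to it, so right-continuity gives pointwise
  convergence of the step functions, and Fatou does the rest. The right side involves finitely many
  times for each \<open>n\<close>, so expectations can be taken term by term.\<close>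

lemma nn_integral_le_liminf_Riemann:
  fixes g :: "real \<Rightarrow> real"
  assumes h: "0 < h" and nn: "\<And>s. 0 \<le> g s"
    and rc: "\<And>s. t \<le> s \<Longrightarrow> s < t + h \<Longrightarrow> continuous (at_right s) g"
  shows "(\<integral>\<^sup>+ s. ennreal (g s) * indicator {t..<t + h} s \<partial>lborel) \<le>
    liminf (\<lambda>n. \<Sum>k<Suc n. ennreal (h / Suc n * g (t + (real k + 1) * h / Suc n)))"
proof -
  define r where "r n k = t + real k * h / Suc n" for n k
  define G where "G n s = (\<Sum>k<Suc n. ennreal (g (r n (Suc k))) * indicator {r n k..<r n (Suc k)} s)" for n s
  have rlt2: "r n (Suc k) - r n k = h / Suc n" for n k
    by (simp add: r_def diff_divide_distrib[symmetric] algebra_simps)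
  have rlt1: "r n k \<le> r n (Suc k)" for n k
    using rlt2[of n k] divide_nonneg_pos[of h "real (Suc n)"] h by linarith
  note rlt = rlt1 rlt2
  have lim: "(\<lambda>n. G n s) \<longlonglongrightarrow> ennreal (g s)" if s: "t \<le> s" "s < t + h" for s
  proof -
    \<comment> \<open>Index of the cell of the \<open>n\<close>-th partition that contains
      \<open>s\<close>.\<close>
    define K where "K n = nat \<lfloor>(s - t) * Suc n / h\<rfloor>" for n
    have K1: "real (K n) \<le> (s - t) * Suc n / h" "(s - t) * Suc n / h < real (K n) + 1" for n
      using s h by (simp_all add: K_def of_nat_nat)
    have "K n < Suc n" for n
    proof -
      have "(s - t) * Suc n / h < 1 * real (Suc n)"
        unfolding times_divide_eq_left[symmetric] using s h by (intro mult_strict_right_mono) auto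
      then have "real (K n) < real (Suc n)" using K1(1)[of n] by simp
      then show ?thesis by (simp only: of_nat_less_iff)
    qed
    have iff: "s \<in> {r n k..<r n (Suc k)} \<longleftrightarrow> k = K n" for n k
    proof -
      have "s \<in> {r n k..<r n (Suc k)} \<longleftrightarrow> real k \<le> (s - t) * Suc n / h \<and> (s - t) * Suc n / h < real k + 1"
        using h by (simp add: r_def field_simps)
      also have "\<dots> \<longleftrightarrow> k = K n" using K1[of n] by auto
      finally show ?thesis .
    qed
    have G: "G n s = ennreal (g (r n (Suc (K n))))" for n
      unfolding G_def indicator_def iff using \<open>K n < Suc n\<close> by (simp add: if_distrib sum.delta cong: if_cong del: sum.lessThan_Suc)
    have sK: "s < r n (Suc (K n))" "r n (Suc (K n)) \<le> s + h / Suc n" for n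
      using iff[of n "K n"] rlt(2)[of n "K n"] by auto
    have "(\<lambda>n. r n (Suc (K n))) \<longlonglongrightarrow> s"
    proof (rule tendsto_sandwich[where f="\<lambda>_. s" and h="\<lambda>n. s + h / Suc n"])
      show "(\<lambda>n. s + h / Suc n) \<longlonglongrightarrow> s"
        using tendsto_add[OF tendsto_const tendsto_mult[OF tendsto_const LIMSEQ_inverse_real_of_nat], of s h]
        by (simp add: divide_inverse)
    qed (use sK in \<open>auto intro: always_eventually less_imp_le\<close>)
    then have "filterlim (\<lambda>n. r n (Suc (K n))) (at_right s) sequentially"
      using less_imp_neq[OF sK(1), symmetric] sK(1) by (simp add: filterlim_at)
    then have "(\<lambda>n. g (r n (Suc (K n)))) \<longlonglongrightarrow> g s"
      using rc[OF s] unfolding continuous_within by (rule filterlim_compose[rotated])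
    then show ?thesis unfolding G by (rule tendsto_ennrealI)
  qed
  have Gm[measurable]: "G n \<in> borel_measurable lborel" for n
    unfolding G_def by measurable
  have "(\<integral>\<^sup>+ s. ennreal (g s) * indicator {t..<t + h} s \<partial>lborel) \<le> (\<integral>\<^sup>+ s. liminf (\<lambda>n. G n s) \<partial>lborel)"
  proof (rule nn_integral_mono)
    fix s show "ennreal (g s) * indicator {t..<t + h} s \<le> liminf (\<lambda>n. G n s)"
      using lim_imp_Liminf[OF _ lim[of s]] by (auto split: split_indicator)
  qed
  also have "\<dots> \<le> liminf (\<lambda>n. \<integral>\<^sup>+ s. G n s \<partial>lborel)"
    by (rule nn_integral_liminf) simp
  also have "(\<lambda>n. \<integral>\<^sup>+ s. G n s \<partial>lborel) = (\<lambda>n. \<Sum>k<Suc n. ennreal (h / Suc n * g (t + (real k + 1) * h / Suc n)))"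
  proof
    fix n
    have "(\<integral>\<^sup>+ s. G n s \<partial>lborel) = (\<Sum>k<Suc n. ennreal (g (r n (Suc k))) * ennreal (h / Suc n))"
      unfolding G_def using rlt by (subst nn_integral_sum) (simp_all add: nn_integral_cmult del: sum.lessThan_Suc)
    also have "\<dots> = (\<Sum>k<Suc n. ennreal (h / Suc n * g (t + (real k + 1) * h / Suc n)))"
      using nn h by (intro sum.cong) (simp_all add: ennreal_mult[symmetric] r_def mult.commute add.commute)
    finally show "(\<integral>\<^sup>+ s. G n s \<partial>lborel) = (\<Sum>k<Suc n. ennreal (h / Suc n * g (t + (real k + 1) * h / Suc n)))" .
  qed
  finally show ?thesis .
qed

lemma ennreal_integral_le_nn_integral:
  assumes "integrable N f"
  shows "ennreal (\<integral>x. f x \<partial>N) \<le> (\<integral>\<^sup>+ x. ennreal (f x) \<partial>N)"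
proof -
  have "(\<integral>x. f x \<partial>N) \<le> (\<integral>x. max 0 (f x) \<partial>N)"
    using assms by (intro integral_mono) auto
  then have "ennreal (\<integral>x. f x \<partial>N) \<le> ennreal (\<integral>x. max 0 (f x) \<partial>N)" by (rule ennreal_leI)
  also have "\<dots> = (\<integral>\<^sup>+ x. ennreal (max 0 (f x)) \<partial>N)"
    using assms by (intro nn_integral_eq_integral[symmetric]) auto
  also have "\<dots> = (\<integral>\<^sup>+ x. ennreal (f x) \<partial>N)"
    by (intro nn_integral_cong) (simp add: max_def ennreal_neg)
  finally show ?thesis .
qed

lemma norm_set_integral_le:
  fixes f :: "real \<Rightarrow> 'v::euclidean_space"
  assumes "set_integrable lborel {t<..u} f" "t \<le> u" "\<And>s. s \<in> {t<..u} \<Longrightarrow> norm (f s) \<le> B"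
  shows "norm (LINT s:{t<..u}|lborel. f s) \<le> B * (u - t)"
proof -
  have "norm (LINT s:{t<..u}|lborel. f s) \<le> (LINT s:{t<..u}|lborel. norm (f s))"
    using assms(1) by (rule set_integral_norm_bound)
  also have "\<dots> \<le> (LINT s:{t<..u}|lborel. B)"
    using assms by (intro set_integral_mono set_integrable_norm) (auto simp: set_integrable_def)
  also have "\<dots> = B * (u - t)"
    using assms(2) by (simp add: set_lebesgue_integral_def)
  finally show ?thesis .
qed

locale switching_drift = switching P lm lp b x z W Z X
  for P :: "'a measure" and lm lp :: real and b :: "'v::euclidean_space \<Rightarrow> nat \<Rightarrow> 'v" and x :: 'v and z :: nat
    and W :: "real \<Rightarrow> 'a \<Rightarrow> 'v" and Z :: "real \<Rightarrow> 'a \<Rightarrow> nat" and X :: "real \<Rightarrow> 'a \<Rightarrow> 'v" +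
  fixes B M rm rp :: real
  assumes B: "\<And>y k. k \<in> {0, 1} \<Longrightarrow> norm (b y k) \<le> B"
    and M: "0 < M" and rm: "0 < rm" and rp: "0 < rp"
    and drift0: "\<And>y. M \<le> norm y \<Longrightarrow> y \<bullet> b y 0 \<le> - rm"
    and drift1: "\<And>y. M \<le> norm y \<Longrightarrow> y \<bullet> b y 1 \<le> rp"
begin

lemma B_nonneg: "0 \<le> B"
  using B[of 0 0] norm_ge_zero[of "b 0 0"] by (simp del: norm_ge_zero)

text \<open>The assumed upper bound for the inner product of \<open>y\<close> and
  \<open>b y k\<close> outside the ball of radius \<open>M\<close>.\<close>

definition radial :: "nat \<Rightarrow> real" where
  "radial k = (if k = 0 then - rm else rp)"

text \<open>The first summand pays for replacing \<open>y\<close> by \<open>v\<close> in the inner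
  product with the drift. The rest pays for points inside the ball, where that inner product is at
  most \<open>B * M\<close> while \<open>radial\<close> may be as low as
  \<open>- rm\<close>.\<close>

definition K :: real where "K = B + B * M + rm"

lemma K_nonneg: "0 \<le> K"
  using B_nonneg M rm by (simp add: K_def)

text \<open>When the path has meanwhile entered the ball of radius \<open>M\<close>, it has moved by at least \<open>1\<close>, so
  the error term absorbs the missing drift condition.\<close>

lemma inner_drift_le:
  assumes "M + 1 \<le> norm v" and "k \<in> {0, 1}"
  shows "v \<bullet> b y k \<le> radial k + K * norm (y - v)"
proof -
  have bnd: "norm (b y k) \<le> B" using B[OF assms(2)] .
  have diff: "(v - y) \<bullet> b y k \<le> norm (y - v) * B"
    using norm_cauchy_schwarz[of "v - y" "b y k"] mult_left_mono[OF bnd, of "norm (v - y)"] by (simp add: norm_minus_commute)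
  have split: "v \<bullet> b y k = y \<bullet> b y k + (v - y) \<bullet> b y k" by (simp add: inner_diff_left)
  have Kge: "B * norm (y - v) \<le> K * norm (y - v)"
    using M rm B_nonneg by (intro mult_right_mono) (auto simp: K_def)
  show ?thesis
  proof (cases "M \<le> norm y")
    case True
    have "y \<bullet> b y k \<le> radial k"
      using drift0[OF True] drift1[OF True] assms(2) by (auto simp: radial_def)
    then show ?thesis using diff split Kge by (simp add: mult.commute)
  next
    case False
    have "norm v \<le> norm y + norm (y - v)"
      by (metis add.commute norm_minus_commute norm_triangle_sub)
    then have 1: "1 \<le> norm (y - v)" using False assms(1) by linarith
    have "y \<bullet> b y k \<le> norm y * norm (b y k)" by (rule norm_cauchy_schwarz)
    also have "\<dots> \<le> M * B" using False bnd B_nonneg M by (intro mult_mono) auto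
    finally have "y \<bullet> b y k \<le> M * B" .
    moreover have "(B * M + rm) * 1 \<le> (B * M + rm) * norm (y - v)"
      using 1 B_nonneg M rm by (intro mult_left_mono) auto
    moreover have "- rm \<le> radial k" using rm rp by (simp add: radial_def)
    moreover have "K * norm (y - v) = norm (y - v) * B + (B * M + rm) * norm (y - v)"
      by (simp add: K_def algebra_simps)
    moreover have "v \<bullet> b y k \<le> M * B + norm (y - v) * B"
      using \<open>y \<bullet> b y k \<le> M * B\<close> diff unfolding split by (rule add_mono)
    ultimately show ?thesis by (simp add: mult.commute)
  qed
qed

text \<open>Dominates the excess of X_t . b(X_s, Z_s) over \<open>radial (Z t \<omega>)\<close> when
  X_t is far out and s lies in the step. \<open>rm + rp\<close> is the gap between the two radial
  bounds, paid if the chain has moved. \<open>X\<close> does not occur: its displacement is at most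
  \<open>B * h\<close> plus that of \<open>W\<close>, so only increments with known laws
  remain.\<close>

definition path_error :: "real \<Rightarrow> real \<Rightarrow> 'a \<Rightarrow> real \<Rightarrow> real" where
  "path_error t h \<omega> s = (rm + rp) * of_bool (Z s \<omega> \<noteq> Z t \<omega>) + K * (B * h + norm (W s \<omega> - W t \<omega>))"

lemma path_error_nonneg: "0 \<le> h \<Longrightarrow> 0 \<le> path_error t h \<omega> s"
  using rm rp K_nonneg B_nonneg by (simp add: path_error_def)

text \<open>Written through \<open>X\<close> and \<open>W\<close> instead of as a time integral, so
  that measurability in the outcome is immediate; the integral form holds almost surely.\<close>

abbreviation drift_incr :: "real \<Rightarrow> real \<Rightarrow> 'a \<Rightarrow> 'v" where
  "drift_incr t u \<omega> \<equiv> X u \<omega> - X t \<omega> - (W u \<omega> - W t \<omega>)"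

lemma AE_path:
  "AE \<omega> in P. (\<forall>s\<ge>0. Z s \<omega> \<in> {0, 1}) \<and> continuous_on {0..} (\<lambda>t. W t \<omega>) \<and>
     (\<forall>t\<ge>0. continuous (at_right t) (\<lambda>s. Z s \<omega>)) \<and>
     (\<forall>t\<ge>0. \<forall>u\<ge>t. set_integrable lborel {t<..u} (\<lambda>s. b (X s \<omega>) (Z s \<omega>)) \<and>
        drift_incr t u \<omega> = (LINT s:{t<..u}|lborel. b (X s \<omega>) (Z s \<omega>)))"
proof -
  have "AE \<omega> in P. \<forall>t\<ge>0. set_integrable lborel {0..t} (\<lambda>s. b (X s \<omega>) (Z s \<omega>)) \<and>
      X t \<omega> = x + (LINT s:{0..t}|lborel. b (X s \<omega>) (Z s \<omega>)) + W t \<omega>"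
    using sol by (simp add: switching_solution_def)
  moreover have "AE \<omega> in P. continuous_on {0..} (\<lambda>t. W t \<omega>)"
    using wiener by (simp add: std_wiener_def)
  moreover have "AE \<omega> in P. \<forall>t\<ge>0. continuous (at_right t) (\<lambda>s. Z s \<omega>) \<and>
                         (0 < t \<longrightarrow> (\<exists>l. ((\<lambda>s. Z s \<omega>) \<longlongrightarrow> l) (at_left t)))"
    using chain by (simp add: two_state_chain_def)
  moreover have "AE \<omega> in P. \<omega> \<in> space P" by (rule AE_space)
  ultimately show ?thesis
  proof eventually_elim
    case (elim \<omega>)
    let ?f = "\<lambda>s. b (X s \<omega>) (Z s \<omega>)"
    have "set_integrable lborel {t<..u} ?f \<and> drift_incr t u \<omega> = (LINT s:{t<..u}|lborel. ?f s)" if "0 \<le> t" "t \<le> u" for t u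
    proof -
      have i: "set_integrable lborel {0..u} ?f" "set_integrable lborel {0..t} ?f" using elim(1) that by auto
      have j: "set_integrable lborel {t<..u} ?f"
        using i(1) by (rule set_integrable_subset) (use that in auto)
      have "{0..u} = {0..t} \<union> {t<..u}" using that by auto
      then have "(LINT s:{0..u}|lborel. ?f s) = (LINT s:{0..t}|lborel. ?f s) + (LINT s:{t<..u}|lborel. ?f s)"
        using set_integral_Un[OF _ i(2) j] by (simp add: Int_def)
      moreover have "X u \<omega> = x + (LINT s:{0..u}|lborel. ?f s) + W u \<omega>" "X t \<omega> = x + (LINT s:{0..t}|lborel. ?f s) + W t \<omega>"
        using elim(1) that by auto
      ultimately show ?thesis using j by simp
    qed
    moreover have "\<forall>s\<ge>0. Z s \<omega> \<in> {0, 1}" using Z_range[OF _ elim(4)] by simp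
    ultimately show ?case using elim(2,3) by blast
  qed
qed

lemma AE_drift_incr_le:
  "AE \<omega> in P. \<forall>t\<ge>0. \<forall>u\<ge>t. norm (drift_incr t u \<omega>) \<le> B * (u - t)"
  using AE_path
proof eventually_elim
  case (elim \<omega>)
  show ?case
  proof (intro allI impI)
    fix t u :: real assume tu: "0 \<le> t" "t \<le> u"
    then have "set_integrable lborel {t<..u} (\<lambda>s. b (X s \<omega>) (Z s \<omega>))"
      and eq: "drift_incr t u \<omega> = (LINT s:{t<..u}|lborel. b (X s \<omega>) (Z s \<omega>))" using elim by auto
    moreover have "norm (b (X s \<omega>) (Z s \<omega>)) \<le> B" if "s \<in> {t<..u}" for s
      using elim tu that by (intro B) simp
    ultimately show "norm (drift_incr t u \<omega>) \<le> B * (u - t)"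
      unfolding eq using tu by (intro norm_set_integral_le)
  qed
qed

text \<open>The pathwise half of the drift estimate: the integrand is dominated by
  \<open>path_error\<close>, which is right-continuous in time because \<open>Z\<close> is and
  \<open>W\<close> is continuous. Values in \<open>ennreal\<close> discard the negative part of the
  left side, which is harmless for an upper bound.\<close>

lemma AE_radial_drift_le:
  assumes t: "0 \<le> t" and h: "0 < h"
  shows "AE \<omega> in P. M + 1 \<le> norm (X t \<omega>) \<longrightarrow>
    ennreal (X t \<omega> \<bullet> drift_incr t (t + h) \<omega> - h * radial (Z t \<omega>)) \<le>
      liminf (\<lambda>n. \<Sum>k<Suc n. ennreal (h / Suc n * path_error t h \<omega> (t + (real k + 1) * h / Suc n)))"
  using AE_path AE_drift_incr_le
proof eventually_elim
  case (elim \<omega>)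
  let ?f = "\<lambda>s. b (X s \<omega>) (Z s \<omega>)" and ?v = "X t \<omega>" and ?a = "radial (Z t \<omega>)" and ?g = "path_error t h \<omega>"
  show ?case
  proof
    assume far: "M + 1 \<le> norm ?v"
    have int: "set_integrable lborel {t<..t + h} ?f"
      and eq: "drift_incr t (t + h) \<omega> = (LINT s:{t<..t + h}|lborel. ?f s)"
      using elim(1) t h by auto
    have le: "?v \<bullet> ?f s - ?a \<le> ?g s" if s: "t < s" "s \<le> t + h" for s
    proof -
      have "?v \<bullet> ?f s \<le> radial (Z s \<omega>) + K * norm (X s \<omega> - ?v)"
        using elim(1) t s by (intro inner_drift_le far) auto
      moreover have "radial (Z s \<omega>) \<le> ?a + (rm + rp) * of_bool (Z s \<omega> \<noteq> Z t \<omega>)"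
        using rm rp by (auto simp: radial_def)
      moreover have "norm (X s \<omega> - ?v) \<le> B * h + norm (W s \<omega> - W t \<omega>)"
      proof -
        have "norm (X s \<omega> - ?v) \<le> norm (drift_incr t s \<omega>) + norm (W s \<omega> - W t \<omega>)"
          using norm_triangle_ineq[of "drift_incr t s \<omega>" "W s \<omega> - W t \<omega>"] by simp
        moreover have "norm (drift_incr t s \<omega>) \<le> B * (s - t)" using elim(2) t s by simp
        moreover have "B * (s - t) \<le> B * h" using s B_nonneg by (intro mult_left_mono) auto
        ultimately show ?thesis by linarith
      qed
      from mult_left_mono[OF this K_nonneg] have "K * norm (X s \<omega> - ?v) \<le> K * (B * h + norm (W s \<omega> - W t \<omega>))" .
      ultimately show ?thesis by (simp add: path_error_def)
    qed
    have i2: "integrable lborel (\<lambda>s. ?v \<bullet> (indicator {t<..t + h} s *\<^sub>R ?f s))"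
      using int unfolding set_integrable_def by (rule integrable_inner_right)
    have i3: "integrable lborel (\<lambda>s. indicator {t<..t + h} s * ?a)" using h by simp
    have dist: "?v \<bullet> (indicator {t<..t + h} s *\<^sub>R ?f s) - indicator {t<..t + h} s * ?a =
        indicator {t<..t + h} s * (?v \<bullet> ?f s - ?a)" for s
      by (simp add: algebra_simps)
    have int': "integrable lborel (\<lambda>s. indicator {t<..t + h} s * (?v \<bullet> ?f s - ?a))"
      using Bochner_Integration.integrable_diff[OF i2 i3] unfolding dist .
    have "?v \<bullet> drift_incr t (t + h) \<omega> - h * ?a =
        (\<integral>s. ?v \<bullet> (indicator {t<..t + h} s *\<^sub>R ?f s) \<partial>lborel) - (\<integral>s. indicator {t<..t + h} s * ?a \<partial>lborel)"
      unfolding eq set_lebesgue_integral_def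
      using int h by (subst integral_inner_right) (auto simp: set_integrable_def)
    also have "\<dots> = (\<integral>s. indicator {t<..t + h} s * (?v \<bullet> ?f s - ?a) \<partial>lborel)"
      unfolding Bochner_Integration.integral_diff[OF i2 i3, symmetric] dist ..
    finally have "ennreal (?v \<bullet> drift_incr t (t + h) \<omega> - h * ?a) \<le>
        (\<integral>\<^sup>+ s. ennreal (indicator {t<..t + h} s * (?v \<bullet> ?f s - ?a)) \<partial>lborel)"
      using ennreal_integral_le_nn_integral[OF int'] by simp
    also have "\<dots> \<le> (\<integral>\<^sup>+ s. ennreal (?g s) * indicator {t..<t + h} s \<partial>lborel)"
    proof (rule nn_integral_mono_AE)
      \<comment> \<open>The two intervals differ only in their endpoints: \<open>t + h\<close> is a
        null set, and at \<open>t\<close> the right side is nonnegative.\<close>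
      have "AE s in lborel. s \<noteq> t + h" by (rule AE_lborel_singleton)
      then show "AE s in lborel. ennreal (indicator {t<..t + h} s * (?v \<bullet> ?f s - ?a)) \<le> ennreal (?g s) * indicator {t..<t + h} s"
        by eventually_elim (use le in \<open>auto split: split_indicator intro!: ennreal_leI\<close>)
    qed
    also have "\<dots> \<le> liminf (\<lambda>n. \<Sum>k<Suc n. ennreal (h / Suc n * ?g (t + (real k + 1) * h / Suc n)))"
    proof (rule nn_integral_le_liminf_Riemann[OF h])
      show "0 \<le> ?g s" for s using path_error_nonneg h by simp
      fix s assume s: "t \<le> s"
      have "continuous (at_right s) (\<lambda>r. Z r \<omega>)" using elim(1) s t by auto
      then have "eventually (\<lambda>r. Z r \<omega> = Z s \<omega>) (at_right s)"
        by (simp add: continuous_within tendsto_discrete)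
      then have c1: "((\<lambda>r. of_bool (Z r \<omega> \<noteq> Z t \<omega>) :: real) \<longlongrightarrow> of_bool (Z s \<omega> \<noteq> Z t \<omega>)) (at_right s)"
        by (intro tendsto_eventually) (auto elim!: eventually_mono)
      have "continuous (at s within {0..}) (\<lambda>r. W r \<omega>)"
        using elim(1) s t by (auto simp: continuous_on_eq_continuous_within)
      then have c2: "((\<lambda>r. W r \<omega>) \<longlongrightarrow> W s \<omega>) (at_right s)"
        unfolding continuous_within by (rule tendsto_within_subset) (use s t in auto)
      show "continuous (at_right s) ?g"
        unfolding continuous_within path_error_def
        by (intro tendsto_intros c1 c2)
    qed
    finally show "ennreal (?v \<bullet> drift_incr t (t + h) \<omega> - h * ?a) \<le>
      liminf (\<lambda>n. \<Sum>k<Suc n. ennreal (h / Suc n * ?g (t + (real k + 1) * h / Suc n)))" .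
  qed
qed

end

section \<open>One-step drift of the Lyapunov function\<close>

lemma power_le_one_plus_power4:
  fixes r :: real
  assumes "0 \<le> r" "k \<le> 4"
  shows "r ^ k \<le> 1 + r ^ 4"
proof (cases "r \<le> 1")
  case True
  then have "r ^ k \<le> 1" using assms(1) by (rule power_le_one[rotated])
  then show ?thesis using assms(1) zero_le_power[of r 4] by linarith
next
  case False
  then have "r ^ k \<le> r ^ 4" using assms(2) by (intro power_increasing) auto
  then show ?thesis by simp
qed

lemma add_power4_le:
  fixes a c :: real
  shows "(a + c) ^ 4 \<le> 8 * (a ^ 4 + c ^ 4)"
proof -
  have s: "(r + s)\<^sup>2 \<le> 2 * (r\<^sup>2 + s\<^sup>2)" for r s :: real
    using zero_le_power2[of "r - s"] by (simp add: power2_eq_square algebra_simps)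
  have "(a + c) ^ 4 = ((a + c)\<^sup>2)\<^sup>2" by simp
  also have "\<dots> \<le> (2 * (a\<^sup>2 + c\<^sup>2))\<^sup>2" using s[of a c] by (intro power_mono) auto
  also have "\<dots> = 4 * (a\<^sup>2 + c\<^sup>2)\<^sup>2" by algebra
  also have "\<dots> \<le> 4 * (2 * ((a\<^sup>2)\<^sup>2 + (c\<^sup>2)\<^sup>2))" using s[of "a\<^sup>2" "c\<^sup>2"] by simp
  finally show ?thesis by simp
qed

definition lyap :: "real \<Rightarrow> 'v::real_inner \<Rightarrow> nat \<Rightarrow> real" where
  "lyap \<delta> y k = norm y ^ 4 + \<delta> * (norm y)\<^sup>2 * real k"

text \<open>Here \<open>\<beta>\<close> stands for the drift displacement and \<open>\<xi>\<close>
  for the Gaussian increment. The square of |v|^2 + 2 v.D + |D|^2 with D =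
  \<open>\<beta> + \<xi>\<close> is expanded; the terms that determine the drift at order |v|^2 keep
  their exact coefficients, and everything of lower order in |v| goes into the last summand.\<close>

lemma lyap_step:
  fixes v \<beta> \<xi> :: "'v::real_inner"
  assumes \<beta>: "norm \<beta> \<le> m" and \<delta>: "0 \<le> \<delta>" and v: "1 \<le> norm v" and k': "k' \<le> 1"
  shows "lyap \<delta> (v + (\<beta> + \<xi>)) k' \<le> lyap \<delta> v k + 4 * (norm v)\<^sup>2 * (v \<bullet> \<xi>) + 4 * (v \<bullet> \<xi>)\<^sup>2 + 2 * (norm v)\<^sup>2 * (norm \<xi>)\<^sup>2
    + 4 * ((norm v)\<^sup>2 * (v \<bullet> \<beta>)) + \<delta> * ((norm v)\<^sup>2 * real k') - \<delta> * ((norm v)\<^sup>2 * real k)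
    + (norm v)\<^sup>2 * (12 * m * norm \<xi> + 6 * m\<^sup>2) + norm v * ((5 + 3 * \<delta>) * (8 * ((1 + m) ^ 4 + norm \<xi> ^ 4)))"
proof -
  define D where "D = \<beta> + \<xi>"
  define n r where "n = norm v" and "r = norm \<xi>"
  have m: "0 \<le> m" using \<beta> norm_ge_zero[of \<beta>] by linarith
  have n: "1 \<le> n" and r: "0 \<le> r" using v by (simp_all add: n_def r_def)
  have D: "norm D \<le> m + r"
    using norm_triangle_ineq[of \<beta> \<xi>] \<beta> by (simp add: D_def r_def)
  have vD: "\<bar>v \<bullet> D\<bar> \<le> n * norm D" unfolding n_def by (rule Cauchy_Schwarz_ineq2)
  have sq: "(norm (v + D))\<^sup>2 = n\<^sup>2 + 2 * (v \<bullet> D) + (norm D)\<^sup>2"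
    by (simp add: n_def power2_norm_eq_inner inner_add_left inner_add_right inner_commute)
  let ?T = "8 * ((1 + m) ^ 4 + r ^ 4)"
  \<comment> \<open>A single bound for all powers of |D| up to the fourth: enlarging the base by 1
    makes its powers increase with the exponent.\<close>
  have T: "(m + r) ^ j \<le> ?T" if "j \<le> 4" for j
  proof -
    have "(m + r) ^ j \<le> (1 + (m + r)) ^ j" using m r by (intro power_mono) auto
    also have "\<dots> \<le> (1 + (m + r)) ^ 4" using m r that by (intro power_increasing) auto
    also have "\<dots> = ((1 + m) + r) ^ 4" by (simp add: algebra_simps)
    also have "\<dots> \<le> ?T" by (rule add_power4_le)
    finally show ?thesis .
  qed
  have DT: "norm D ^ j \<le> ?T" if "j \<le> 4" for j
    using power_mono[OF D norm_ge_zero, of j] T[OF that] by linarith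
  have T0: "0 \<le> ?T" using m r by simp
  have "norm (v + D) ^ 4 = ((norm (v + D))\<^sup>2)\<^sup>2" by simp
  also have "\<dots> = n ^ 4 + 4 * n\<^sup>2 * (v \<bullet> D) + 4 * (v \<bullet> D)\<^sup>2 + 2 * n\<^sup>2 * (norm D)\<^sup>2 + 4 * (v \<bullet> D) * (norm D)\<^sup>2 + norm D ^ 4"
    unfolding sq by (simp add: power2_eq_square power4_eq_xxxx algebra_simps)
  finally have e4: "norm (v + D) ^ 4 = n ^ 4 + 4 * n\<^sup>2 * (v \<bullet> D) + 4 * (v \<bullet> D)\<^sup>2 + 2 * n\<^sup>2 * (norm D)\<^sup>2 + 4 * (v \<bullet> D) * (norm D)\<^sup>2 + norm D ^ 4" .
  have b1: "(v \<bullet> D)\<^sup>2 \<le> (v \<bullet> \<xi>)\<^sup>2 + n\<^sup>2 * (2 * m * r + m\<^sup>2)"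
  proof -
    have "\<bar>v \<bullet> \<beta>\<bar> \<le> n * m"
      using Cauchy_Schwarz_ineq2[of v \<beta>] mult_left_mono[OF \<beta>, of n] n by (simp add: n_def)
    moreover have x: "\<bar>v \<bullet> \<xi>\<bar> \<le> n * r" unfolding n_def r_def by (rule Cauchy_Schwarz_ineq2)
    ultimately have "\<bar>v \<bullet> \<beta>\<bar> * \<bar>v \<bullet> \<xi>\<bar> \<le> (n * m) * (n * r)" using n m by (intro mult_mono) auto
    then have "(v \<bullet> \<beta>) * (v \<bullet> \<xi>) \<le> (n * m) * (n * r)" by (simp add: abs_mult[symmetric])
    moreover have "(v \<bullet> \<beta>)\<^sup>2 \<le> (n * m)\<^sup>2" using \<open>\<bar>v \<bullet> \<beta>\<bar> \<le> n * m\<close> by (rule abs_le_square_iff[THEN iffD1, OF order_trans[OF _ abs_ge_self]])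
    moreover have "(v \<bullet> D)\<^sup>2 = (v \<bullet> \<xi>)\<^sup>2 + 2 * ((v \<bullet> \<beta>) * (v \<bullet> \<xi>)) + (v \<bullet> \<beta>)\<^sup>2"
      by (simp add: D_def inner_add_right power2_eq_square algebra_simps)
    ultimately show ?thesis by (simp add: power2_eq_square algebra_simps)
  qed
  have b2: "(norm D)\<^sup>2 \<le> r\<^sup>2 + (2 * m * r + m\<^sup>2)"
    using power_mono[OF D norm_ge_zero, of 2] by (simp add: power2_eq_square algebra_simps)
  have b2': "2 * n\<^sup>2 * (norm D)\<^sup>2 \<le> 2 * n\<^sup>2 * r\<^sup>2 + 2 * n\<^sup>2 * (2 * m * r + m\<^sup>2)"
    using mult_left_mono[OF b2, of "2 * n\<^sup>2"] by (simp add: distrib_left)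
  have b3: "4 * (v \<bullet> D) * (norm D)\<^sup>2 \<le> 4 * (n * ?T)"
  proof -
    have "(v \<bullet> D) * (norm D)\<^sup>2 \<le> (n * norm D) * (norm D)\<^sup>2" using vD by (intro mult_right_mono) auto
    also have "\<dots> = n * norm D ^ 3" by (simp add: power2_eq_square power3_eq_cube)
    also have "\<dots> \<le> n * ?T" using DT[of 3] n by (intro mult_left_mono) auto
    finally show ?thesis by simp
  qed
  have b4: "norm D ^ 4 \<le> n * ?T"
    using DT[of 4] mult_right_mono[OF n T0] by simp
  have b5: "(norm (v + D))\<^sup>2 \<le> n\<^sup>2 + 3 * (n * ?T)"
  proof -
    have "v \<bullet> D \<le> n * norm D" using vD by simp
    also have "\<dots> \<le> n * ?T" using DT[of 1] n by (intro mult_left_mono) auto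
    finally have "v \<bullet> D \<le> n * ?T" .
    moreover have "(norm D)\<^sup>2 \<le> n * ?T" using DT[of 2] mult_right_mono[OF n T0] by simp
    ultimately show ?thesis unfolding sq by simp
  qed
  have b6: "\<delta> * (norm (v + D))\<^sup>2 * real k' \<le> \<delta> * (n\<^sup>2 * real k') + 3 * \<delta> * (n * ?T)"
  proof -
    have "(norm (v + D))\<^sup>2 * real k' \<le> (n\<^sup>2 + 3 * (n * ?T)) * real k'" using b5 by (intro mult_right_mono) auto
    also have "\<dots> \<le> n\<^sup>2 * real k' + 3 * (n * ?T)"
      using k' n T0 mult_left_mono[of "real k'" 1 "3 * (n * ?T)"] by (simp add: distrib_right)
    finally show ?thesis using mult_left_mono[OF _ \<delta>] by (fastforce simp: algebra_simps)
  qed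
  have vv: "4 * n\<^sup>2 * (v \<bullet> D) = 4 * n\<^sup>2 * (v \<bullet> \<xi>) + 4 * (n\<^sup>2 * (v \<bullet> \<beta>))"
    by (simp add: D_def inner_add_right algebra_simps)
  \<comment> \<open>Bookkeeping of the constants: 12 and 6 collect 4 times the error in (v.D)^2 and
    2 times the error in |D|^2. Below, 5 is 4 from the cubic term plus 1 from the fourth power of
    |D|, and \<open>3 * \<delta>\<close> comes from |v + D|^2 - |v|^2.\<close>
  have g1: "n\<^sup>2 * (12 * m * r + 6 * m\<^sup>2) = 4 * (n\<^sup>2 * (2 * m * r + m\<^sup>2)) + 2 * n\<^sup>2 * (2 * m * r + m\<^sup>2)"
    by (simp add: algebra_simps)
  have g2: "n * ((5 + 3 * \<delta>) * ?T) = 4 * (n * ?T) + n * ?T + 3 * \<delta> * (n * ?T)"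
    by (simp add: algebra_simps)
  have "\<delta> * n\<^sup>2 * real k = \<delta> * (n\<^sup>2 * real k)" by simp
  then show ?thesis
    unfolding lyap_def D_def[symmetric] n_def[symmetric] r_def[symmetric] e4 g1 g2
    using b1 b2' b3 b4 b6 vv by linarith
qed

context switching_drift
begin

section \<open>Expected drift over one step\<close>

lemma increment_distributed:
  assumes "0 \<le> t" "t < u"
  shows "distributed P lborel (\<lambda>\<omega>. W u \<omega> - W t \<omega>) (\<lambda>y. ennreal (gauss_density (u - t) y))"
  using wiener assms by (simp add: std_wiener_def)

text \<open>Bound for the mean of \<open>path_error\<close> given the past, uniform over the step.
  It is of order sqrt h, and multiplied by the length of the step it yields the errors of order
  h^(3/2).\<close>

definition err :: "real \<Rightarrow> real" where
  "err h = (rm + rp) * ((lm + lp) * h) + K * (B * h + sqrt (real DIM('v) * h))"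

lemma path_error_measurable:
  assumes "0 \<le> t" "0 \<le> s"
  shows "(\<lambda>\<omega>. path_error t h \<omega> s) \<in> borel_measurable P"
proof -
  have [measurable]: "W s \<in> borel_measurable P" "W t \<in> borel_measurable P"
    "Z s \<in> measurable P (count_space UNIV)" "Z t \<in> measurable P (count_space UNIV)" using assms by auto
  have [measurable]: "(\<lambda>\<omega>. real (Z s \<omega>)) \<in> borel_measurable P" "(\<lambda>\<omega>. real (Z t \<omega>)) \<in> borel_measurable P" by measurable
  have "(\<lambda>\<omega>. of_bool (real (Z s \<omega>) \<noteq> real (Z t \<omega>)) :: real) \<in> borel_measurable P"
    unfolding of_bool_def by measurable
  then have [measurable]: "(\<lambda>\<omega>. of_bool (Z s \<omega> \<noteq> Z t \<omega>) :: real) \<in> borel_measurable P" by simp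
  show ?thesis unfolding path_error_def by measurable
qed

lemma path_error_expectation:
  assumes f: "f \<in> borel_measurable (F t)" "\<And>\<omega>. 0 \<le> f \<omega>" "integrable P f"
    and t: "0 \<le> t" "t < s" "s \<le> t + h"
  shows "integrable P (\<lambda>\<omega>. f \<omega> * path_error t h \<omega> s)"
    "(\<integral>\<omega>. f \<omega> * path_error t h \<omega> s \<partial>P) \<le> err h * (\<integral>\<omega>. f \<omega> \<partial>P)"
proof -
  have ts: "t \<le> s" "0 < s - t" using t by auto
  note g = gauss_norm_moments[OF increment_distributed[OF t(1,2)] ts(2) prob_space_axioms]
  have n1: "integrable P (\<lambda>\<omega>. f \<omega> * norm (W s \<omega> - W t \<omega>))"
    "(\<integral>\<omega>. f \<omega> * norm (W s \<omega> - W t \<omega>) \<partial>P) = (\<integral>\<omega>. f \<omega> \<partial>P) * (\<integral>\<omega>. norm (W s \<omega> - W t \<omega>) \<partial>P)"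
    using integral_F_increment[OF f(1) _ t(1) ts(1) f(3), of norm] g(3) by auto
  note c = integral_F_chain_1(3,4)[OF f t(1) ts(1)]
  have eq: "f \<omega> * path_error t h \<omega> s = (rm + rp) * (f \<omega> * of_bool (Z s \<omega> \<noteq> Z t \<omega>)) + (K * (B * h) * f \<omega> + K * (f \<omega> * norm (W s \<omega> - W t \<omega>)))" for \<omega>
    by (simp add: path_error_def algebra_simps)
  show "integrable P (\<lambda>\<omega>. f \<omega> * path_error t h \<omega> s)"
    unfolding eq using n1(1) c(1) f(3) by (intro Bochner_Integration.integrable_add integrable_mult_right)
  have Ef: "0 \<le> (\<integral>\<omega>. f \<omega> \<partial>P)" using f(2) by simp
  have "(\<integral>\<omega>. norm (W s \<omega> - W t \<omega>) \<partial>P) \<le> sqrt (real DIM('v) * h)"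
    using g(4) t(3) by (elim order_trans) (intro real_sqrt_le_mono mult_left_mono, auto)
  from mult_left_mono[OF this Ef]
  have 1: "(\<integral>\<omega>. f \<omega> * norm (W s \<omega> - W t \<omega>) \<partial>P) \<le> sqrt (real DIM('v) * h) * (\<integral>\<omega>. f \<omega> \<partial>P)"
    unfolding n1(2) by (simp add: mult.commute)
  have "(lm + lp) * (s - t) * (\<integral>\<omega>. f \<omega> \<partial>P) \<le> (lm + lp) * h * (\<integral>\<omega>. f \<omega> \<partial>P)"
    using lm lp t Ef by (intro mult_right_mono mult_left_mono) auto
  with c(2) have 2: "(\<integral>\<omega>. f \<omega> * of_bool (Z s \<omega> \<noteq> Z t \<omega>) \<partial>P) \<le> (lm + lp) * h * (\<integral>\<omega>. f \<omega> \<partial>P)" by linarith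
  have "(\<integral>\<omega>. f \<omega> * path_error t h \<omega> s \<partial>P) = (rm + rp) * (\<integral>\<omega>. f \<omega> * of_bool (Z s \<omega> \<noteq> Z t \<omega>) \<partial>P)
      + (K * (B * h) * (\<integral>\<omega>. f \<omega> \<partial>P) + K * (\<integral>\<omega>. f \<omega> * norm (W s \<omega> - W t \<omega>) \<partial>P))"
    unfolding eq using n1(1) c(1) f(3) by simp
  also have "\<dots> \<le> (rm + rp) * ((lm + lp) * h * (\<integral>\<omega>. f \<omega> \<partial>P)) + (K * (B * h) * (\<integral>\<omega>. f \<omega> \<partial>P) + K * (sqrt (real DIM('v) * h) * (\<integral>\<omega>. f \<omega> \<partial>P)))"
    using 1 2 K_nonneg rm rp by (intro add_mono mult_left_mono order_refl) auto
  also have "\<dots> = err h * (\<integral>\<omega>. f \<omega> \<partial>P)" by (simp add: err_def algebra_simps)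
  finally show "(\<integral>\<omega>. f \<omega> * path_error t h \<omega> s \<partial>P) \<le> err h * (\<integral>\<omega>. f \<omega> \<partial>P)" .
qed

lemma drift_incr_measurable [measurable]: "0 \<le> t \<Longrightarrow> t \<le> u \<Longrightarrow> drift_incr t u \<in> borel_measurable P"
  by (intro borel_measurable_diff X_measurable W_measurable) auto

lemma radial_measurable [measurable]: "0 \<le> t \<Longrightarrow> (\<lambda>\<omega>. radial (Z t \<omega>)) \<in> borel_measurable P"
  by (rule measurable_compose[OF Z_measurable]) auto

lemma integrable_mult_radial:
  assumes "integrable P f" "0 \<le> t"
  shows "integrable P (\<lambda>\<omega>. f \<omega> * radial (Z t \<omega>))"
proof (rule Bochner_Integration.integrable_bound)
  show "integrable P (\<lambda>\<omega>. (rm + rp) * f \<omega>)" using assms by simp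
  have [measurable]: "(\<lambda>\<omega>. radial (Z t \<omega>)) \<in> borel_measurable P" "f \<in> borel_measurable P" using assms by auto
  show "(\<lambda>\<omega>. f \<omega> * radial (Z t \<omega>)) \<in> borel_measurable P" by measurable
  have "\<bar>radial k\<bar> \<le> rm + rp" for k using rm rp by (simp add: radial_def)
  then have "\<bar>f \<omega>\<bar> * \<bar>radial (Z t \<omega>)\<bar> \<le> (rm + rp) * \<bar>f \<omega>\<bar>" for \<omega>
    using mult_left_mono[of "\<bar>radial (Z t \<omega>)\<bar>" "rm + rp" "\<bar>f \<omega>\<bar>"] by (simp add: mult.commute)
  then show "AE \<omega> in P. norm (f \<omega> * radial (Z t \<omega>)) \<le> norm ((rm + rp) * f \<omega>)"
    using rm rp by (auto simp: abs_mult)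
qed

text \<open>The pathwise bound is multiplied by the weight and integrated with Fatou; then every
  Riemann node contributes at most \<open>err h\<close>. The weight vanishes where
  \<open>X t\<close> is too close to the origin for the pathwise bound.\<close>

lemma radial_drift_expectation:
  assumes f: "f \<in> borel_measurable (F t)" "\<And>\<omega>. 0 \<le> f \<omega>" "integrable P f" "integrable P (\<lambda>\<omega>. f \<omega> * norm (X t \<omega>))"
    and far: "\<And>\<omega>. f \<omega> \<noteq> 0 \<Longrightarrow> M + 1 \<le> norm (X t \<omega>)" and t: "0 \<le> t" and h: "0 < h"
  shows "integrable P (\<lambda>\<omega>. f \<omega> * (X t \<omega> \<bullet> drift_incr t (t + h) \<omega>))"
    "(\<integral>\<omega>. f \<omega> * (X t \<omega> \<bullet> drift_incr t (t + h) \<omega>) \<partial>P) \<le> h * (\<integral>\<omega>. f \<omega> * radial (Z t \<omega>) \<partial>P) + h * err h * (\<integral>\<omega>. f \<omega> \<partial>P)"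
proof -
  let ?d = "drift_incr t (t + h)"
  have [measurable]: "X t \<in> borel_measurable P" "?d \<in> borel_measurable P" "f \<in> borel_measurable P"
    using t h f measurable_F_P by auto
  show int: "integrable P (\<lambda>\<omega>. f \<omega> * (X t \<omega> \<bullet> ?d \<omega>))"
  proof (rule Bochner_Integration.integrable_bound)
    show "integrable P (\<lambda>\<omega>. (B * h) * (f \<omega> * norm (X t \<omega>)))" using f(4) by simp
    show "AE \<omega> in P. norm (f \<omega> * (X t \<omega> \<bullet> ?d \<omega>)) \<le> norm ((B * h) * (f \<omega> * norm (X t \<omega>)))"
      using AE_drift_incr_le
    proof eventually_elim
      case (elim \<omega>)
      have "norm (?d \<omega>) \<le> B * (t + h - t)" using elim t h by (metis le_add_same_cancel1 less_imp_le)
      then have "norm (X t \<omega>) * norm (?d \<omega>) \<le> norm (X t \<omega>) * (B * h)"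
        by (intro mult_left_mono) auto
      with Cauchy_Schwarz_ineq2[of "X t \<omega>" "?d \<omega>"] have "\<bar>X t \<omega> \<bullet> ?d \<omega>\<bar> \<le> norm (X t \<omega>) * (B * h)" by linarith
      from mult_left_mono[OF this f(2)[of \<omega>]] show ?case
        using f(2)[of \<omega>] B_nonneg h by (simp add: abs_mult mult.commute mult.left_commute)
    qed
  qed measurable
  let ?\<phi> = "\<lambda>\<omega>. f \<omega> * (X t \<omega> \<bullet> ?d \<omega>) - h * (f \<omega> * radial (Z t \<omega>))"
  have intr: "integrable P (\<lambda>\<omega>. f \<omega> * radial (Z t \<omega>))" using f(3) t by (rule integrable_mult_radial)
  have int\<phi>: "integrable P ?\<phi>" using int intr by simp
  let ?s = "\<lambda>n k. t + (real k + 1) * h / Suc n"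
  let ?R = "\<lambda>n \<omega>. \<Sum>k<Suc n. ennreal (h / Suc n * (f \<omega> * path_error t h \<omega> (?s n k)))"
  \<comment> \<open>Nodes are strictly later than \<open>t\<close>, as the Gaussian moment bounds
    require a positive variance.\<close>
  have s: "t < ?s n k" "?s n k \<le> t + h" if "k < Suc n" for n k
  proof -
    show "t < ?s n k" using h by simp
    have "(real k + 1) * h / Suc n \<le> 1 * h"
      unfolding times_divide_eq_left[symmetric] using that h
      by (intro mult_right_mono) (simp_all add: field_simps)
    then show "?s n k \<le> t + h" by simp
  qed
  have Ef: "0 \<le> (\<integral>\<omega>. f \<omega> \<partial>P)" using f(2) by simp
  have err0: "0 \<le> err h" using rm rp lm lp K_nonneg B_nonneg h by (simp add: err_def)
  have R: "(\<integral>\<^sup>+ \<omega>. ?R n \<omega> \<partial>P) \<le> ennreal (h * err h * (\<integral>\<omega>. f \<omega> \<partial>P))" for n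
  proof -
    have nn: "0 \<le> h / Suc n * (f \<omega> * path_error t h \<omega> (?s n k))" for \<omega> k
      using h f(2) path_error_nonneg[of h] by simp
    have pe: "integrable P (\<lambda>\<omega>. f \<omega> * path_error t h \<omega> (?s n k))"
      "(\<integral>\<omega>. f \<omega> * path_error t h \<omega> (?s n k) \<partial>P) \<le> err h * (\<integral>\<omega>. f \<omega> \<partial>P)" if "k < Suc n" for k
      using path_error_expectation[OF f(1-3) t s[OF that]] by auto
    have ip: "integrable P (\<lambda>\<omega>. \<Sum>k<Suc n. h / Suc n * (f \<omega> * path_error t h \<omega> (?s n k)))"
      by (intro Bochner_Integration.integrable_sum integrable_mult_right pe) simp
    have "(\<integral>\<^sup>+ \<omega>. ?R n \<omega> \<partial>P) = (\<integral>\<^sup>+ \<omega>. ennreal (\<Sum>k<Suc n. h / Suc n * (f \<omega> * path_error t h \<omega> (?s n k))) \<partial>P)"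
      using nn by (intro nn_integral_cong sum_ennreal)
    also have "\<dots> = ennreal (\<integral>\<omega>. (\<Sum>k<Suc n. h / Suc n * (f \<omega> * path_error t h \<omega> (?s n k))) \<partial>P)"
      using nn by (intro nn_integral_eq_integral ip AE_I2 sum_nonneg) auto
    finally have 1: "(\<integral>\<^sup>+ \<omega>. ?R n \<omega> \<partial>P) = ennreal (\<integral>\<omega>. (\<Sum>k<Suc n. h / Suc n * (f \<omega> * path_error t h \<omega> (?s n k))) \<partial>P)" .
    have "(\<integral>\<omega>. (\<Sum>k<Suc n. h / Suc n * (f \<omega> * path_error t h \<omega> (?s n k))) \<partial>P) =
        (\<Sum>k<Suc n. h / Suc n * (\<integral>\<omega>. f \<omega> * path_error t h \<omega> (?s n k) \<partial>P))"
      using pe(1) by (subst Bochner_Integration.integral_sum) (auto simp del: sum.lessThan_Suc)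
    also have "\<dots> \<le> (\<Sum>k<Suc n. h / Suc n * (err h * (\<integral>\<omega>. f \<omega> \<partial>P)))"
      using pe(2) h by (intro sum_mono mult_left_mono) auto
    also have "\<dots> = real (Suc n) * (h / real (Suc n) * (err h * (\<integral>\<omega>. f \<omega> \<partial>P)))"
      by (simp only: sum_constant card_lessThan)
    also have "\<dots> = h * err h * (\<integral>\<omega>. f \<omega> \<partial>P)" by (simp del: of_nat_Suc)
    finally show ?thesis unfolding 1 by (rule ennreal_leI)
  qed
  have Rm: "?R n \<in> borel_measurable P" for n
  proof (intro borel_measurable_sum)
    fix k assume "k \<in> {..<Suc n}"
    then have "0 \<le> ?s n k" using s[of k n] t by simp
    then have [measurable]: "(\<lambda>\<omega>. path_error t h \<omega> (?s n k)) \<in> borel_measurable P"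
      using t by (intro path_error_measurable)
    show "(\<lambda>\<omega>. ennreal (h / Suc n * (f \<omega> * path_error t h \<omega> (?s n k)))) \<in> borel_measurable P"
      by measurable
  qed
  \<comment> \<open>An upper bound for the integral of the positive part suffices, so the estimate
    moves to \<open>ennreal\<close>, where Fatou applies.\<close>
  have "ennreal (\<integral>\<omega>. ?\<phi> \<omega> \<partial>P) \<le> (\<integral>\<^sup>+ \<omega>. ennreal (?\<phi> \<omega>) \<partial>P)"
    by (rule ennreal_integral_le_nn_integral[OF int\<phi>])
  also have "\<dots> \<le> (\<integral>\<^sup>+ \<omega>. liminf (\<lambda>n. ?R n \<omega>) \<partial>P)"
  proof (rule nn_integral_mono_AE)
    show "AE \<omega> in P. ennreal (?\<phi> \<omega>) \<le> liminf (\<lambda>n. ?R n \<omega>)"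
      using AE_radial_drift_le[OF t h]
    proof eventually_elim
      case (elim \<omega>)
      show ?case
      proof (cases "f \<omega> = 0")
        case False
        let ?L = "\<lambda>n. \<Sum>k<Suc n. ennreal (h / Suc n * path_error t h \<omega> (?s n k))"
        have "?\<phi> \<omega> = f \<omega> * (X t \<omega> \<bullet> ?d \<omega> - h * radial (Z t \<omega>))" by (simp add: algebra_simps)
        then have "ennreal (?\<phi> \<omega>) = ennreal (f \<omega>) * ennreal (X t \<omega> \<bullet> ?d \<omega> - h * radial (Z t \<omega>))"
          using f(2)[of \<omega>] by (simp add: ennreal_mult')
        also have "\<dots> \<le> ennreal (f \<omega>) * liminf ?L"
          using elim far[OF False] by (intro mult_left_mono) auto
        \<comment> \<open>Multiplication by a finite constant is continuous and monotone on
          \<open>ennreal\<close>, hence commutes with the liminf.\<close>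
        also have "\<dots> = liminf (\<lambda>n. ennreal (f \<omega>) * ?L n)"
        proof (rule Liminf_compose_continuous_mono[symmetric])
          show "continuous_on UNIV ((*) (ennreal (f \<omega>)))"
            unfolding continuous_on_def by (auto intro!: ennreal_tendsto_cmult tendsto_ident_at)
        qed (auto intro!: monoI mult_left_mono)
        also have "(\<lambda>n. ennreal (f \<omega>) * ?L n) = (\<lambda>n. ?R n \<omega>)"
          using f(2)[of \<omega>] path_error_nonneg[of h] h unfolding sum_distrib_left
          by (intro ext sum.cong refl) (simp add: ennreal_mult[symmetric] mult.left_commute)
        finally show ?thesis .
      qed simp
    qed
  qed
  also have "\<dots> \<le> liminf (\<lambda>n. \<integral>\<^sup>+ \<omega>. ?R n \<omega> \<partial>P)" by (rule nn_integral_liminf[OF Rm])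
  also have "\<dots> \<le> ennreal (h * err h * (\<integral>\<omega>. f \<omega> \<partial>P))"
    by (rule Liminf_le) (use R in auto)
  finally have "(\<integral>\<omega>. ?\<phi> \<omega> \<partial>P) \<le> h * err h * (\<integral>\<omega>. f \<omega> \<partial>P)"
    using h err0 Ef by (subst (asm) ennreal_le_iff) auto
  then show "(\<integral>\<omega>. f \<omega> * (X t \<omega> \<bullet> ?d \<omega>) \<partial>P) \<le> h * (\<integral>\<omega>. f \<omega> * radial (Z t \<omega>) \<partial>P) + h * err h * (\<integral>\<omega>. f \<omega> \<partial>P)"
    using int intr by simp
qed

section \<open>Initial value, fourth moments and integrability\<close>

lemma AE_X_0: "AE \<omega> in P. X 0 \<omega> = x"
proof -
  have "AE \<omega> in P. \<forall>t\<ge>0. set_integrable lborel {0..t} (\<lambda>s. b (X s \<omega>) (Z s \<omega>)) \<and>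
      X t \<omega> = x + (LINT s:{0..t}|lborel. b (X s \<omega>) (Z s \<omega>)) + W t \<omega>"
    using sol by (simp add: switching_solution_def)
  moreover have "AE \<omega> in P. W 0 \<omega> = 0" using wiener by (simp add: std_wiener_def)
  ultimately show ?thesis
  proof eventually_elim
    case (elim \<omega>)
    have "(LINT s:{0..0}|lborel. b (X s \<omega>) (Z s \<omega>)) = 0"
      unfolding set_lebesgue_integral_def
    proof (rule integral_eq_zero_AE)
      have "AE s in lborel. s \<noteq> (0::real)" by (rule AE_lborel_singleton)
      then show "AE s in lborel. indicator {0..0} s *\<^sub>R b (X s \<omega>) (Z s \<omega>) = 0"
        by eventually_elim auto
    qed
    then show ?case using elim by auto
  qed
qed

text \<open>The drift is bounded, so |X_t| is at most |x| + \<open>B * t\<close> plus the norm of a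
  Gaussian increment.\<close>

lemma X_power4_integrable:
  assumes "0 \<le> t"
  shows "integrable P (\<lambda>\<omega>. norm (X t \<omega>) ^ 4)"
proof -
  have [measurable]: "X t \<in> borel_measurable P" using assms by simp
  have W4: "integrable P (\<lambda>\<omega>. norm (W t \<omega> - W 0 \<omega>) ^ 4)"
  proof (cases "t = 0")
    case False
    then have "0 < t" "0 < t - 0" using assms by auto
    from gauss_norm_moments(5)[OF increment_distributed[OF order_refl this(1)] this(2) prob_space_axioms]
    show ?thesis .
  qed simp
  show ?thesis
  proof (rule Bochner_Integration.integrable_bound)
    show "integrable P (\<lambda>\<omega>. 8 * ((norm x + B * t) ^ 4 + norm (W t \<omega> - W 0 \<omega>) ^ 4))" using W4 by simp
    show "AE \<omega> in P. norm (norm (X t \<omega>) ^ 4) \<le> norm (8 * ((norm x + B * t) ^ 4 + norm (W t \<omega> - W 0 \<omega>) ^ 4))"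
      using AE_X_0 AE_drift_incr_le
    proof eventually_elim
      case (elim \<omega>)
      have "norm (drift_incr 0 t \<omega>) \<le> B * (t - 0)" using elim(2) assms by blast
      moreover have "X t \<omega> = x + (drift_incr 0 t \<omega> + (W t \<omega> - W 0 \<omega>))" using elim(1) by simp
      ultimately have "norm (X t \<omega>) \<le> (norm x + B * t) + norm (W t \<omega> - W 0 \<omega>)"
        using norm_triangle_ineq[of x "drift_incr 0 t \<omega> + (W t \<omega> - W 0 \<omega>)"] norm_triangle_ineq[of "drift_incr 0 t \<omega>" "W t \<omega> - W 0 \<omega>"]
        by simp
      then have "norm (X t \<omega>) ^ 4 \<le> ((norm x + B * t) + norm (W t \<omega> - W 0 \<omega>)) ^ 4" by (intro power_mono) auto
      also have "\<dots> \<le> 8 * ((norm x + B * t) ^ 4 + norm (W t \<omega> - W 0 \<omega>) ^ 4)" by (rule add_power4_le)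
      finally show ?case by simp
    qed
  qed simp
qed

lemma integrable_weighted:
  assumes Y: "Y \<in> borel_measurable P" "\<And>\<omega>. 0 \<le> Y \<omega>" "\<And>\<omega>. Y \<omega> \<le> 1" and t: "0 \<le> t"
    and g: "g \<in> borel_measurable P" "\<And>\<omega>. \<bar>g \<omega>\<bar> \<le> c * (1 + norm (X t \<omega>) ^ 4)"
  shows "integrable P (\<lambda>\<omega>. Y \<omega> * g \<omega>)"
proof (rule Bochner_Integration.integrable_bound)
  show "integrable P (\<lambda>\<omega>. c * (1 + norm (X t \<omega>) ^ 4))" using X_power4_integrable[OF t] by simp
  show "(\<lambda>\<omega>. Y \<omega> * g \<omega>) \<in> borel_measurable P" using Y(1) g(1) by measurable
  have "\<bar>Y \<omega> * g \<omega>\<bar> \<le> c * (1 + norm (X t \<omega>) ^ 4)" for \<omega>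
    using mult_mono[OF Y(3)[of \<omega>] g(2)[of \<omega>]] Y(2)[of \<omega>] by (simp add: abs_mult)
  then show "AE \<omega> in P. norm (Y \<omega> * g \<omega>) \<le> norm (c * (1 + norm (X t \<omega>) ^ 4))"
    using abs_ge_self order_trans by (intro AE_I2) fastforce
qed

lemma lyap_measurable:
  assumes "0 \<le> t" shows "(\<lambda>\<omega>. lyap \<delta> (X t \<omega>) (Z t \<omega>)) \<in> borel_measurable (F t)"
proof -
  have [measurable]: "X t \<in> borel_measurable (F t)" "Z t \<in> measurable (F t) (count_space UNIV)"
    using assms X_measurable_F Z_measurable_F by auto
  show ?thesis unfolding lyap_def by measurable
qed

lemma lyap_integrable:
  assumes Y: "Y \<in> borel_measurable P" "\<And>\<omega>. 0 \<le> Y \<omega>" "\<And>\<omega>. Y \<omega> \<le> 1" and t: "0 \<le> t"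
  shows "integrable P (\<lambda>\<omega>. Y \<omega> * lyap \<delta> (X t \<omega>) (Z t \<omega>))"
proof -
  have [measurable]: "X t \<in> borel_measurable P" "Z t \<in> measurable P (count_space UNIV)" using t by auto
  have 1: "integrable P (\<lambda>\<omega>. Y \<omega> * norm (X t \<omega>) ^ 4)"
    by (rule integrable_weighted[OF Y t, where c=1]) auto
  \<comment> \<open>The range of \<open>Z\<close> is known only on \<open>space P\<close>, whereas
    \<open>integrable_weighted\<close> asks for a bound at every point; \<open>mod 2\<close>
    provides it and changes nothing on \<open>space P\<close>.\<close>
  have 2: "integrable P (\<lambda>\<omega>. Y \<omega> * ((norm (X t \<omega>))\<^sup>2 * real (Z t \<omega> mod 2)))"
  proof (rule integrable_weighted[OF Y t, where c=1])
    fix \<omega>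
    have "(norm (X t \<omega>))\<^sup>2 * real (Z t \<omega> mod 2) \<le> (norm (X t \<omega>))\<^sup>2 * 1"
      by (intro mult_left_mono) (auto simp: less_Suc_eq_le[symmetric])
    then show "\<bar>(norm (X t \<omega>))\<^sup>2 * real (Z t \<omega> mod 2)\<bar> \<le> 1 * (1 + norm (X t \<omega>) ^ 4)"
      using power_le_one_plus_power4[of "norm (X t \<omega>)" 2] by simp
  qed simp
  have "Y \<omega> * lyap \<delta> (X t \<omega>) (Z t \<omega>) = Y \<omega> * norm (X t \<omega>) ^ 4 + \<delta> * (Y \<omega> * ((norm (X t \<omega>))\<^sup>2 * real (Z t \<omega> mod 2)))"
    if "\<omega> \<in> space P" for \<omega>
    using Z_range[OF t that] by (auto simp: lyap_def algebra_simps)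
  then show ?thesis
    by (subst Bochner_Integration.integrable_cong[OF refl], assumption) (intro Bochner_Integration.integrable_add integrable_mult_right 1 2)
qed

text \<open>\<open>A0\<close> and \<open>A1\<close> are the rates at order |X_t|^2 in the two
  states: 4 comes from (v.xi)^2 and 2d from |v|^2 |xi|^2, then follow the radial drift and the jump
  term, and \<open>E\<close> collects all errors that vanish with \<open>h\<close>. Of the margin
  \<open>2 * \<epsilon>\<close>, one half is kept; the other pays for the remainder of order |X_t|,
  which \<open>Q\<close> makes small against \<open>M1\<close>.\<close>

lemma lyap_drift:
  assumes Y: "Y \<in> borel_measurable (F t)" "\<And>\<omega>. 0 \<le> Y \<omega>" "\<And>\<omega>. Y \<omega> \<le> 1"
    and far: "\<And>\<omega>. Y \<omega> \<noteq> 0 \<Longrightarrow> M1 \<le> norm (X t \<omega>)" and M1: "M + 1 \<le> M1"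
    and t: "0 \<le> t" and h: "0 < h" and \<delta>: "0 \<le> \<delta>" and \<epsilon>: "0 < \<epsilon>"
    and E: "E = 4 * err h + 12 * B * sqrt (real DIM('v) * h) + 6 * B\<^sup>2 * h + \<delta> * lp * (lm + lp) * h"
    and A0: "2 * real DIM('v) + 4 - 4 * rm + \<delta> * lm + E \<le> - 2 * \<epsilon>"
    and A1: "2 * real DIM('v) + 4 + 4 * rp - \<delta> * lp + E \<le> - 2 * \<epsilon>"
    and Q: "(5 + 3 * \<delta>) * (8 * ((1 + B * h) ^ 4 + 3 * (real DIM('v))\<^sup>2 * h\<^sup>2)) \<le> \<epsilon> * h * M1"
  shows "(\<integral>\<omega>. Y \<omega> * lyap \<delta> (X (t + h) \<omega>) (Z (t + h) \<omega>) \<partial>P) \<le>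
    (\<integral>\<omega>. Y \<omega> * lyap \<delta> (X t \<omega>) (Z t \<omega>) \<partial>P) - \<epsilon> * h * (\<integral>\<omega>. Y \<omega> * (norm (X t \<omega>))\<^sup>2 \<partial>P)"
proof -
  define u where "u = t + h"
  have tu: "t \<le> u" "t < u" "0 < u - t" "0 \<le> u" and ut: "u - t = h" using t h by (auto simp: u_def)
  define \<xi> where "\<xi> \<omega> = W u \<omega> - W t \<omega>" for \<omega>
  define m where "m = B * h"
  have m: "0 \<le> m" using B_nonneg h by (simp add: m_def)
  let ?v = "X t" and ?n = "\<lambda>\<omega>. norm (X t \<omega>)" and ?d = "drift_incr t u"
  let ?D = "real DIM('v)"
  note dist = increment_distributed[OF t tu(2), unfolded ut]
  note gm = gauss_norm_moments[OF dist h prob_space_axioms, folded \<xi>_def]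
  note gc = gauss_component_moments[OF dist h, folded \<xi>_def]
  note gu = gauss_component_uncorrelated[OF dist, folded \<xi>_def]
  note ind = integral_F_increment[OF _ _ t tu(1), folded \<xi>_def]
  have YP: "Y \<in> borel_measurable P" using Y(1) by (rule measurable_F_P)
  have [measurable]: "Y \<in> borel_measurable (F t)" "X t \<in> borel_measurable (F t)" "Z t \<in> measurable (F t) (count_space UNIV)"
    using Y(1) X_measurable_F[OF t] Z_measurable_F[OF t] by auto
  have Pm[measurable]: "Y \<in> borel_measurable P" "X t \<in> borel_measurable P" "Z t \<in> measurable P (count_space UNIV)"
    "Z u \<in> measurable P (count_space UNIV)" "\<xi> \<in> borel_measurable P"
    using t tu YP unfolding \<xi>_def[abs_def] by (auto intro!: borel_measurable_diff)
  note iw = integrable_weighted[OF YP Y(2,3) t]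
  \<comment> \<open>Powers of the norm of \<open>X t\<close> are known at time \<open>t\<close>, so
    they are merged with \<open>Y\<close> into new weights, to which the weighted moment lemmas
    apply.\<close>
  define a2 where "a2 \<omega> = Y \<omega> * (?n \<omega>)\<^sup>2" for \<omega>
  define a1 where "a1 \<omega> = Y \<omega> * ?n \<omega>" for \<omega>
  have a2F[measurable]: "a2 \<in> borel_measurable (F t)" and a1F[measurable]: "a1 \<in> borel_measurable (F t)"
    unfolding a2_def[abs_def] a1_def[abs_def] by measurable
  have a20: "0 \<le> a2 \<omega>" and a10: "0 \<le> a1 \<omega>" for \<omega> using Y(2) by (simp_all add: a2_def a1_def)
  have n_le: "?n \<omega> ^ k \<le> 1 * (1 + ?n \<omega> ^ 4)" if "k \<le> 4" for \<omega> k
    using power_le_one_plus_power4[of "?n \<omega>" k] that by simp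
  have a2i: "integrable P a2" and a1i: "integrable P a1"
    unfolding a2_def[abs_def] a1_def[abs_def]
    using n_le[of 2] n_le[of 1] by (auto intro!: iw[where c=1])
  have a2n: "integrable P (\<lambda>\<omega>. a2 \<omega> * ?n \<omega>)"
  proof -
    have "integrable P (\<lambda>\<omega>. Y \<omega> * ((?n \<omega>)\<^sup>2 * ?n \<omega>))"
      by (rule iw[where c=1]) (use n_le[of 3] in \<open>auto simp: power2_eq_square power3_eq_cube\<close>)
    then show ?thesis by (simp add: a2_def mult.assoc)
  qed
  have comp: "\<bar>?v \<omega> \<bullet> i\<bar> \<le> ?n \<omega>" if "i \<in> Basis" for \<omega> i
    using that by (rule Basis_le_norm)
  have T1: "integrable P (\<lambda>\<omega>. Y \<omega> * ((?n \<omega>)\<^sup>2 * (?v \<omega> \<bullet> \<xi> \<omega>)))" "(\<integral>\<omega>. Y \<omega> * ((?n \<omega>)\<^sup>2 * (?v \<omega> \<bullet> \<xi> \<omega>)) \<partial>P) = 0"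
  proof -
    have F1: "(\<lambda>\<omega>. a2 \<omega> * (?v \<omega> \<bullet> i)) \<in> borel_measurable (F t)" for i by measurable
    have i1: "integrable P (\<lambda>\<omega>. a2 \<omega> * (?v \<omega> \<bullet> i))" if "i \<in> Basis" for i
    proof (rule Bochner_Integration.integrable_bound[OF a2n])
      show "(\<lambda>\<omega>. a2 \<omega> * (?v \<omega> \<bullet> i)) \<in> borel_measurable P" using F1 by (rule measurable_F_P)
      show "AE \<omega> in P. norm (a2 \<omega> * (?v \<omega> \<bullet> i)) \<le> norm (a2 \<omega> * ?n \<omega>)"
        using comp[OF that] a20 by (auto simp: abs_mult intro!: mult_left_mono)
    qed
    have eq: "Y \<omega> * ((?n \<omega>)\<^sup>2 * (?v \<omega> \<bullet> \<xi> \<omega>)) = (\<Sum>i\<in>Basis. a2 \<omega> * (?v \<omega> \<bullet> i) * (\<xi> \<omega> \<bullet> i))" for \<omega>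
      by (subst euclidean_inner) (simp add: a2_def sum_distrib_left mult.assoc)
    have g: "(\<lambda>y. y \<bullet> i) \<in> borel_measurable borel" for i :: 'v by measurable
    note r = ind[OF F1 g i1 gc(1)]
    show "integrable P (\<lambda>\<omega>. Y \<omega> * ((?n \<omega>)\<^sup>2 * (?v \<omega> \<bullet> \<xi> \<omega>)))"
      unfolding eq by (intro Bochner_Integration.integrable_sum r(1))
    show "(\<integral>\<omega>. Y \<omega> * ((?n \<omega>)\<^sup>2 * (?v \<omega> \<bullet> \<xi> \<omega>)) \<partial>P) = 0"
      unfolding eq using r gc(2) by (subst Bochner_Integration.integral_sum) auto
  qed
  \<comment> \<open>The covariance of \<open>\<xi>\<close> is \<open>h\<close> times the identity:
    the off-diagonal terms vanish and the diagonal ones add up to |X_t|^2.\<close>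
  have T2: "integrable P (\<lambda>\<omega>. Y \<omega> * (?v \<omega> \<bullet> \<xi> \<omega>)\<^sup>2)" "(\<integral>\<omega>. Y \<omega> * (?v \<omega> \<bullet> \<xi> \<omega>)\<^sup>2 \<partial>P) = h * (\<integral>\<omega>. a2 \<omega> \<partial>P)"
  proof -
    have F1: "(\<lambda>\<omega>. Y \<omega> * ((?v \<omega> \<bullet> i) * (?v \<omega> \<bullet> j))) \<in> borel_measurable (F t)" for i j by measurable
    have i1: "integrable P (\<lambda>\<omega>. Y \<omega> * ((?v \<omega> \<bullet> i) * (?v \<omega> \<bullet> j)))" if "i \<in> Basis" "j \<in> Basis" for i j
    proof (rule iw[where c=1])
      fix \<omega> have "\<bar>?v \<omega> \<bullet> i\<bar> * \<bar>?v \<omega> \<bullet> j\<bar> \<le> ?n \<omega> * ?n \<omega>"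
        using comp that by (intro mult_mono) auto
      then show "\<bar>(?v \<omega> \<bullet> i) * (?v \<omega> \<bullet> j)\<bar> \<le> 1 * (1 + ?n \<omega> ^ 4)"
        using n_le[of 2 \<omega>] by (simp add: abs_mult power2_eq_square)
    qed measurable
    have x1: "integrable P (\<lambda>\<omega>. (\<xi> \<omega> \<bullet> i) * (\<xi> \<omega> \<bullet> j))" if "i \<in> Basis" "j \<in> Basis" for i j
    proof (rule Bochner_Integration.integrable_bound[OF gm(1)])
      have "\<bar>\<xi> \<omega> \<bullet> i\<bar> * \<bar>\<xi> \<omega> \<bullet> j\<bar> \<le> norm (\<xi> \<omega>) * norm (\<xi> \<omega>)" for \<omega>
        using that by (intro mult_mono Basis_le_norm) auto
      then show "AE \<omega> in P. norm ((\<xi> \<omega> \<bullet> i) * (\<xi> \<omega> \<bullet> j)) \<le> norm ((norm (\<xi> \<omega>))\<^sup>2)"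
        by (auto simp: abs_mult power2_eq_square)
    qed measurable
    have eq: "Y \<omega> * (?v \<omega> \<bullet> \<xi> \<omega>)\<^sup>2 = (\<Sum>i\<in>Basis. \<Sum>j\<in>Basis. Y \<omega> * ((?v \<omega> \<bullet> i) * (?v \<omega> \<bullet> j)) * ((\<xi> \<omega> \<bullet> i) * (\<xi> \<omega> \<bullet> j)))" for \<omega>
    proof -
      have "(?v \<omega> \<bullet> \<xi> \<omega>)\<^sup>2 = (\<Sum>i\<in>Basis. (?v \<omega> \<bullet> i) * (\<xi> \<omega> \<bullet> i)) * (\<Sum>j\<in>Basis. (?v \<omega> \<bullet> j) * (\<xi> \<omega> \<bullet> j))"
        unfolding power2_eq_square by (simp only: euclidean_inner[of "?v \<omega>" "\<xi> \<omega>"])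
      also have "\<dots> = (\<Sum>i\<in>Basis. \<Sum>j\<in>Basis. ((?v \<omega> \<bullet> i) * (\<xi> \<omega> \<bullet> i)) * ((?v \<omega> \<bullet> j) * (\<xi> \<omega> \<bullet> j)))"
        by (rule sum_product)
      finally show ?thesis
        by (simp only: sum_distrib_left) (simp only: mult.assoc mult.left_commute)
    qed
    have g: "(\<lambda>y. (y \<bullet> i) * (y \<bullet> j)) \<in> borel_measurable borel" for i j :: 'v by measurable
    note r = ind[OF F1 g i1 x1]
    show "integrable P (\<lambda>\<omega>. Y \<omega> * (?v \<omega> \<bullet> \<xi> \<omega>)\<^sup>2)"
      unfolding eq by (intro Bochner_Integration.integrable_sum r(1))
    have "(\<integral>\<omega>. Y \<omega> * (?v \<omega> \<bullet> \<xi> \<omega>)\<^sup>2 \<partial>P) = (\<Sum>i\<in>Basis. \<Sum>j\<in>Basis. (\<integral>\<omega>. Y \<omega> * ((?v \<omega> \<bullet> i) * (?v \<omega> \<bullet> j)) \<partial>P) * (\<integral>\<omega>. (\<xi> \<omega> \<bullet> i) * (\<xi> \<omega> \<bullet> j) \<partial>P))"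
      unfolding eq using r by (simp add: Bochner_Integration.integral_sum)
    also have "\<dots> = (\<Sum>i\<in>Basis. \<Sum>j\<in>Basis. if j = i then h * (\<integral>\<omega>. Y \<omega> * (?v \<omega> \<bullet> i)\<^sup>2 \<partial>P) else 0)"
      using gu gc(4) by (intro sum.cong refl) (auto simp: power2_eq_square)
    also have "\<dots> = h * (\<Sum>i\<in>Basis. \<integral>\<omega>. Y \<omega> * (?v \<omega> \<bullet> i)\<^sup>2 \<partial>P)"
      by (simp add: sum_distrib_left)
    also have "(\<Sum>i\<in>Basis. \<integral>\<omega>. Y \<omega> * (?v \<omega> \<bullet> i)\<^sup>2 \<partial>P) = (\<integral>\<omega>. (\<Sum>i\<in>Basis. Y \<omega> * (?v \<omega> \<bullet> i)\<^sup>2) \<partial>P)"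
      using i1 by (subst Bochner_Integration.integral_sum) (auto simp: power2_eq_square)
    also have "(\<lambda>\<omega>. (\<Sum>i\<in>Basis. Y \<omega> * (?v \<omega> \<bullet> i)\<^sup>2)) = a2"
      by (simp add: fun_eq_iff a2_def power2_norm_eq_sum_Basis sum_distrib_left)
    finally show "(\<integral>\<omega>. Y \<omega> * (?v \<omega> \<bullet> \<xi> \<omega>)\<^sup>2 \<partial>P) = h * (\<integral>\<omega>. a2 \<omega> \<partial>P)" .
  qed
  have T3: "integrable P (\<lambda>\<omega>. a2 \<omega> * (norm (\<xi> \<omega>))\<^sup>2)" "(\<integral>\<omega>. a2 \<omega> * (norm (\<xi> \<omega>))\<^sup>2 \<partial>P) = (\<integral>\<omega>. a2 \<omega> \<partial>P) * (?D * h)"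
    using ind[OF a2F _ a2i gm(1)] gm(2) by auto
  have T4: "integrable P (\<lambda>\<omega>. a2 \<omega> * norm (\<xi> \<omega>))" "(\<integral>\<omega>. a2 \<omega> * norm (\<xi> \<omega>) \<partial>P) \<le> (\<integral>\<omega>. a2 \<omega> \<partial>P) * sqrt (?D * h)"
    using ind[OF a2F _ a2i gm(3)] gm(4) a20 by (auto intro!: mult_left_mono)
  have T5: "integrable P (\<lambda>\<omega>. a1 \<omega> * norm (\<xi> \<omega>) ^ 4)" "(\<integral>\<omega>. a1 \<omega> * norm (\<xi> \<omega>) ^ 4 \<partial>P) \<le> (\<integral>\<omega>. a1 \<omega> \<partial>P) * (3 * ?D\<^sup>2 * h\<^sup>2)"
    using ind[OF a1F _ a1i gm(5)] gm(6) a10 by (auto intro!: mult_left_mono)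
  have far': "M + 1 \<le> ?n \<omega>" if "a2 \<omega> \<noteq> 0" for \<omega>
    using far[of \<omega>] that M1 by (auto simp: a2_def)
  have T6: "integrable P (\<lambda>\<omega>. a2 \<omega> * (?v \<omega> \<bullet> ?d \<omega>))"
    "(\<integral>\<omega>. a2 \<omega> * (?v \<omega> \<bullet> ?d \<omega>) \<partial>P) \<le> h * (\<integral>\<omega>. a2 \<omega> * radial (Z t \<omega>) \<partial>P) + h * err h * (\<integral>\<omega>. a2 \<omega> \<partial>P)"
    using radial_drift_expectation[OF a2F a20 a2i a2n far' t h] unfolding u_def by blast+
  note T7 = integral_F_chain_1(1,2)[OF a2F a20 a2i t tu(1), unfolded ut]
  note T8 = integral_F_chain_1(1)[OF a2F a20 a2i t order_refl]
  note L' = lyap_integrable[OF YP Y(2,3) tu(4), of \<delta>] and L = lyap_integrable[OF YP Y(2,3) t, of \<delta>]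
  let ?c = "(5 + 3 * \<delta>) * 8"
  let ?R = "\<lambda>\<omega>. Y \<omega> * lyap \<delta> (X t \<omega>) (Z t \<omega>) + 4 * (Y \<omega> * ((?n \<omega>)\<^sup>2 * (?v \<omega> \<bullet> \<xi> \<omega>))) + 4 * (Y \<omega> * (?v \<omega> \<bullet> \<xi> \<omega>)\<^sup>2)
      + 2 * (a2 \<omega> * (norm (\<xi> \<omega>))\<^sup>2) + 4 * (a2 \<omega> * (?v \<omega> \<bullet> ?d \<omega>)) + \<delta> * (a2 \<omega> * real (Z u \<omega>)) - \<delta> * (a2 \<omega> * real (Z t \<omega>))
      + 12 * m * (a2 \<omega> * norm (\<xi> \<omega>)) + 6 * m\<^sup>2 * a2 \<omega> + ?c * (1 + m) ^ 4 * a1 \<omega> + ?c * (a1 \<omega> * norm (\<xi> \<omega>) ^ 4)"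
  have Ri: "integrable P ?R"
    by (intro Bochner_Integration.integrable_add Bochner_Integration.integrable_diff integrable_mult_right
        L T1(1) T2(1) T3(1) T4(1) T5(1) T6(1) T7(1) T8 a2i a1i)
  have "AE \<omega> in P. Y \<omega> * lyap \<delta> (X u \<omega>) (Z u \<omega>) \<le> ?R \<omega>"
    using AE_drift_incr_le AE_space
  proof eventually_elim
    case (elim \<omega>)
    show ?case
    proof (cases "Y \<omega> = 0")
      case True then show ?thesis by (simp add: a1_def a2_def)
    next
      case False
      have "norm (?d \<omega>) \<le> m" using elim(1) t tu(1) ut unfolding m_def by metis
      moreover have "1 \<le> ?n \<omega>" using far[OF False] M1 M by linarith
      moreover have "Z u \<omega> \<le> 1" using Z_range[OF tu(4) elim(2)] by auto
      ultimately have *: "lyap \<delta> (?v \<omega> + (?d \<omega> + \<xi> \<omega>)) (Z u \<omega>) \<le> lyap \<delta> (?v \<omega>) (Z t \<omega>) + 4 * (?n \<omega>)\<^sup>2 * (?v \<omega> \<bullet> \<xi> \<omega>)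
          + 4 * (?v \<omega> \<bullet> \<xi> \<omega>)\<^sup>2 + 2 * (?n \<omega>)\<^sup>2 * (norm (\<xi> \<omega>))\<^sup>2
          + 4 * ((?n \<omega>)\<^sup>2 * (?v \<omega> \<bullet> ?d \<omega>)) + \<delta> * ((?n \<omega>)\<^sup>2 * real (Z u \<omega>)) - \<delta> * ((?n \<omega>)\<^sup>2 * real (Z t \<omega>))
          + (?n \<omega>)\<^sup>2 * (12 * m * norm (\<xi> \<omega>) + 6 * m\<^sup>2) + ?n \<omega> * ((5 + 3 * \<delta>) * (8 * ((1 + m) ^ 4 + norm (\<xi> \<omega>) ^ 4)))"
        by (intro lyap_step \<delta>)
      have veq: "?v \<omega> + (?d \<omega> + \<xi> \<omega>) = X u \<omega>" by (simp add: \<xi>_def)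
      have "Y \<omega> * lyap \<delta> (X u \<omega>) (Z u \<omega>) \<le> Y \<omega> * (lyap \<delta> (?v \<omega>) (Z t \<omega>) + 4 * (?n \<omega>)\<^sup>2 * (?v \<omega> \<bullet> \<xi> \<omega>)
          + 4 * (?v \<omega> \<bullet> \<xi> \<omega>)\<^sup>2 + 2 * (?n \<omega>)\<^sup>2 * (norm (\<xi> \<omega>))\<^sup>2
          + 4 * ((?n \<omega>)\<^sup>2 * (?v \<omega> \<bullet> ?d \<omega>)) + \<delta> * ((?n \<omega>)\<^sup>2 * real (Z u \<omega>)) - \<delta> * ((?n \<omega>)\<^sup>2 * real (Z t \<omega>))
          + (?n \<omega>)\<^sup>2 * (12 * m * norm (\<xi> \<omega>) + 6 * m\<^sup>2) + ?n \<omega> * ((5 + 3 * \<delta>) * (8 * ((1 + m) ^ 4 + norm (\<xi> \<omega>) ^ 4))))"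
        by (rule mult_left_mono[OF *[unfolded veq] Y(2)])
      also have "\<dots> = ?R \<omega>" unfolding a1_def a2_def by algebra
      finally show ?thesis .
    qed
  qed
  then have "(\<integral>\<omega>. Y \<omega> * lyap \<delta> (X u \<omega>) (Z u \<omega>) \<partial>P) \<le> (\<integral>\<omega>. ?R \<omega> \<partial>P)"
    by (intro integral_mono_AE L' Ri)
  also have "(\<integral>\<omega>. ?R \<omega> \<partial>P) = (\<integral>\<omega>. Y \<omega> * lyap \<delta> (X t \<omega>) (Z t \<omega>) \<partial>P) + 4 * 0 + 4 * (h * (\<integral>\<omega>. a2 \<omega> \<partial>P))
      + 2 * ((\<integral>\<omega>. a2 \<omega> \<partial>P) * (?D * h)) + 4 * (\<integral>\<omega>. a2 \<omega> * (?v \<omega> \<bullet> ?d \<omega>) \<partial>P) + \<delta> * (\<integral>\<omega>. a2 \<omega> * real (Z u \<omega>) \<partial>P) - \<delta> * (\<integral>\<omega>. a2 \<omega> * real (Z t \<omega>) \<partial>P)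
      + 12 * m * (\<integral>\<omega>. a2 \<omega> * norm (\<xi> \<omega>) \<partial>P) + 6 * m\<^sup>2 * (\<integral>\<omega>. a2 \<omega> \<partial>P) + ?c * (1 + m) ^ 4 * (\<integral>\<omega>. a1 \<omega> \<partial>P) + ?c * (\<integral>\<omega>. a1 \<omega> * norm (\<xi> \<omega>) ^ 4 \<partial>P)"
    unfolding T1(2)[symmetric] T2(2)[symmetric] T3(2)[symmetric]
    using L T1(1) T2(1) T3(1) T4(1) T5(1) T6(1) T7(1) T8 a2i a1i
    by (simp only: Bochner_Integration.integral_add Bochner_Integration.integral_diff integral_mult_right_zero
        Bochner_Integration.integrable_add Bochner_Integration.integrable_diff integrable_mult_right)
  finally have main: "(\<integral>\<omega>. Y \<omega> * lyap \<delta> (X u \<omega>) (Z u \<omega>) \<partial>P) \<le> \<dots>" .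
  define A where "A = (\<integral>\<omega>. a2 \<omega> \<partial>P)"
  define A1' where "A1' = (\<integral>\<omega>. a1 \<omega> \<partial>P)"
  define p01 where "p01 = two_state_trans lm lp h 0 1"
  define p10 where "p10 = two_state_trans lm lp h 1 0"
  have p: "p01 \<le> lm * h" "lp * h - lp * (lm + lp) * h\<^sup>2 \<le> p10"
    using two_state_trans_bounds[of h] h by (simp_all add: p01_def p10_def)
  have A0': "0 \<le> A" and A1'0: "0 \<le> A1'" using a20 a10 by (simp_all add: A_def A1'_def)
  \<comment> \<open>The rate left for radial drift and jumps together, so that all contributions sum
    to exactly \<open>- 2 * \<epsilon>\<close>. The jump error is added back because the bound
    \<open>k1\<close> already charges it in state 1; in state 0 it is mere slack.\<close>
  define \<kappa> where "\<kappa> = - 2 * \<epsilon> - 2 * ?D - 4 - E + \<delta> * lp * (lm + lp) * h"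
  have Gi: "integrable P (\<lambda>\<omega>. a2 \<omega> * (if Z t \<omega> = 0 then p01 else 1 - p10))"
  proof (rule Bochner_Integration.integrable_bound)
    show "integrable P (\<lambda>\<omega>. (\<bar>p01\<bar> + \<bar>1 - p10\<bar>) * a2 \<omega>)" using a2i by simp
    show "(\<lambda>\<omega>. a2 \<omega> * (if Z t \<omega> = 0 then p01 else 1 - p10)) \<in> borel_measurable P"
      using measurable_F_P[OF a2F] by measurable
    have "\<bar>if Z t \<omega> = 0 then p01 else 1 - p10\<bar> \<le> \<bar>p01\<bar> + \<bar>1 - p10\<bar>" for \<omega> by simp
    from mult_right_mono[OF this a20]
    show "AE \<omega> in P. norm (a2 \<omega> * (if Z t \<omega> = 0 then p01 else 1 - p10)) \<le> norm ((\<bar>p01\<bar> + \<bar>1 - p10\<bar>) * a2 \<omega>)"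
      using a20 by (intro AE_I2) (simp add: abs_mult mult.commute)
  qed
  have G: "4 * (h * (\<integral>\<omega>. a2 \<omega> * radial (Z t \<omega>) \<partial>P)) + \<delta> * (\<integral>\<omega>. a2 \<omega> * real (Z u \<omega>) \<partial>P) - \<delta> * (\<integral>\<omega>. a2 \<omega> * real (Z t \<omega>) \<partial>P) \<le> h * \<kappa> * A"
  proof -
    have ir: "integrable P (\<lambda>\<omega>. a2 \<omega> * radial (Z t \<omega>))" using a2i t by (rule integrable_mult_radial)
    have "4 * (h * (\<integral>\<omega>. a2 \<omega> * radial (Z t \<omega>) \<partial>P)) + \<delta> * (\<integral>\<omega>. a2 \<omega> * real (Z u \<omega>) \<partial>P) - \<delta> * (\<integral>\<omega>. a2 \<omega> * real (Z t \<omega>) \<partial>P) =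
      (\<integral>\<omega>. 4 * (h * (a2 \<omega> * radial (Z t \<omega>))) + \<delta> * (a2 \<omega> * (if Z t \<omega> = 0 then p01 else 1 - p10)) - \<delta> * (a2 \<omega> * real (Z t \<omega>)) \<partial>P)"
      unfolding T7(2)[folded p01_def p10_def] using ir Gi T8 by simp
    also have "\<dots> \<le> (\<integral>\<omega>. h * \<kappa> * a2 \<omega> \<partial>P)"
    proof (rule integral_mono)
      show "integrable P (\<lambda>\<omega>. h * \<kappa> * a2 \<omega>)" using a2i by simp
      show "integrable P (\<lambda>\<omega>. 4 * (h * (a2 \<omega> * radial (Z t \<omega>))) + \<delta> * (a2 \<omega> * (if Z t \<omega> = 0 then p01 else 1 - p10)) - \<delta> * (a2 \<omega> * real (Z t \<omega>)))"
        using ir Gi T8 by simp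
      fix \<omega> assume "\<omega> \<in> space P"
      then have z: "Z t \<omega> = 0 \<or> Z t \<omega> = 1" by (rule Z_range[OF t])
      have k0: "h * (- 4 * rm + \<delta> * lm) \<le> h * \<kappa>"
      proof (intro mult_left_mono)
        have "0 \<le> \<delta> * lp * (lm + lp) * h" using h \<delta> lm lp by simp
        then show "- 4 * rm + \<delta> * lm \<le> \<kappa>" using A0 unfolding \<kappa>_def by linarith
      qed (use h in simp)
      have k1: "h * (4 * rp - \<delta> * lp + \<delta> * lp * (lm + lp) * h) \<le> h * \<kappa>"
        using A1 h by (intro mult_left_mono) (auto simp: \<kappa>_def)
      have "4 * (h * radial (Z t \<omega>)) + \<delta> * (if Z t \<omega> = 0 then p01 else 1 - p10) - \<delta> * real (Z t \<omega>) \<le> h * \<kappa>"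
      proof (cases "Z t \<omega> = 0")
        case True
        then show ?thesis using k0 mult_left_mono[OF p(1) \<delta>] by (simp add: radial_def algebra_simps)
      next
        case False
        then have "Z t \<omega> = 1" using z by simp
        then show ?thesis using k1 mult_left_mono[OF p(2) \<delta>] by (simp add: radial_def algebra_simps power2_eq_square)
      qed
      from mult_left_mono[OF this a20[of \<omega>]]
      show "4 * (h * (a2 \<omega> * radial (Z t \<omega>))) + \<delta> * (a2 \<omega> * (if Z t \<omega> = 0 then p01 else 1 - p10)) - \<delta> * (a2 \<omega> * real (Z t \<omega>)) \<le> h * \<kappa> * a2 \<omega>"
        by (simp only: distrib_left right_diff_distrib mult.assoc mult.left_commute mult.commute)
    qed
    finally show ?thesis by (simp add: A_def)
  qed
  \<comment> \<open>Where \<open>Y\<close> does not vanish, |X_t| is at least \<open>M1\<close>, so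
    a term of order |X_t| costs at most 1/\<open>M1\<close> of one of order |X_t|^2.\<close>
  have last: "?c * (1 + m) ^ 4 * A1' + ?c * (A1' * (3 * ?D\<^sup>2 * h\<^sup>2)) \<le> \<epsilon> * h * A"
  proof -
    have "A1' * M1 \<le> A"
    proof -
      have "(\<integral>\<omega>. a1 \<omega> * M1 \<partial>P) \<le> (\<integral>\<omega>. a2 \<omega> \<partial>P)"
      proof (rule integral_mono)
        fix \<omega> show "a1 \<omega> * M1 \<le> a2 \<omega>"
          using far[of \<omega>] Y(2)[of \<omega>] by (cases "Y \<omega> = 0") (auto simp: a1_def a2_def power2_eq_square mult.assoc intro!: mult_left_mono)
      qed (use a1i a2i in auto)
      then show ?thesis by (simp add: A_def A1'_def)
    qed
    then have "\<epsilon> * h * (A1' * M1) \<le> \<epsilon> * h * A" using \<epsilon> h by (intro mult_left_mono) auto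
    moreover have "A1' * ((5 + 3 * \<delta>) * (8 * ((1 + m) ^ 4 + 3 * ?D\<^sup>2 * h\<^sup>2))) \<le> A1' * (\<epsilon> * h * M1)"
      using Q A1'0 unfolding m_def by (rule mult_left_mono)
    ultimately show ?thesis by (simp add: algebra_simps)
  qed
  have R6: "4 * (\<integral>\<omega>. a2 \<omega> * (?v \<omega> \<bullet> ?d \<omega>) \<partial>P) \<le> 4 * (h * (\<integral>\<omega>. a2 \<omega> * radial (Z t \<omega>) \<partial>P)) + 4 * (h * err h * A)"
    using T6(2) by (simp add: A_def)
  have R4: "12 * m * (\<integral>\<omega>. a2 \<omega> * norm (\<xi> \<omega>) \<partial>P) \<le> 12 * m * (A * sqrt (?D * h))"
    using T4(2) m unfolding A_def by (intro mult_left_mono) auto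
  have R5: "?c * (\<integral>\<omega>. a1 \<omega> * norm (\<xi> \<omega>) ^ 4 \<partial>P) \<le> ?c * (A1' * (3 * ?D\<^sup>2 * h\<^sup>2))"
    using T5(2) \<delta> unfolding A1'_def by (intro mult_left_mono) auto
  have "4 * (h * A) + 2 * (A * (?D * h)) + 4 * (h * err h * A) + h * \<kappa> * A + 12 * m * (A * sqrt (?D * h)) + 6 * m\<^sup>2 * A = - 2 * \<epsilon> * h * A"
    unfolding \<kappa>_def E m_def by (simp add: algebra_simps power2_eq_square)
  then have "(\<integral>\<omega>. Y \<omega> * lyap \<delta> (X u \<omega>) (Z u \<omega>) \<partial>P) \<le> (\<integral>\<omega>. Y \<omega> * lyap \<delta> (X t \<omega>) (Z t \<omega>) \<partial>P) - \<epsilon> * h * A"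
    using main[folded A_def A1'_def] G R6 R4 R5 last by linarith
  then show ?thesis by (simp add: u_def A_def a2_def)
qed

end

section \<open>Second moment of the hitting time\<close>

lemma lyap_nonneg: "0 \<le> \<delta> \<Longrightarrow> 0 \<le> lyap \<delta> y k"
  by (simp add: lyap_def)

lemma norm_power4_le_lyap: "0 \<le> \<delta> \<Longrightarrow> norm y ^ 4 \<le> lyap \<delta> y k"
  by (simp add: lyap_def)

lemma lyap_le:
  assumes "0 \<le> \<delta>" "1 \<le> norm y" "k \<le> 1"
  shows "lyap \<delta> y k \<le> (1 + \<delta>) * norm y ^ 4"
proof -
  have "(norm y)\<^sup>2 * real k \<le> norm y ^ 4 * 1"
    using assms by (intro mult_mono power_increasing) auto
  from mult_left_mono[OF this assms(1)] show ?thesis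
    by (simp add: lyap_def algebra_simps)
qed

section \<open>From the grid to the hitting time\<close>

lemma square_eq_sum_odd: "(real n)\<^sup>2 = (\<Sum>k<n. 2 * real k + 1)"
  by (induction n) (simp_all add: power2_eq_square algebra_simps)

text \<open>If \<open>n\<close> is the first grid index inside the ball, the hitting time is at most
  \<open>n * h\<close>, and the square of \<open>n * h\<close> is the sum of the first
  \<open>n\<close> terms on the right, whose conditions all hold. If there is no such index, the
  right side is infinite.\<close>

lemma hit_time_square_le:
  fixes X :: "real \<Rightarrow> 'a \<Rightarrow> 'v::real_normed_vector"
  assumes h: "0 < h"
  shows "(hit_time X M1 \<omega>)\<^sup>2 \<le>
    (\<Sum>k. ennreal (h\<^sup>2 * (2 * real k + 1)) * of_bool (\<forall>j\<le>k. M1 < norm (X (real j * h) \<omega>)))"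
    (is "_ \<le> (\<Sum>k. ?f k)")
proof -
  have part: "ennreal ((real n * h)\<^sup>2) \<le> (\<Sum>k. ?f k)" if "\<And>j. j < n \<Longrightarrow> M1 < norm (X (real j * h) \<omega>)" for n
  proof -
    have "ennreal ((real n * h)\<^sup>2) = ennreal (\<Sum>k<n. h\<^sup>2 * (2 * real k + 1))"
      unfolding power_mult_distrib square_eq_sum_odd by (simp add: sum_distrib_left mult.commute)
    also have "\<dots> = (\<Sum>k<n. ennreal (h\<^sup>2 * (2 * real k + 1)))"
      by (rule sum_ennreal[symmetric]) simp
    also have "\<dots> = (\<Sum>k<n. ?f k)" using that by (intro sum.cong) auto
    also have "\<dots> \<le> (\<Sum>k. ?f k)" by (rule sum_le_suminf) auto
    finally show ?thesis .
  qed
  show ?thesis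
  proof (cases "\<exists>j. norm (X (real j * h) \<omega>) \<le> M1")
    case True
    define n where "n = (LEAST j. norm (X (real j * h) \<omega>) \<le> M1)"
    have n: "norm (X (real n * h) \<omega>) \<le> M1" unfolding n_def using True by (rule LeastI_ex)
    have "hit_time X M1 \<omega> \<le> ennreal (real n * h)"
      unfolding hit_time_def using n h by (intro INF_lower) auto
    then have "(hit_time X M1 \<omega>)\<^sup>2 \<le> (ennreal (real n * h))\<^sup>2" by (intro power_mono) auto
    also have "\<dots> = ennreal ((real n * h)\<^sup>2)" using h by (simp add: ennreal_power)
    also have "\<dots> \<le> (\<Sum>k. ?f k)"
      by (rule part) (use not_less_Least[of _ "\<lambda>j. norm (X (real j * h) \<omega>) \<le> M1"] in \<open>auto simp: n_def not_le\<close>)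
    finally show ?thesis .
  next
    case False
    have "(\<Sum>k. ?f k) = top"
    proof (rule ccontr)
      assume "(\<Sum>k. ?f k) \<noteq> top"
      then obtain r where r: "0 \<le> r" "(\<Sum>k. ?f k) = ennreal r" by (cases "\<Sum>k. ?f k") auto
      \<comment> \<open>The maximum with 1 ensures that \<open>real n * h\<close> exceeds 1 and
        hence does not exceed its square, so that the square being at most \<open>r\<close> is
        contradictory.\<close>
      obtain n :: nat where "max r 1 / h < real n" using reals_Archimedean2 by blast
      then have n: "max r 1 < real n * h" using h by (simp add: pos_divide_less_eq)
      have "ennreal ((real n * h)\<^sup>2) \<le> ennreal r"
        using part[of n] False unfolding r(2) by (auto simp: not_le)
      then have "(real n * h)\<^sup>2 \<le> r" using r(1) by (simp add: ennreal_le_iff)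
      moreover have "real n * h * 1 \<le> (real n * h) * (real n * h)" using n by (intro mult_left_mono) auto
      ultimately show False using n by (simp add: power2_eq_square)
    qed
    then show ?thesis by simp
  qed
qed

context switching_drift
begin

text \<open>The one-step estimate enters only as the hypothesis \<open>drift\<close>, used twice:
  with the indicator of the event of no grid hit so far, and with that indicator divided by twice
  the root of the Lyapunov function.\<close>

lemma hit_time_second_moment:
  assumes h: "0 < h" and \<epsilon>: "0 < \<epsilon>" and \<delta>: "0 \<le> \<delta>" and M1: "1 \<le> M1"
    and drift: "\<And>k Y. Y \<in> borel_measurable (F (real k * h)) \<Longrightarrow> (\<And>\<omega>. 0 \<le> Y \<omega>) \<Longrightarrow> (\<And>\<omega>. Y \<omega> \<le> 1) \<Longrightarrow>
      (\<And>\<omega>. Y \<omega> \<noteq> 0 \<Longrightarrow> M1 \<le> norm (X (real k * h) \<omega>)) \<Longrightarrow>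
      (\<integral>\<omega>. Y \<omega> * lyap \<delta> (X (real k * h + h) \<omega>) (Z (real k * h + h) \<omega>) \<partial>P) \<le>
      (\<integral>\<omega>. Y \<omega> * lyap \<delta> (X (real k * h) \<omega>) (Z (real k * h) \<omega>) \<partial>P) - \<epsilon> * h * (\<integral>\<omega>. Y \<omega> * (norm (X (real k * h) \<omega>))\<^sup>2 \<partial>P)"
  shows "(\<integral>\<^sup>+ \<omega>. (hit_time X M1 \<omega>)\<^sup>2 \<partial>P) \<le> ennreal (4 * ((1 + \<delta>) / \<epsilon>)\<^sup>2 * lyap \<delta> x z)"
proof -
  define T where "T k = real k * h" for k
  have T0: "0 \<le> T k" for k using h by (simp add: T_def)
  have TS: "T k + h = T (Suc k)" for k by (simp add: T_def algebra_simps)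
  define V where "V k \<omega> = lyap \<delta> (X (T k) \<omega>) (Z (T k) \<omega>)" for k \<omega>
  define U where "U k \<omega> = sqrt (V k \<omega>)" for k \<omega>
  define N where "N k \<omega> = (norm (X (T k) \<omega>))\<^sup>2" for k \<omega>
  define A where "A k = {\<omega>\<in>space P. \<forall>j\<le>k. M1 < norm (X (T j) \<omega>)}" for k
  define I where "I k = (indicator (A k) :: 'a \<Rightarrow> real)" for k
  have V0: "0 \<le> V k \<omega>" for k \<omega> unfolding V_def using \<delta> by (rule lyap_nonneg)
  have U0: "0 \<le> U k \<omega>" for k \<omega> using V0 by (simp add: U_def)
  have XF: "X (T j) \<in> borel_measurable (F (T k))" if "j \<le> k" for j k
    using that h by (intro measurable_switch_filtr_mono[OF X_measurable_F[OF T0]]) (auto simp: T_def)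
  have AF[measurable]: "A k \<in> sets (F (T k))" for k
  proof -
    have "{\<omega>\<in>space (F (T k)). \<forall>j\<in>{..k}. M1 < norm (X (T j) \<omega>)} \<in> sets (F (T k))"
    proof (rule sets.sets_Collect_finite_All)
      fix j assume "j \<in> {..k}"
      then have [measurable]: "X (T j) \<in> borel_measurable (F (T k))" by (intro XF) auto
      show "{\<omega>\<in>space (F (T k)). M1 < norm (X (T j) \<omega>)} \<in> sets (F (T k))" by measurable
    qed simp
    also have "{\<omega>\<in>space (F (T k)). \<forall>j\<in>{..k}. M1 < norm (X (T j) \<omega>)} = A k"
      unfolding A_def space_switch_filtr Ball_def atMost_iff ..
    finally show ?thesis .
  qed
  have AP[measurable]: "A k \<in> sets P" for k using AF sets_F_subset by blast
  have IF[measurable]: "I k \<in> borel_measurable (F (T k))" for k unfolding I_def by measurable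
  have IP[measurable]: "I k \<in> borel_measurable P" for k using IF by (rule measurable_F_P)
  have VF[measurable]: "V k \<in> borel_measurable (F (T k))" for k
    unfolding V_def[abs_def] using T0 by (rule lyap_measurable)
  have UF[measurable]: "U k \<in> borel_measurable (F (T k))" for k unfolding U_def[abs_def] by measurable
  have I01: "0 \<le> I k \<omega>" "I k \<omega> \<le> 1" for k \<omega> by (simp_all add: I_def)
  have IS: "I (Suc k) \<omega> \<le> I k \<omega>" for k \<omega>
    by (auto simp: I_def A_def split: split_indicator)
  have onA: "M1 < norm (X (T k) \<omega>)" "\<omega> \<in> space P" if "I k \<omega> \<noteq> 0" for k \<omega>
    using that by (auto simp: I_def A_def indicator_def split: if_splits)
  have bnd: "1 \<le> V k \<omega>" "U k \<omega> \<le> (1 + \<delta>) * N k \<omega>" if "I k \<omega> \<noteq> 0" for k \<omega>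
  proof -
    have n: "1 \<le> norm (X (T k) \<omega>)" using onA(1)[OF that] M1 by simp
    have "1 ^ 4 \<le> norm (X (T k) \<omega>) ^ 4" using n by (intro power_mono) auto
    then show "1 \<le> V k \<omega>" using norm_power4_le_lyap[OF \<delta>, of "X (T k) \<omega>" "Z (T k) \<omega>"] by (simp add: V_def)
    have "Z (T k) \<omega> \<le> 1" using Z_range[OF T0[of k] onA(2)[OF that]] by auto
    then have "V k \<omega> \<le> (1 + \<delta>) * norm (X (T k) \<omega>) ^ 4" unfolding V_def by (rule lyap_le[OF \<delta> n])
    \<comment> \<open>The factor is enlarged to a perfect square so that no root of
      \<open>1 + \<delta>\<close> appears.\<close>
    also have "\<dots> \<le> (1 + \<delta>)\<^sup>2 * norm (X (T k) \<omega>) ^ 4"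
      using \<delta> by (intro mult_right_mono) (auto simp: power2_eq_square algebra_simps)
    also have "\<dots> = ((1 + \<delta>) * N k \<omega>)\<^sup>2" by (simp add: N_def power_mult_distrib)
    finally show "U k \<omega> \<le> (1 + \<delta>) * N k \<omega>"
      unfolding U_def using \<delta> by (intro real_le_lsqrt) (auto simp: N_def V0)
  qed
  have Vint: "integrable P (\<lambda>\<omega>. Y \<omega> * V k \<omega>)" if "Y \<in> borel_measurable P" "\<And>\<omega>. 0 \<le> Y \<omega>" "\<And>\<omega>. Y \<omega> \<le> 1" for Y k
    unfolding V_def using that T0 by (rule lyap_integrable)
  have Uint: "integrable P (\<lambda>\<omega>. I k \<omega> * U j \<omega>)" for k j
  proof (rule Bochner_Integration.integrable_bound)
    show "integrable P (\<lambda>\<omega>. 1 + I k \<omega> * V j \<omega>)" using Vint[OF IP I01] by simp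
    show "(\<lambda>\<omega>. I k \<omega> * U j \<omega>) \<in> borel_measurable P" using measurable_F_P[OF UF] by measurable
    have "I k \<omega> * U j \<omega> \<le> 1 + I k \<omega> * V j \<omega>" for \<omega>
    proof -
      have "U j \<omega> \<le> 1 + (U j \<omega>)\<^sup>2" using sum_squares_ge_zero[of "U j \<omega> - 1" "U j \<omega>"] by (simp add: power2_eq_square algebra_simps)
      then have "U j \<omega> \<le> 1 + V j \<omega>" using V0 by (simp add: U_def)
      from mult_left_mono[OF this I01(1)[of k \<omega>]] show ?thesis using I01(2)[of k \<omega>] by (simp add: distrib_left)
    qed
    then show "AE \<omega> in P. norm (I k \<omega> * U j \<omega>) \<le> norm (1 + I k \<omega> * V j \<omega>)"
      using I01 U0 V0 by (intro AE_I2) (simp add: abs_mult)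
  qed
  have Nint: "integrable P (\<lambda>\<omega>. Y \<omega> * N k \<omega>)" if "Y \<in> borel_measurable P" "\<And>\<omega>. 0 \<le> Y \<omega>" "\<And>\<omega>. Y \<omega> \<le> 1" for Y k
    unfolding N_def
  proof (rule integrable_weighted[OF that T0, where c=1])
    have [measurable]: "X (T k) \<in> borel_measurable P" using T0 by simp
    show "(\<lambda>\<omega>. (norm (X (T k) \<omega>))\<^sup>2) \<in> borel_measurable P" by measurable
    show "\<bar>(norm (X (T k) \<omega>))\<^sup>2\<bar> \<le> 1 * (1 + norm (X (T k) \<omega>) ^ 4)" for \<omega>
      using power_le_one_plus_power4[of "norm (X (T k) \<omega>)" 2] by simp
  qed
  note drift' = drift[folded T_def, unfolded TS, folded V_def N_def]
  have d1: "(\<integral>\<omega>. I k \<omega> * V (Suc k) \<omega> \<partial>P) \<le> (\<integral>\<omega>. I k \<omega> * V k \<omega> \<partial>P) - \<epsilon> * h * (\<integral>\<omega>. I k \<omega> * N k \<omega> \<partial>P)" for k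
    using onA(1)[of k] by (intro drift' IF I01) (simp add: less_imp_le)
  \<comment> \<open>Constant loss of \<open>U\<close> per step: the weight turns
    \<open>\<epsilon> * h * N\<close> into \<open>\<epsilon> * h * N / (2 * U)\<close>, and
    \<open>U\<close> is at most \<open>(1 + \<delta>) * N\<close> before the hit.\<close>
  define \<epsilon>' where "\<epsilon>' = \<epsilon> * h / (2 * (1 + \<delta>))"
  have \<epsilon>': "0 < \<epsilon>'" using \<epsilon> h \<delta> by (simp add: \<epsilon>'_def)
  have d2: "(\<integral>\<omega>. I k \<omega> * U (Suc k) \<omega> \<partial>P) \<le> (\<integral>\<omega>. I k \<omega> * U k \<omega> \<partial>P) - \<epsilon>' * prob (A k)" for k
  proof -
    \<comment> \<open>The factor is the derivative of the square root at \<open>V k\<close>. The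
      weight is at most 1 because \<open>M1\<close> is at least 1, which makes \<open>U k\<close> at
      least 1 on the event.\<close>
    define Y where "Y \<omega> = I k \<omega> / (2 * U k \<omega>)" for \<omega>
    have YF[measurable]: "Y \<in> borel_measurable (F (T k))" unfolding Y_def[abs_def] by measurable
    have YP: "Y \<in> borel_measurable P" using YF by (rule measurable_F_P)
    have U1: "1 \<le> U k \<omega>" if "I k \<omega> \<noteq> 0" for \<omega> using bnd(1)[OF that] by (simp add: U_def)
    have Y0: "0 \<le> Y \<omega>" for \<omega> using I01(1) U0 by (simp add: Y_def)
    have Y1: "Y \<omega> \<le> 1" for \<omega>
    proof (cases "I k \<omega> = 0")
      case False
      then show ?thesis using U1[OF False] I01(2)[of k \<omega>] by (simp add: Y_def)
    qed (simp add: Y_def)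
    have dY: "(\<integral>\<omega>. Y \<omega> * V (Suc k) \<omega> \<partial>P) \<le> (\<integral>\<omega>. Y \<omega> * V k \<omega> \<partial>P) - \<epsilon> * h * (\<integral>\<omega>. Y \<omega> * N k \<omega> \<partial>P)"
      using onA(1)[of k] by (intro drift' YF Y0 Y1) (auto simp: Y_def less_imp_le)
    have "(\<integral>\<omega>. I k \<omega> * U (Suc k) \<omega> \<partial>P) \<le> (\<integral>\<omega>. I k \<omega> * U k \<omega> + (Y \<omega> * V (Suc k) \<omega> - Y \<omega> * V k \<omega>) \<partial>P)"
    proof (rule integral_mono)
      show "integrable P (\<lambda>\<omega>. I k \<omega> * U k \<omega> + (Y \<omega> * V (Suc k) \<omega> - Y \<omega> * V k \<omega>))"
        by (intro Bochner_Integration.integrable_add Bochner_Integration.integrable_diff Uint Vint YP Y0 Y1)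
      fix \<omega>
      show "I k \<omega> * U (Suc k) \<omega> \<le> I k \<omega> * U k \<omega> + (Y \<omega> * V (Suc k) \<omega> - Y \<omega> * V k \<omega>)"
      proof (cases "I k \<omega> = 0")
        case False
        have u: "0 < U k \<omega>" using U1[OF False] by simp
        \<comment> \<open>The tangent line of the square root at \<open>V k\<close> lies above its
          graph; this is the square of the difference of \<open>U (Suc k)\<close> and
          \<open>U k\<close> being nonnegative.\<close>
        have "V j \<omega> = (U j \<omega>)\<^sup>2" for j using V0 by (simp add: U_def)
        moreover have "0 \<le> (U (Suc k) \<omega> - U k \<omega>)\<^sup>2" by simp
        ultimately have "2 * U k \<omega> * U (Suc k) \<omega> \<le> 2 * U k \<omega> * U k \<omega> + (V (Suc k) \<omega> - V k \<omega>)"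
          by (simp add: power2_eq_square algebra_simps)
        then have "U (Suc k) \<omega> \<le> U k \<omega> + (V (Suc k) \<omega> - V k \<omega>) / (2 * U k \<omega>)"
          using u by (simp add: field_simps)
        from mult_left_mono[OF this I01(1)[of k \<omega>]] show ?thesis
          by (simp add: Y_def distrib_left diff_divide_distrib right_diff_distrib)
      qed (simp add: Y_def)
    qed (rule Uint)
    also have "\<dots> = (\<integral>\<omega>. I k \<omega> * U k \<omega> \<partial>P) + ((\<integral>\<omega>. Y \<omega> * V (Suc k) \<omega> \<partial>P) - (\<integral>\<omega>. Y \<omega> * V k \<omega> \<partial>P))"
      using Uint Vint[OF YP Y0 Y1] by simp
    also have "\<dots> \<le> (\<integral>\<omega>. I k \<omega> * U k \<omega> \<partial>P) - \<epsilon> * h * (\<integral>\<omega>. Y \<omega> * N k \<omega> \<partial>P)" using dY by simp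
    also have "\<dots> \<le> (\<integral>\<omega>. I k \<omega> * U k \<omega> \<partial>P) - \<epsilon>' * prob (A k)"
    proof -
      have "(\<integral>\<omega>. I k \<omega> / (2 * (1 + \<delta>)) \<partial>P) \<le> (\<integral>\<omega>. Y \<omega> * N k \<omega> \<partial>P)"
      proof (rule integral_mono)
        show "integrable P (\<lambda>\<omega>. I k \<omega> / (2 * (1 + \<delta>)))"
          unfolding I_def by (intro integrable_divide integrable_real_indicator) (auto simp: less_top[symmetric])
        show "integrable P (\<lambda>\<omega>. Y \<omega> * N k \<omega>)" by (intro Nint YP Y0 Y1)
        fix \<omega> show "I k \<omega> / (2 * (1 + \<delta>)) \<le> Y \<omega> * N k \<omega>"
        proof (cases "I k \<omega> = 0")
          case False
          have u: "0 < U k \<omega>" using U1[OF False] by simp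
          have "1 / (2 * (1 + \<delta>)) \<le> N k \<omega> / (2 * U k \<omega>)"
            using bnd(2)[OF False] u \<delta> by (simp add: divide_simps) (simp add: algebra_simps)
          from mult_left_mono[OF this I01(1)[of k \<omega>]] show ?thesis by (simp add: Y_def)
        qed (simp add: Y_def)
      qed
      moreover have "(\<integral>\<omega>. I k \<omega> / (2 * (1 + \<delta>)) \<partial>P) = prob (A k) / (2 * (1 + \<delta>))"
        by (simp add: I_def)
      ultimately have "\<epsilon> * h * (prob (A k) / (2 * (1 + \<delta>))) \<le> \<epsilon> * h * (\<integral>\<omega>. Y \<omega> * N k \<omega> \<partial>P)"
        using \<epsilon> h by (intro mult_left_mono) auto
      then show ?thesis by (simp add: \<epsilon>'_def)
    qed
    finally show ?thesis .
  qed
  \<comment> \<open>Raising the factor \<open>k\<close> to \<open>Suc k\<close> adds one expectation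
    of \<open>U k\<close>, which is at most \<open>1 + \<delta>\<close> times that of
    \<open>N k\<close>. \<open>\<rho>\<close> is chosen so that the decrease of the \<open>V\<close>
    term is exactly this amount.\<close>
  define \<rho> where "\<rho> = (1 + \<delta>) / (\<epsilon> * h)"
  have \<rho>: "0 < \<rho>" "\<rho> * (\<epsilon> * h) = 1 + \<delta>" using \<epsilon> h \<delta> by (simp_all add: \<rho>_def)
  define S where "S k = real k * (\<integral>\<omega>. I k \<omega> * U k \<omega> \<partial>P) + \<rho> * (\<integral>\<omega>. I k \<omega> * V k \<omega> \<partial>P)" for k
  have S0: "0 \<le> S k" for k
    using I01(1) U0 V0 \<rho>(1) by (auto simp: S_def intro!: add_nonneg_nonneg mult_nonneg_nonneg integral_nonneg)
  have step: "S (Suc k) \<le> S k - real (Suc k) * \<epsilon>' * prob (A k)" for k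
  proof -
    have m1: "(\<integral>\<omega>. I (Suc k) \<omega> * U (Suc k) \<omega> \<partial>P) \<le> (\<integral>\<omega>. I k \<omega> * U (Suc k) \<omega> \<partial>P)"
      by (intro integral_mono Uint mult_right_mono IS U0)
    have m2: "(\<integral>\<omega>. I (Suc k) \<omega> * V (Suc k) \<omega> \<partial>P) \<le> (\<integral>\<omega>. I k \<omega> * V (Suc k) \<omega> \<partial>P)"
      by (intro integral_mono Vint IP I01 mult_right_mono IS V0)
    have m3: "(\<integral>\<omega>. I k \<omega> * U k \<omega> \<partial>P) \<le> (1 + \<delta>) * (\<integral>\<omega>. I k \<omega> * N k \<omega> \<partial>P)"
    proof -
      have "(\<integral>\<omega>. I k \<omega> * U k \<omega> \<partial>P) \<le> (\<integral>\<omega>. (1 + \<delta>) * (I k \<omega> * N k \<omega>) \<partial>P)"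
      proof (rule integral_mono)
        fix \<omega> show "I k \<omega> * U k \<omega> \<le> (1 + \<delta>) * (I k \<omega> * N k \<omega>)"
          using mult_left_mono[OF bnd(2) I01(1)[of k \<omega>]] by (cases "I k \<omega> = 0") (auto simp: mult.left_commute)
      qed (use Uint Nint[OF IP I01] in auto)
      then show ?thesis by simp
    qed
    have "real (Suc k) * (\<integral>\<omega>. I (Suc k) \<omega> * U (Suc k) \<omega> \<partial>P) \<le> real (Suc k) * ((\<integral>\<omega>. I k \<omega> * U k \<omega> \<partial>P) - \<epsilon>' * prob (A k))"
      using m1 d2[of k] by (intro mult_left_mono) auto
    moreover have "\<rho> * (\<integral>\<omega>. I (Suc k) \<omega> * V (Suc k) \<omega> \<partial>P) \<le> \<rho> * ((\<integral>\<omega>. I k \<omega> * V k \<omega> \<partial>P) - \<epsilon> * h * (\<integral>\<omega>. I k \<omega> * N k \<omega> \<partial>P))"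
      using m2 d1[of k] \<rho>(1) by (intro mult_left_mono) auto
    moreover have "\<rho> * ((\<integral>\<omega>. I k \<omega> * V k \<omega> \<partial>P) - \<epsilon> * h * (\<integral>\<omega>. I k \<omega> * N k \<omega> \<partial>P)) =
        \<rho> * (\<integral>\<omega>. I k \<omega> * V k \<omega> \<partial>P) - (1 + \<delta>) * (\<integral>\<omega>. I k \<omega> * N k \<omega> \<partial>P)"
      by (simp only: right_diff_distrib mult.assoc[symmetric] \<rho>(2)[symmetric])
    moreover have "real (Suc k) * ((\<integral>\<omega>. I k \<omega> * U k \<omega> \<partial>P) - \<epsilon>' * prob (A k)) =
        real k * (\<integral>\<omega>. I k \<omega> * U k \<omega> \<partial>P) + (\<integral>\<omega>. I k \<omega> * U k \<omega> \<partial>P) - real (Suc k) * \<epsilon>' * prob (A k)"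
      by (simp add: algebra_simps)
    ultimately show ?thesis using m3 unfolding S_def by linarith
  qed
  have sum: "S n + (\<Sum>k<n. real (Suc k) * \<epsilon>' * prob (A k)) \<le> S 0" for n
  proof (induction n)
    case (Suc n)
    then show ?case using step[of n] by simp
  qed simp
  have S0le: "S 0 \<le> \<rho> * lyap \<delta> x z"
  proof -
    have "AE \<omega> in P. Z 0 \<omega> = z" using chain by (simp add: two_state_chain_def)
    then have ae: "AE \<omega> in P. I 0 \<omega> * V 0 \<omega> \<le> lyap \<delta> x z"
      using AE_X_0
    proof eventually_elim
      case (elim \<omega>)
      have "V 0 \<omega> = lyap \<delta> x z" using elim by (simp add: V_def T_def)
      then show ?case using mult_right_mono[OF I01(2)[of 0 \<omega>] V0[of 0 \<omega>]] by simp
    qed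
    have "(\<integral>\<omega>. I 0 \<omega> * V 0 \<omega> \<partial>P) \<le> (\<integral>\<omega>. lyap \<delta> x z \<partial>P)"
      by (rule integral_mono_AE[OF Vint[OF IP I01] _ ae]) simp
    then have "(\<integral>\<omega>. I 0 \<omega> * V 0 \<omega> \<partial>P) \<le> lyap \<delta> x z" by (simp add: prob_space)
    then show ?thesis using \<rho>(1) by (simp add: S_def)
  qed
  have psum: "(\<Sum>k<n. real (Suc k) * prob (A k)) \<le> \<rho> * lyap \<delta> x z / \<epsilon>'" for n
  proof -
    have "\<epsilon>' * (\<Sum>k<n. real (Suc k) * prob (A k)) \<le> \<rho> * lyap \<delta> x z"
      using sum[of n] S0[of n] S0le by (simp add: sum_distrib_left mult.assoc mult.left_commute)
    then show ?thesis using \<epsilon>' by (simp add: pos_le_divide_eq mult.commute)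
  qed
  have "(\<integral>\<^sup>+ \<omega>. (hit_time X M1 \<omega>)\<^sup>2 \<partial>P) \<le> (\<integral>\<^sup>+ \<omega>. (\<Sum>k. ennreal (h\<^sup>2 * (2 * real k + 1)) * indicator (A k) \<omega>) \<partial>P)"
  proof (rule nn_integral_mono)
    fix \<omega> assume "\<omega> \<in> space P"
    then have "of_bool (\<forall>j\<le>k. M1 < norm (X (real j * h) \<omega>)) = (indicator (A k) \<omega> :: ennreal)" for k
      by (simp add: A_def T_def indicator_def)
    then show "(hit_time X M1 \<omega>)\<^sup>2 \<le> (\<Sum>k. ennreal (h\<^sup>2 * (2 * real k + 1)) * indicator (A k) \<omega>)"
      using hit_time_square_le[OF h, of X M1 \<omega>] by simp
  qed
  also have "\<dots> = (\<Sum>k. \<integral>\<^sup>+ \<omega>. ennreal (h\<^sup>2 * (2 * real k + 1)) * indicator (A k) \<omega> \<partial>P)"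
    by (rule nn_integral_suminf) measurable
  also have "\<dots> = (\<Sum>k. ennreal (h\<^sup>2 * (2 * real k + 1) * prob (A k)))"
    by (simp add: nn_integral_cmult_indicator emeasure_eq_measure ennreal_mult)
  also have "\<dots> \<le> ennreal (2 * h\<^sup>2 * (\<rho> * lyap \<delta> x z / \<epsilon>'))"
  proof (rule suminf_le_const)
    fix n
    have "(\<Sum>k<n. ennreal (h\<^sup>2 * (2 * real k + 1) * prob (A k))) = ennreal (\<Sum>k<n. h\<^sup>2 * (2 * real k + 1) * prob (A k))"
      by (rule sum_ennreal) simp
    also have "\<dots> \<le> ennreal (2 * h\<^sup>2 * (\<rho> * lyap \<delta> x z / \<epsilon>'))"
    proof (rule ennreal_leI)
      have "(\<Sum>k<n. h\<^sup>2 * (2 * real k + 1) * prob (A k)) \<le> (\<Sum>k<n. 2 * h\<^sup>2 * (real (Suc k) * prob (A k)))"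
      proof (rule sum_mono)
        fix k
        have "h\<^sup>2 * prob (A k) * (2 * real k + 1) \<le> h\<^sup>2 * prob (A k) * (2 * real (Suc k))"
          by (intro mult_left_mono) auto
        then show "h\<^sup>2 * (2 * real k + 1) * prob (A k) \<le> 2 * h\<^sup>2 * (real (Suc k) * prob (A k))"
          by (simp only: mult.commute mult.left_commute mult.assoc)
      qed
      also have "\<dots> = 2 * h\<^sup>2 * (\<Sum>k<n. real (Suc k) * prob (A k))" by (simp add: sum_distrib_left)
      also have "\<dots> \<le> 2 * h\<^sup>2 * (\<rho> * lyap \<delta> x z / \<epsilon>')" by (intro mult_left_mono psum) simp
      finally show "(\<Sum>k<n. h\<^sup>2 * (2 * real k + 1) * prob (A k)) \<le> 2 * h\<^sup>2 * (\<rho> * lyap \<delta> x z / \<epsilon>')" .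
    qed
    finally show "(\<Sum>k<n. ennreal (h\<^sup>2 * (2 * real k + 1) * prob (A k))) \<le> ennreal (2 * h\<^sup>2 * (\<rho> * lyap \<delta> x z / \<epsilon>'))" .
  qed simp
  \<comment> \<open>Both \<open>\<rho>\<close> and the inverse of \<open>\<epsilon>'\<close> are of
    order 1/h, so the step length cancels and the final constant does not depend on it.\<close>
  also have "2 * h\<^sup>2 * (\<rho> * lyap \<delta> x z / \<epsilon>') = 4 * ((1 + \<delta>) / \<epsilon>)\<^sup>2 * lyap \<delta> x z"
    using h \<epsilon> \<delta> by (simp add: \<rho>_def \<epsilon>'_def field_simps power2_eq_square)
  finally show ?thesis .
qed

end

theorem theorem1:
  fixes b :: "'v::euclidean_space \<Rightarrow> nat \<Rightarrow> 'v"
    and lm lp M rm rp Rm Rp :: real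
  assumes "lm > 0" and "lp > 0"
    and "\<exists>B. \<forall>y z. z \<in> {0, 1} \<longrightarrow> norm (b y z) \<le> B"
    and "(\<lambda>y. b y 0) \<in> borel_measurable borel" and "(\<lambda>y. b y 1) \<in> borel_measurable borel"
    and "M > 0" and "rm > 0" and "rp > 0"
    and "\<forall>y. norm y \<ge> M \<longrightarrow>
           y \<bullet> b y 0 \<le> - rm \<and> y \<bullet> b y 1 \<le> rp \<and> y \<bullet> b y 0 \<ge> - Rm \<and> y \<bullet> b y 1 \<ge> Rp"
    and "(6 * rm - (3 * real DIM('v) + 12)) / lm > (6 * rp + (3 * real DIM('v) + 12)) / lp"
  shows "\<exists>C>0. \<exists>M0. \<forall>M1\<ge>M0. \<forall>(x::'v) z. z \<in> {0, 1} \<longrightarrow>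
           (\<forall>(P::'a measure) W Z X. switching_solution P lm lp b x z W Z X \<longrightarrow>
              (\<integral>\<^sup>+ \<omega>. (hit_time X M1 \<omega>)^2 \<partial>P) \<le> ennreal (C * ((norm x)^6 + 1)))"
proof -
  obtain B where B: "\<And>y k. k \<in> {0, 1} \<Longrightarrow> norm (b y k) \<le> B"
    using assms(3) by blast
  define D where "D = real DIM('v)"
  \<comment> \<open>Chosen so that the rate in state 1 is exactly -4 before errors; the hypothesis
    then makes the rate in state 0 smaller than -4, which is \<open>\<delta>m\<close> below.\<close>
  define \<delta> where "\<delta> = (4 * rp + 2 * D + 8) / lp"
  have D: "0 \<le> D" by (simp add: D_def)
  have \<delta>: "0 < \<delta>" using assms(2,8) D by (simp add: \<delta>_def)
  have \<delta>p: "\<delta> * lp = 4 * rp + 2 * D + 8" using assms(2) by (simp add: \<delta>_def)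
  have \<delta>m: "\<delta> * lm < 4 * rm - 2 * D - 8"
  proof -
    have "(6 * rp + (3 * D + 12)) / lp = 3 / 2 * \<delta>" using assms(2) by (simp add: \<delta>_def field_simps)
    then have "3 / 2 * \<delta> < (6 * rm - (3 * D + 12)) / lm" using assms(10) unfolding D_def by linarith
    then have "3 / 2 * \<delta> * lm < 6 * rm - (3 * D + 12)" using assms(1) by (simp add: pos_less_divide_eq)
    then show ?thesis by simp
  qed
  \<comment> \<open>\<open>L\<close> and \<open>E\<close> spell out \<open>K\<close> and the error
    term of \<open>lyap_drift\<close>: the step \<open>h\<close> has to be fixed before any process
    is given, while \<open>K\<close> and \<open>err\<close> exist only inside the locale.\<close>
  define L where "L = B + B * M + rm"
  define E where "E h = 4 * ((rm + rp) * ((lm + lp) * h) + L * (B * h + sqrt (D * h))) + 12 * B * sqrt (D * h) + 6 * B\<^sup>2 * h + \<delta> * lp * (lm + lp) * h" for h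
  have "(E \<longlongrightarrow> E 0) (at_right 0)"
    unfolding E_def by (intro tendsto_intros)
  \<comment> \<open>\<open>E\<close> is continuous from the right and vanishes at 0. The threshold 2
    turns the rate -4 into at most -2, that is, \<open>\<epsilon>\<close> is 1 in
    \<open>lyap_drift\<close>.\<close>
  then have "eventually (\<lambda>h. E h < 2) (at_right 0)"
    by (rule order_tendstoD) (simp add: E_def)
  then have "eventually (\<lambda>h. E h < 2 \<and> 0 < h) (at_right 0)"
    using eventually_at_right_less[of 0] by (rule eventually_conj)
  then obtain h where h: "E h < 2" "0 < h"
    using eventually_happens[of _ "at_right (0::real)"] by auto
  define Q where "Q = (5 + 3 * \<delta>) * (8 * ((1 + B * h) ^ 4 + 3 * D\<^sup>2 * h\<^sup>2))"
  \<comment> \<open>\<open>M + 1\<close> lets the drift bounds survive a small displacement, and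
    \<open>Q / h\<close> makes the remainder of order |X_t| negligible. Neither depends on the
    starting point or on the process.\<close>
  define M0 where "M0 = max (M + 1) (Q / h)"
  define C where "C = 4 * (1 + \<delta>)\<^sup>2 * (1 + \<delta>)"
  have "0 < C" using \<delta> by (simp add: C_def)
  moreover have "(\<integral>\<^sup>+ \<omega>. (hit_time X M1 \<omega>)^2 \<partial>P) \<le> ennreal (C * ((norm x)^6 + 1))"
    if M1: "M0 \<le> M1" and z: "z \<in> {0, 1}" and sol: "switching_solution P lm lp b x z W Z X"
    for M1 and x :: 'v and z and P :: "'a measure" and W Z X
  proof -
    interpret switching_drift P lm lp b x z W Z X B M rm rp
      by unfold_locales (use sol assms B in auto)
    have Eeq: "E h = 4 * err h + 12 * B * sqrt (real DIM('v) * h) + 6 * B\<^sup>2 * h + \<delta> * lp * (lm + lp) * h"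
      by (simp add: E_def err_def K_def L_def D_def)
    have "Q / h \<le> M1" "M + 1 \<le> M1" using M1 by (simp_all add: M0_def)
    then have Q: "Q \<le> 1 * h * M1" using h(2) by (simp add: pos_divide_le_eq mult.commute)
    have "(\<integral>\<^sup>+ \<omega>. (hit_time X M1 \<omega>)\<^sup>2 \<partial>P) \<le> ennreal (4 * ((1 + \<delta>) / 1)\<^sup>2 * lyap \<delta> x z)"
    proof (rule hit_time_second_moment[OF h(2)])
      fix k and Y :: "'a \<Rightarrow> real"
      assume Y: "Y \<in> borel_measurable (F (real k * h))" "\<And>\<omega>. 0 \<le> Y \<omega>" "\<And>\<omega>. Y \<omega> \<le> 1"
        "\<And>\<omega>. Y \<omega> \<noteq> 0 \<Longrightarrow> M1 \<le> norm (X (real k * h) \<omega>)"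
      show "(\<integral>\<omega>. Y \<omega> * lyap \<delta> (X (real k * h + h) \<omega>) (Z (real k * h + h) \<omega>) \<partial>P) \<le>
        (\<integral>\<omega>. Y \<omega> * lyap \<delta> (X (real k * h) \<omega>) (Z (real k * h) \<omega>) \<partial>P) - 1 * h * (\<integral>\<omega>. Y \<omega> * (norm (X (real k * h) \<omega>))\<^sup>2 \<partial>P)"
        using Y(4) \<open>M + 1 \<le> M1\<close> h \<delta> \<delta>m \<delta>p Q
        by (intro lyap_drift[OF Y(1-3), where E="E h"] Eeq) (auto simp: Q_def D_def)
    qed (use \<delta> \<open>M + 1 \<le> M1\<close> assms(6) in auto)
    also have "\<dots> \<le> ennreal (C * ((norm x) ^ 6 + 1))"
    proof (rule ennreal_leI)
      \<comment> \<open>The bound obtained is of order |x|^4; it is relaxed here to the sixth power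
        of the claim.\<close>
      have p: "norm x ^ j \<le> norm x ^ 6 + 1" if "j \<le> 6" for j
      proof (cases "norm x \<le> 1")
        case True
        then show ?thesis using power_le_one[of "norm x" j] by (simp add: add_increasing)
      next
        case False
        then have "norm x ^ j \<le> norm x ^ 6" using that by (intro power_increasing) auto
        then show ?thesis by simp
      qed
      have "(norm x)\<^sup>2 * real z \<le> (norm x)\<^sup>2 * 1" using z by (intro mult_left_mono) auto
      then have "\<delta> * ((norm x)\<^sup>2 * real z) \<le> \<delta> * (norm x ^ 6 + 1)"
        using p[of 2] \<delta> by (intro mult_left_mono) auto
      then have "lyap \<delta> x z \<le> (1 + \<delta>) * (norm x ^ 6 + 1)"
        using p[of 4] by (simp add: lyap_def algebra_simps)
      then have "4 * (1 + \<delta>)\<^sup>2 * lyap \<delta> x z \<le> 4 * (1 + \<delta>)\<^sup>2 * ((1 + \<delta>) * (norm x ^ 6 + 1))"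
        by (rule mult_left_mono) simp
      then show "4 * ((1 + \<delta>) / 1)\<^sup>2 * lyap \<delta> x z \<le> C * ((norm x) ^ 6 + 1)"
        by (simp add: C_def mult.assoc)
    qed
    finally show ?thesis .
  qed
  ultimately show ?thesis by blast
qed

end
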